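(* Let $d=1+\Pi^n\sum_{0\le j<p^s}b_ju^j$ with all $b_j\in B$ and $1\le n<p^{r+s-1}$. Then $$\mathrm{nr}(d)-1\equiv\sum_k{}^{*}\ \sum_{0\le v<p^{s-k}}(1+T)^v\,\mathrm{Tr}_{\mathfrak g/\mathfrak g^{p^k}}\big(N_{\mathfrak g^{p^k}}(\Pi^nb_{p^kv})\big)\pmod{\pi^{\Phi(n)+1}A},$$ with each term of the sum in $\pi^{\Phi(n)}A$. Here $\sum^*_k$ means that $k$ is restricted to those $k$ with $\Phi_k(n)=\Phi(n)$, i.e. to $k=w$ when $n$ is ordinary of weight $w$, and to $k\in\{w,w+1\}$ when $n$ is transitional of weight $w$.
   Context: Let $p$ be an odd prime, $r\ge1$, $s\ge1$ integers, $F/\mathbb Q_p$ a finite unramified extension with ring of integers $\mathfrak O$. Fix primitive $p^m$-th roots of unity $\zeta_m$ with $\zeta_0=1$, $\zeta_m^p=\zeta_{m-1}$; put $\mathfrak O_m=\mathfrak O[\zeta_m]$, $\pi_m=1-\zeta_m$, $\Pi=\pi_{r+s}$, $\pi=\pi_r$, $A=\mathfrak O_r[[T]]$, $B=\mathfrak O_{r+s}[[T]]$, with fraction fields $\mathfrak q(A),\mathfrak q(B)$. Let $\mathfrak g=\langle g\rangle=\mathrm{Gal}(\mathfrak q(B)/\mathfrak q(A))$, cyclic of order $p^s$, with $g$ fixing $\mathfrak q(A)$ and $\zeta_{r+s}\mapsto\zeta_{r+s}^{1+p^r}$. $D=\bigoplus_{j=0}^{p^s-1}\mathfrak q(B)u^j$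 with $ub={}^gb\,u$ and $u^{p^s}=1+T$ is a division algebra with centre $\mathfrak q(A)$, $\Delta=\bigoplus_{j=0}^{p^s-1}Bu^j$ is an $A$-order in $D$, and $\mathrm{nr}:D\to\mathfrak q(A)$ is the reduced norm. $\mathfrak g^{p^k}$ is the subgroup generated by $g^{p^k}$; $N_{\mathfrak g^{p^k}}(b)=\prod_{h\in\mathfrak g^{p^k}}{}^hb$ for $b\in B$, and $\mathrm{Tr}_{\mathfrak g/\mathfrak g^{p^k}}(c)=\sum_{h\in\mathfrak g/\mathfrak g^{p^k}}{}^hc$ for $c\in B$ fixed by $\mathfrak g^{p^k}$. For $n\ge1$, $k\ge0$: $\Phi_k(n)=k\phi(p^r)+\lfloor n/p^k\rfloor$ with $\phi$ Euler's function, and $\Phi(n)=\min_{k\ge0}\Phi_k(n)$. The weight $w$ of $n$ is the smallest $w\ge0$ with $n<p^{r+w}+p^w$; $n$ of weight $w$ is ordinary if $n<p^{r+w}-p^w$, and transitional if $p^{r+w}-p^w\le n<p^{r+w}+p^w$. *)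

theory Defs
  imports
    "HOL-Algebra.Algebraic_Closure_Type"
    "HOL-Algebra.Bij"
    "HOL-Algebra.Left_Coset"
    "HOL-Number_Theory.Totient"
    "Jordan_Normal_Form.Determinant"
begin

text \<open>
  All number fields live inside one ambient field of type \<open>'a\<close> (for instance an algebraic closure
  of \<open>\<rat>\<^sub>p\<close>), and all rings of power series and their fraction fields inside the Laurent series
  field \<open>'a fls\<close>. Subrings and subfields are sets.
\<close>


section \<open>The field of \<open>p\<close>-adic numbers and its unramified extensions\<close>

definition padic_abs :: "nat \<Rightarrow> rat \<Rightarrow> real" where
  "padic_abs p q =
     (if q = 0 then 0
      else case quotient_of q of (a, b) \<Rightarrow>
        real p powi (int (multiplicity (int p) b) - int (multiplicity (int p) a)))"

text \<open>
  \<open>Qp\<close> with the absolute value \<open>av\<close> is the completion of \<open>\<rat>\<close> with respect to the \<open>p\<close>-adic absolute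
  value; \<open>av\<close> is only relevant on \<open>Qp\<close>.
\<close>

definition padic_field :: "nat \<Rightarrow> 'a::field_char_0 set \<Rightarrow> ('a \<Rightarrow> real) \<Rightarrow> bool" where
  "padic_field p Qp av \<longleftrightarrow>
     subfield Qp ring_of_type_algebra \<and>
     (\<forall>x\<in>Qp. av x \<ge> 0 \<and> (av x = 0 \<longleftrightarrow> x = 0)) \<and>
     (\<forall>x\<in>Qp. \<forall>y\<in>Qp. av (x * y) = av x * av y \<and> av (x + y) \<le> av x + av y) \<and>
     (\<forall>q. av (of_rat q) = padic_abs p q) \<and>
     (\<forall>x\<in>Qp. \<forall>e>0. \<exists>q. av (x - of_rat q) < e) \<and>
     (\<forall>a::nat \<Rightarrow> 'a. (\<forall>i. a i \<in> Qp) \<and> (\<forall>e>0. \<exists>N. \<forall>i\<ge>N. \<forall>j\<ge>N. av (a i - a j) < e) \<longrightarrow>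
        (\<exists>x\<in>Qp. (\<lambda>i. av (a i - x)) \<longlonglongrightarrow> 0))"

definition integral_closure :: "'a::field set \<Rightarrow> 'a set \<Rightarrow> 'a set" where
  "integral_closure R F =
     {x \<in> F. \<exists>q. lead_coeff q = 1 \<and> (\<forall>i. poly.coeff q i \<in> R) \<and> poly q x = 0}"

definition ring_of_integers :: "'a::field set \<Rightarrow> ('a \<Rightarrow> real) \<Rightarrow> 'a set \<Rightarrow> 'a set" where
  "ring_of_integers Qp av F = integral_closure {x \<in> Qp. av x \<le> 1} F"

text \<open>
  Unramified: the maximal ideal \<open>p\<int>\<^sub>p\<close> of \<open>\<int>\<^sub>p\<close> generates the maximal ideal of the ring of
  integers of \<open>F\<close>. The residue field extension is one of finite fields, hence separable.
\<close>

definition finite_unramified_extension ::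
    "nat \<Rightarrow> 'a::field set \<Rightarrow> ('a \<Rightarrow> real) \<Rightarrow> 'a set \<Rightarrow> bool" where
  "finite_unramified_extension p Qp av F \<longleftrightarrow>
     subfield F ring_of_type_algebra \<and> Qp \<subseteq> F \<and>
     ring.finite_dimension ring_of_type_algebra Qp F \<and>
     maximalideal ((\<lambda>x. of_nat p * x) ` ring_of_integers Qp av F)
       (ring_of_type_algebra \<lparr>carrier := ring_of_integers Qp av F\<rparr>)"

definition primitive_root_of_unity :: "nat \<Rightarrow> 'a::field \<Rightarrow> bool" where
  "primitive_root_of_unity N z \<longleftrightarrow> z ^ N = 1 \<and> (\<forall>i. 0 < i \<and> i < N \<longrightarrow> z ^ i \<noteq> 1)"

definition adjoin :: "'a::field set \<Rightarrow> 'a \<Rightarrow> 'a set" where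
  "adjoin R z = {poly q z |q. \<forall>i. poly.coeff q i \<in> R}"


section \<open>Power series rings, fraction fields and Galois groups\<close>

definition power_series_ring :: "'a::field set \<Rightarrow> 'a fls set" where
  "power_series_ring R = fps_to_fls ` {f. \<forall>i. fps_nth f i \<in> R}"

definition fraction_field :: "'b::field set \<Rightarrow> 'b set" where
  "fraction_field R = {x / y |x y. x \<in> R \<and> y \<in> R \<and> y \<noteq> 0}"

text \<open>As in \<^const>\<open>BijGroup\<close>, automorphisms of \<open>L\<close> are extended by \<^const>\<open>undefined\<close> outside \<open>L\<close>.\<close>

definition galois_group :: "'b::field set \<Rightarrow> 'b set \<Rightarrow> ('b \<Rightarrow> 'b) monoid" where
  "galois_group L K = BijGroup L
     \<lparr>carrier := {h \<in> Bij L. (\<forall>x\<in>L. \<forall>y\<in>L. h (x + y) = h x + h y \<and> h (x * y) = h x * h y) \<and>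
                              (\<forall>x\<in>K. h x = x)}\<rparr>"

definition norm_over :: "('b::field \<Rightarrow> 'b) set \<Rightarrow> 'b \<Rightarrow> 'b" where
  "norm_over H x = (\<Prod>h\<in>H. h x)"

text \<open>
  If \<open>x\<close> is fixed by \<open>H\<close>, then all elements of a left coset of \<open>H\<close> agree on \<open>x\<close>.
\<close>

definition trace_mod :: "('b::field \<Rightarrow> 'b) monoid \<Rightarrow> ('b \<Rightarrow> 'b) set \<Rightarrow> 'b \<Rightarrow> 'b" where
  "trace_mod G H x = (\<Sum>C \<in> lcosets\<^bsub>G\<^esub> H. the_elem ((\<lambda>h. h x) ` C))"


section \<open>Cyclic algebras and the reduced norm\<close>

text \<open>
  The algebra \<open>\<Oplus>\<^bsub>j<n\<^esub> L u\<^sup>j\<close> with \<open>u x = g(x) u\<close> and \<open>u\<^sup>n = c\<close>, for \<open>c\<close> fixed by \<open>g\<close>. The element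
  \<open>\<Sum>\<^bsub>j<n\<^esub> x\<^sub>j u\<^sup>j\<close> is represented by the function \<open>j \<mapsto> x\<^sub>j\<close>, which is \<open>0\<close> for \<open>j \<ge> n\<close>. Thus
  \<open>(x u\<^sup>i) (y u\<^sup>j) = x g\<^sup>i(y) c\<^sup>q u\<^sup>k\<close> where \<open>i + j = q n + k\<close> and \<open>k < n\<close>.
\<close>

definition cyclic_algebra ::
    "'b::field set \<Rightarrow> ('b \<Rightarrow> 'b) \<Rightarrow> nat \<Rightarrow> 'b \<Rightarrow> (nat \<Rightarrow> 'b) ring" where
  "cyclic_algebra L g n c =
     \<lparr>carrier = {x. (\<forall>j<n. x j \<in> L) \<and> (\<forall>j\<ge>n. x j = 0)},
      monoid.mult = (\<lambda>x y k. \<Sum>i<n. \<Sum>j<n.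
        if (i + j) mod n = k then x i * (g ^^ i) (y j) * c ^ ((i + j) div n) else 0),
      one = (\<lambda>j. if j = 0 then 1 else 0),
      ring.zero = (\<lambda>j. 0),
      add = (\<lambda>x y j. x j + y j)\<rparr>"

definition cyclic_embed :: "'b::field \<Rightarrow> nat \<Rightarrow> 'b" where
  "cyclic_embed x = (\<lambda>j. if j = 0 then x else 0)"

text \<open>The element \<open>u\<close>, provided \<open>n > 1\<close>.\<close>

definition cyclic_gen :: "nat \<Rightarrow> 'b::field" where
  "cyclic_gen = (\<lambda>j. if j = 1 then 1 else 0)"

text \<open>
  Let \<open>D\<close> be a \<open>K\<close>-algebra with structure map \<open>\<iota>\<close>. A homomorphism \<open>\<rho>\<close> of \<open>K\<close>-algebras from \<open>D\<close> to
  \<open>M\<^sub>m(E)\<close> is a splitting of \<open>D\<close> over the extension field \<open>E\<close> if the induced map from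
  \<open>E \<otimes>\<^sub>K D\<close> to \<open>M\<^sub>m(E)\<close> is an isomorphism, i.e. if \<open>\<rho>\<close> maps some \<open>K\<close>-basis \<open>x\<^sub>0, \<dots>\<close> of \<open>D\<close> to an
  \<open>E\<close>-basis of \<open>M\<^sub>m(E)\<close>.
\<close>

definition matrices_over :: "'b set \<Rightarrow> nat \<Rightarrow> 'b mat set" where
  "matrices_over E m = {M \<in> carrier_mat m m. elements_mat M \<subseteq> E}"

definition splitting ::
    "'b::field set \<Rightarrow> ('b \<Rightarrow> 'd) \<Rightarrow> 'd ring \<Rightarrow> 'b set \<Rightarrow> nat \<Rightarrow> ('d \<Rightarrow> 'b mat) \<Rightarrow> bool" where
  "splitting K \<iota> D E m \<rho> \<longleftrightarrow>
     subfield E ring_of_type_algebra \<and> K \<subseteq> E \<and>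
     \<rho> \<in> Ring.ring_hom D (ring_mat TYPE('b) m ()) \<and>
     \<rho> ` carrier D \<subseteq> matrices_over E m \<and>
     (\<forall>a\<in>K. \<rho> (\<iota> a) = a \<cdot>\<^sub>m 1\<^sub>m m) \<and>
     (\<exists>N x. (\<forall>i<N. x i \<in> carrier D) \<and>
        (\<forall>d\<in>carrier D. \<exists>!c. c \<in> {..<N::nat} \<rightarrow>\<^sub>E K \<and> d = (\<Oplus>\<^bsub>D\<^esub>i\<in>{..<N}. \<iota> (c i) \<otimes>\<^bsub>D\<^esub> x i)) \<and>
        (\<forall>M\<in>matrices_over E m. \<exists>!c. c \<in> {..<N} \<rightarrow>\<^sub>E E \<and>
           M = mat m m (\<lambda>(i, j). \<Sum>l<N. c l * \<rho> (x l) $$ (i, j))))"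

text \<open>
  For a central simple \<open>K\<close>-algebra \<open>D\<close> the determinant below does not depend on the splitting. The
  splitting fields considered are those inside the ambient field \<open>'b\<close>; for
  \<^const>\<open>cyclic_algebra\<close> the field \<open>L\<close> is one of them.
\<close>

definition reduced_norm :: "'b::field set \<Rightarrow> ('b \<Rightarrow> 'd) \<Rightarrow> 'd ring \<Rightarrow> 'd \<Rightarrow> 'b" where
  "reduced_norm K \<iota> D d = (THE z. \<exists>E m \<rho>. splitting K \<iota> D E m \<rho> \<and> z = det (\<rho> d))"


section \<open>The numerical functions\<close>

definition Phi_k :: "nat \<Rightarrow> nat \<Rightarrow> nat \<Rightarrow> nat \<Rightarrow> nat" where
  "Phi_k p r k n = k * totient (p ^ r) + n div p ^ k"

definition Phi :: "nat \<Rightarrow> nat \<Rightarrow> nat \<Rightarrow> nat" where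
  "Phi p r n = (INF k. Phi_k p r k n)"

definition weight :: "nat \<Rightarrow> nat \<Rightarrow> nat \<Rightarrow> nat" where
  "weight p r n = (LEAST w. n < p ^ (r + w) + p ^ w)"

definition ordinary :: "nat \<Rightarrow> nat \<Rightarrow> nat \<Rightarrow> bool" where
  "ordinary p r n \<longleftrightarrow> n < p ^ (r + weight p r n) - p ^ weight p r n"

definition transitional :: "nat \<Rightarrow> nat \<Rightarrow> nat \<Rightarrow> bool" where
  "transitional p r n \<longleftrightarrow>
     p ^ (r + weight p r n) - p ^ weight p r n \<le> n \<and> n < p ^ (r + weight p r n) + p ^ weight p r n"

end

theory Submission
  imports Defs "Jordan_Normal_Form.Char_Poly" "HOL-Number_Theory.Pocklington"
begin

text \<open>
  The algebra \<open>D\<close> is split by its maximal subfield \<open>L = Frac(B)\<close>: right multiplication by \<open>d\<close> in the left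
  basis \<open>u\<^sup>j\<close> is a matrix \<open>1 + M\<close>, and \<open>nr(d)\<close> is its determinant. Expand the determinant into terms
  indexed by pairs of a set \<open>S\<close> of residues modulo \<open>p\<^sup>s\<close> and a permutation of \<open>S\<close>. Conjugation by \<open>u\<close>
  translates these pairs and acts on the terms through \<open>g\<close>. The terms of an orbit of length \<open>p\<^sup>k\<close> add
  up to a trace from the fixed ring of \<open>g\<close> to the power \<open>p\<^sup>k\<close>; such a set \<open>S\<close> is a union of \<open>m\<close> cosets
  of the subgroup generated by \<open>p\<^sup>k\<close>, and the sum lies in the ideal generated by \<open>\<pi>\<close> to the power
  \<open>\<Phi>\<^sub>k(m n)\<close>. The case \<open>m = 1\<close> gives exactly the traces of norms in the theorem, \<open>m = 0\<close> gives \<open>1\<close>,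
  and for \<open>m \<ge> 2\<close> one has \<open>\<Phi>\<^sub>k(2 n) > \<Phi>(n)\<close>.

  The estimate for traces needs no information on differents: an element \<open>y\<close> of \<open>B\<close> has full trace
  \<open>p\<^sup>s a\<close> with \<open>a \<in> A\<close>, and if \<open>y\<close> is fixed by \<open>g\<close> to the power \<open>p\<^sup>k\<close>, its trace from that fixed ring is
  therefore \<open>p\<^sup>k a\<close>.
\<close>

section \<open>Subrings and integral closures\<close>

text \<open>\<open>reduced_norm\<close> is a \<open>THE\<close> over all splittings inside the
  ambient field, so one splitting determines it only after any two are shown to give the same
  determinant. The degree of the extension and the independence of the powers of z =
  \<open>\<zeta> (r + s)\<close> are not imported from field theory. The conjugates of z are the q =
  p^s solutions of x^q = z^q, so the powers z^t behave like characters; their orthogonality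
  relations yield the coordinates, the fixed ring, the splitting and the divisibility of full traces
  by q. The ring A is no discrete valuation ring, and no valuation occurs: every estimate exhibits a
  cofactor. Three divisibilities supply the exponents: 1 - z divides its conjugates, \<pi> = 1 - z^q
  divides (1 - z)^q in B, and \<pi> to the power \<phi>(p^r) divides p in A. By the first two, a
  minor on S contains a power of \<pi>, rounded down because q need not divide n card S; the third
  turns the factor p^k of a partial trace into k \<phi>(p^r). These are the two summands of
  \<Phi>_k. Oddness of p enters in the evenness of the permutations for m = 1, in the order of 1 +
  p^r modulo p^(r+s), and in the congruence for (1 - z)^q.\<close>

locale unital_subring =
  fixes R :: "'a::comm_ring_1 set"
  assumes zero_mem: "0 \<in> R" and one_mem: "1 \<in> R"
    and add_mem: "x \<in> R \<Longrightarrow> y \<in> R \<Longrightarrow> x + y \<in> R"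
    and mult_mem: "x \<in> R \<Longrightarrow> y \<in> R \<Longrightarrow> x * y \<in> R"
    and uminus_mem: "x \<in> R \<Longrightarrow> - x \<in> R"
begin

lemma diff_mem: "x \<in> R \<Longrightarrow> y \<in> R \<Longrightarrow> x - y \<in> R"
  using add_mem[OF _ uminus_mem, of x y] by simp

lemma sum_mem: "(\<And>i. i \<in> I \<Longrightarrow> f i \<in> R) \<Longrightarrow> sum f I \<in> R"
  by (induction I rule: infinite_finite_induct) (auto intro: zero_mem add_mem)

lemma prod_mem: "(\<And>i. i \<in> I \<Longrightarrow> f i \<in> R) \<Longrightarrow> prod f I \<in> R"
  by (induction I rule: infinite_finite_induct) (auto intro: one_mem mult_mem)

lemma power_mem: "x \<in> R \<Longrightarrow> x ^ k \<in> R"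
  by (induction k) (auto intro: one_mem mult_mem)

lemma of_nat_mem: "of_nat k \<in> R"
  by (induction k) (auto intro: zero_mem one_mem add_mem)

lemma of_int_mem: "of_int k \<in> R"
  by (cases k) (auto intro: of_nat_mem uminus_mem diff_mem one_mem simp del: of_nat_Suc)

lemma poly_mem: "(\<And>i. poly.coeff q i \<in> R) \<Longrightarrow> x \<in> R \<Longrightarrow> poly q x \<in> R"
  unfolding poly_altdef by (intro sum_mem mult_mem power_mem)

text \<open>This instance is why the locale is stated for commutative rings and not only for fields:
  \<open>det_mem\<close> for matrices of polynomials controls the coefficients of characteristic
  polynomials.\<close>

lemma polys_over: "unital_subring {q. \<forall>i. poly.coeff q i \<in> R}"
proof
  show "q * q' \<in> {q. \<forall>i. poly.coeff q i \<in> R}"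
    if "q \<in> {q. \<forall>i. poly.coeff q i \<in> R}" "q' \<in> {q. \<forall>i. poly.coeff q i \<in> R}" for q q'
    using that by (auto simp: coeff_mult intro!: sum_mem mult_mem)
qed (auto simp: coeff_1 zero_mem one_mem add_mem uminus_mem)

lemma det_mem:
  assumes "M \<in> carrier_mat N N" "\<And>i j. i < N \<Longrightarrow> j < N \<Longrightarrow> M $$ (i, j) \<in> R"
  shows "det M \<in> R"
  unfolding det_def'[OF assms(1)]
  by (intro sum_mem mult_mem of_int_mem prod_mem assms(2)) (auto simp: permutes_in_image)

lemma char_poly_coeff_mem:
  assumes M: "M \<in> carrier_mat N N" and "\<And>i j. i < N \<Longrightarrow> j < N \<Longrightarrow> M $$ (i, j) \<in> R"
  shows "poly.coeff (char_poly M) k \<in> R"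
proof -
  interpret P: unital_subring "{q. \<forall>i. poly.coeff q i \<in> R}" by (rule polys_over)
  have "det (char_poly_matrix M) \<in> {q. \<forall>i. poly.coeff q i \<in> R}"
    by (rule P.det_mem[of _ N])
       (use assms in \<open>simp_all add: char_poly_matrix_def coeff_pCons zero_mem one_mem uminus_mem
                          add_mem diff_mem split: nat.split\<close>)
  then show ?thesis by (simp add: char_poly_def)
qed

end

text \<open>The generators are indexed by themselves, so coincidences such as x^i = x^j among the
  listed generators need no care. Only finite \<open>V\<close> occur; over an infinite
  \<open>V\<close> the sum is 0 by convention.\<close>

definition module_span :: "'a::comm_ring_1 set \<Rightarrow> 'a set \<Rightarrow> 'a set" where
  "module_span R V = {\<Sum>v\<in>V. c v * v |c. \<forall>v\<in>V. c v \<in> R}"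

context unital_subring
begin

lemma module_span_add:
  assumes "x \<in> module_span R V" "y \<in> module_span R V"
  shows "x + y \<in> module_span R V"
proof -
  obtain c d where "x = (\<Sum>v\<in>V. c v * v)" "\<forall>v\<in>V. c v \<in> R" "y = (\<Sum>v\<in>V. d v * v)" "\<forall>v\<in>V. d v \<in> R"
    using assms by (auto simp: module_span_def)
  then show ?thesis unfolding module_span_def
    by (intro CollectI exI[of _ "\<lambda>v. c v + d v"]) (auto simp: sum.distrib distrib_right add_mem)
qed

lemma module_span_scale:
  assumes "x \<in> module_span R V" "a \<in> R"
  shows "a * x \<in> module_span R V"
proof -
  obtain c where "x = (\<Sum>v\<in>V. c v * v)" "\<forall>v\<in>V. c v \<in> R"
    using assms by (auto simp: module_span_def)
  then show ?thesis unfolding module_span_def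
    by (intro CollectI exI[of _ "\<lambda>v. a * c v"])
       (auto simp: sum_distrib_left mult.assoc mult_mem assms)
qed

lemma module_span_zero: "0 \<in> module_span R V"
  unfolding module_span_def by (intro CollectI exI[of _ "\<lambda>v. 0"]) (auto simp: zero_mem)

lemma module_span_sum:
  "(\<And>i. i \<in> I \<Longrightarrow> f i \<in> module_span R V) \<Longrightarrow> sum f I \<in> module_span R V"
  by (induction I rule: infinite_finite_induct) (auto intro: module_span_zero module_span_add)

lemma module_span_base: "finite V \<Longrightarrow> v \<in> V \<Longrightarrow> v \<in> module_span R V"
  unfolding module_span_def
  by (intro CollectI exI[of _ "\<lambda>w. if w = v then 1 else 0"])
     (auto simp: zero_mem one_mem if_distrib[of "\<lambda>x. x * _"] cong: if_cong)

lemma module_span_mult: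
  assumes "\<And>v. v \<in> V \<Longrightarrow> x * v \<in> module_span R V" "y \<in> module_span R V"
  shows "x * y \<in> module_span R V"
proof -
  obtain c where c: "y = (\<Sum>v\<in>V. c v * v)" "\<forall>v\<in>V. c v \<in> R"
    using assms by (auto simp: module_span_def)
  have "x * y = (\<Sum>v\<in>V. c v * (x * v))" by (simp add: c sum_distrib_left mult_ac)
  also have "\<dots> \<in> module_span R V" using c(2) assms(1) by (blast intro: module_span_sum module_span_scale)
  finally show ?thesis .
qed

end

section \<open>Integral elements form a ring\<close>

definition integral_over :: "'a::comm_ring_1 set \<Rightarrow> 'a \<Rightarrow> bool" where
  "integral_over R x \<longleftrightarrow> (\<exists>q. lead_coeff q = 1 \<and> (\<forall>i. poly.coeff q i \<in> R) \<and> poly q x = 0)"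

text \<open>The determinant trick: \<open>x\<close> is an eigenvalue of a matrix over \<open>R\<close>.\<close>

lemma integral_over_module_span:
  fixes x :: "'a::field"
  assumes "unital_subring R" and V: "finite V" "v \<in> V" "v \<noteq> 0"
    and x: "\<And>v. v \<in> V \<Longrightarrow> x * v \<in> module_span R V"
  shows "integral_over R x"
proof -
  interpret unital_subring R by fact
  obtain f where f: "bij_betw f {0..<card V} V" using ex_bij_betw_nat_finite[OF V(1)] by blast
  define N where "N = card V"
  have "\<forall>i\<in>{..<N}. \<exists>c. x * f i = (\<Sum>v\<in>V. c v * v) \<and> (\<forall>v\<in>V. c v \<in> R)"
    using x bij_betwE[OF f] unfolding module_span_def N_def by fastforce
  then obtain C where C: "\<And>i. i < N \<Longrightarrow> x * f i = (\<Sum>v\<in>V. C i v * v)"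
    and CR: "\<And>i v. i < N \<Longrightarrow> v \<in> V \<Longrightarrow> C i v \<in> R"
    by (metis lessThan_iff)
  define M where "M = mat N N (\<lambda>(i, j). C i (f j))"
  have M: "M \<in> carrier_mat N N" by (simp add: M_def)
  obtain i where i: "i < N" "f i = v"
    using f V(2) by (force simp: bij_betw_def N_def)
  have "eigenvector M (vec N f) x"
    unfolding eigenvector_def
  proof (intro conjI)
    show "vec N f \<noteq> 0\<^sub>v (dim_row M)" using i V by (auto simp: vec_eq_iff M_def)
    show "M *\<^sub>v vec N f = x \<cdot>\<^sub>v vec N f"
    proof (rule eq_vecI)
      fix i assume "i < dim_vec (x \<cdot>\<^sub>v vec N f)"
      then have i: "i < N" by simp
      have "(M *\<^sub>v vec N f) $ i = (\<Sum>j\<in>{0..<N}. C i (f j) * f j)"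
        using i by (simp add: M_def scalar_prod_def)
      also have "\<dots> = (\<Sum>v\<in>V. C i v * v)"
        using f by (intro sum.reindex_bij_betw) (simp add: N_def)
      finally show "(M *\<^sub>v vec N f) $ i = (x \<cdot>\<^sub>v vec N f) $ i" using i C by simp
    qed (simp add: M_def)
  qed (simp add: M_def)
  then have "poly (char_poly M) x = 0"
    using eigenvalue_root_char_poly[OF M] by (auto simp: eigenvalue_def)
  moreover have "poly.coeff (char_poly M) k \<in> R" for k
    using bij_betwE[OF f] by (intro char_poly_coeff_mem[OF M]) (auto simp: M_def N_def CR)
  ultimately show ?thesis
    using degree_monic_char_poly[OF M] unfolding integral_over_def by auto
qed

text \<open>A monic equation solved for its leading power. The exponent is positive because the
  monic polynomial of degree 0 is 1, which has no root.\<close>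

lemma integral_over_power_span:
  fixes x :: "'a::field"
  assumes "unital_subring R" and x: "integral_over R x"
  obtains m where "m > 0" "x ^ m \<in> module_span R ((\<lambda>i. x ^ i) ` {..<m})"
proof -
  interpret unital_subring R by fact
  obtain q where q: "lead_coeff q = 1" "\<And>i. poly.coeff q i \<in> R" "poly q x = 0"
    using x by (auto simp: integral_over_def)
  define m where "m = degree q"
  have "m > 0"
  proof (rule ccontr)
    assume "\<not> m > 0"
    then have "poly q x = 1" using q(1) by (simp add: poly_altdef m_def)
    with q(3) show False by simp
  qed
  have "(\<Sum>i<m. poly.coeff q i * x ^ i) + x ^ m = 0"
    using q(1,3) by (simp add: poly_altdef m_def flip: lessThan_Suc_atMost)
  then have "x ^ m = (\<Sum>i<m. - poly.coeff q i * x ^ i)"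
    by (simp add: sum_negf add_eq_0_iff)
  also have "\<dots> \<in> module_span R ((\<lambda>i. x ^ i) ` {..<m})"
    by (intro module_span_sum module_span_scale module_span_base) (auto intro: uminus_mem q)
  finally show ?thesis using that \<open>m > 0\<close> by blast
qed

text \<open>The products x^i y^j below the degrees of monic equations for x and y span a module that
  contains 1 and is mapped into itself by x and by y, hence by sum, product and negative. The
  determinant trick applies to each of these.\<close>

lemma integral_over_closed:
  fixes x y :: "'a::field"
  assumes R: "unital_subring R" and x: "integral_over R x" and y: "integral_over R y"
  shows "integral_over R (x + y)" "integral_over R (x * y)" "integral_over R (- x)"
proof -
  interpret unital_subring R by fact
  obtain m n where m: "m > 0" "x ^ m \<in> module_span R ((\<lambda>i. x ^ i) ` {..<m})"
    and n: "n > 0" "y ^ n \<in> module_span R ((\<lambda>i. y ^ i) ` {..<n})"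
    using integral_over_power_span[OF R] x y by metis
  define V where "V = (\<lambda>(i, j). x ^ i * y ^ j) ` ({..<m} \<times> {..<n})"
  have fin: "finite V" by (simp add: V_def)
  have inV: "x ^ i * y ^ j \<in> V" if "i < m" "j < n" for i j
    using that by (force simp: V_def)
  have X: "x * v \<in> module_span R V" if v: "v \<in> V" for v
  proof -
    obtain i j where ij: "v = x ^ i * y ^ j" "i < m" "j < n" using v by (auto simp: V_def)
    show ?thesis
    proof (cases "Suc i < m")
      case True
      then have "x ^ Suc i * y ^ j \<in> module_span R V"
        using ij by (intro module_span_base fin inV)
      then show ?thesis by (simp add: ij mult.assoc)
    next
      case False
      then have "m = Suc i" using ij by auto
      then have "x * v = y ^ j * x ^ m" using ij by simp
      moreover obtain c where "x ^ m = (\<Sum>v\<in>(\<lambda>i. x ^ i) ` {..<m}. c v * v)"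
        "\<forall>v\<in>(\<lambda>i. x ^ i) ` {..<m}. c v \<in> R" using m(2) by (auto simp: module_span_def)
      ultimately have "x * v = (\<Sum>v\<in>(\<lambda>i. x ^ i) ` {..<m}. c v * (v * y ^ j))"
        and "\<forall>v\<in>(\<lambda>i. x ^ i) ` {..<m}. c v \<in> R"
        by (simp_all add: sum_distrib_left mult_ac)
      then show ?thesis
        by (auto intro!: module_span_sum module_span_scale[OF module_span_base[OF fin inV]] ij)
    qed
  qed
  have Y: "y * v \<in> module_span R V" if v: "v \<in> V" for v
  proof -
    obtain i j where ij: "v = x ^ i * y ^ j" "i < m" "j < n" using v by (auto simp: V_def)
    show ?thesis
    proof (cases "Suc j < n")
      case True
      then have "x ^ i * y ^ Suc j \<in> module_span R V"
        using ij by (intro module_span_base fin inV)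
      then show ?thesis by (simp add: ij mult_ac)
    next
      case False
      then have "n = Suc j" using ij by auto
      then have "y * v = x ^ i * y ^ n" using ij by simp
      moreover obtain c where "y ^ n = (\<Sum>v\<in>(\<lambda>i. y ^ i) ` {..<n}. c v * v)"
        "\<forall>v\<in>(\<lambda>i. y ^ i) ` {..<n}. c v \<in> R" using n(2) by (auto simp: module_span_def)
      ultimately have "y * v = (\<Sum>v\<in>(\<lambda>i. y ^ i) ` {..<n}. c v * (x ^ i * v))"
        and "\<forall>v\<in>(\<lambda>i. y ^ i) ` {..<n}. c v \<in> R"
        by (simp_all add: sum_distrib_left mult_ac)
      then show ?thesis
        by (auto intro!: module_span_sum module_span_scale[OF module_span_base[OF fin inV]] ij)
    qed
  qed
  have one: "1 \<in> V" using inV[of 0 0] m n by simp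
  show "integral_over R (x + y)"
    by (rule integral_over_module_span[OF R fin one])
       (auto simp: distrib_right intro!: module_span_add X Y)
  show "integral_over R (x * y)"
    by (rule integral_over_module_span[OF R fin one])
       (auto simp: mult.assoc intro!: module_span_mult[OF X] Y)
  show "integral_over R (- x)"
    using module_span_scale[OF X uminus_mem[OF one_mem]]
    by (intro integral_over_module_span[OF R fin one]) auto
qed

lemma integral_over_base:
  assumes "unital_subring R" "x \<in> R"
  shows "integral_over R x"
proof -
  interpret unital_subring R by fact
  show ?thesis unfolding integral_over_def
    by (rule exI[of _ "[:- x, 1:]"])
       (auto simp: coeff_pCons assms zero_mem one_mem uminus_mem split: nat.split)
qed

lemma unital_subring_integral_closure:
  assumes R: "unital_subring R" and F: "unital_subring F"
  shows "unital_subring (integral_closure R F)"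
proof -
  interpret F: unital_subring F by fact
  interpret R: unital_subring R by fact
  have eq: "integral_closure R F = {x \<in> F. integral_over R x}"
    by (auto simp: integral_closure_def integral_over_def)
  show ?thesis unfolding eq
    by unfold_locales
       (auto intro: F.zero_mem F.one_mem F.add_mem F.mult_mem F.uminus_mem R.zero_mem R.one_mem
          integral_over_base[OF R] integral_over_closed[OF R])
qed

lemma unital_subring_subfield:
  assumes "subfield K ring_of_type_algebra"
  shows "unital_subring K"
proof -
  interpret cring "ring_of_type_algebra :: 'a ring" by (rule cring_from_type_algebra)
  have "subring K ring_of_type_algebra" using assms by (rule subfieldE(1))
  \<comment> \<open>The form to which the additive inverse of HOL-Algebra unfolds in the ring of the
    whole type.\<close>
  moreover have "(THE y. x + y = 0 \<and> y + x = 0) = - x" for x :: 'a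
    by (rule the_equality) (auto simp: eq_neg_iff_add_eq_0 add.commute)
  ultimately show ?thesis
    using subringE[of K "ring_of_type_algebra"]
    unfolding unital_subring_def by (auto simp: ring_of_type_algebra_def a_inv_def m_inv_def)
qed

section \<open>The rings of the problem\<close>

text \<open>\<open>padic_field\<close> provides only the triangle inequality. Integers have absolute
  value at most 1, so the binomial expansion of (x + y)^k bounds the k-th power of |x + y| by k + 1,
  and a number above 1 has powers growing faster than that.\<close>

lemma unital_subring_padic_integers:
  assumes "padic_field p Qp av" and p: "prime p"
  shows "unital_subring {x \<in> Qp. av x \<le> 1}"
proof -
  have sub: "subfield Qp ring_of_type_algebra"
    and pos: "x \<in> Qp \<Longrightarrow> av x \<ge> 0"
    and mult: "x \<in> Qp \<Longrightarrow> y \<in> Qp \<Longrightarrow> av (x * y) = av x * av y"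
    and add: "x \<in> Qp \<Longrightarrow> y \<in> Qp \<Longrightarrow> av (x + y) \<le> av x + av y"
    and rat: "av (of_rat q) = padic_abs p q" for x y q
    using assms(1) by (auto simp: padic_field_def)
  interpret Q: unital_subring Qp using unital_subring_subfield[OF sub] .
  have p0: "real p \<ge> 1" using prime_ge_1_nat[OF p] by simp
  have of_nat: "av (of_nat k) \<le> 1" for k
  proof -
    have "quotient_of (of_nat k) = (int k, 1)"
      using quotient_of_int[of "int k"] by simp
    then have "padic_abs p (of_nat k) \<le> 1"
      using p0 by (auto simp: padic_abs_def power_int_def inverse_le_1_iff intro!: power_le_one)
    then show ?thesis using rat[of "of_nat k"] by simp
  qed
  have m1: "av (- 1) = 1"
  proof -
    have "quotient_of (- 1) = (- 1, 1)"
      using quotient_of_int[of "-1"] by simp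
    then have "padic_abs p (- 1) = 1" by (simp add: padic_abs_def)
    then show ?thesis using rat[of "- 1"] by (simp add: of_rat_minus)
  qed
  have av1: "av 1 = 1" using rat[of 1] by (simp add: padic_abs_def)
  have av0: "av 0 = 0" using rat[of 0] by (simp add: padic_abs_def)
  have pow: "av (x ^ k) = av x ^ k" if "x \<in> Qp" for x k
    by (induction k) (simp_all add: av1 mult that Q.power_mem)
  have sum: "av (sum f I) \<le> (\<Sum>i\<in>I. av (f i))" if "finite I" "\<And>i. i \<in> I \<Longrightarrow> f i \<in> Qp"
    for f and I :: "nat set"
    using that
  proof (induction I)
    case (insert i I)
    have "av (f i + sum f I) \<le> av (f i) + av (sum f I)"
      using insert by (intro add Q.sum_mem) auto
    with insert show ?case by force
  qed (simp add: av0)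
  have ultra: "av (x + y) \<le> 1" if x: "x \<in> Qp" "av x \<le> 1" and y: "y \<in> Qp" "av y \<le> 1" for x y
  proof (rule ccontr)
    assume "\<not> av (x + y) \<le> 1"
    define h where "h = av (x + y) - 1"
    have h: "h > 0" using \<open>\<not> av (x + y) \<le> 1\<close> by (simp add: h_def)
    have bound: "(1 + h) ^ k \<le> real k + 1" for k
    proof -
      have "(1 + h) ^ k = av ((x + y) ^ k)" by (simp add: h_def pow Q.add_mem x y)
      also have "\<dots> = av (\<Sum>i\<le>k. of_nat (k choose i) * x ^ i * y ^ (k - i))"
        by (simp add: binomial_ring)
      also have "\<dots> \<le> (\<Sum>i\<le>k. av (of_nat (k choose i) * x ^ i * y ^ (k - i)))"
        by (intro sum Q.mult_mem Q.of_nat_mem Q.power_mem x y) simp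
      also have "\<dots> \<le> (\<Sum>i\<le>k. 1)"
      proof (rule sum_mono)
        fix i
        have "av (of_nat (k choose i)) * (av x ^ i * av y ^ (k - i)) \<le> 1 * (1 * 1)"
          by (intro mult_mono of_nat power_le_one pos x y mult_nonneg_nonneg zero_le_power
                Q.of_nat_mem) auto
        then show "av (of_nat (k choose i) * x ^ i * y ^ (k - i)) \<le> 1"
          by (simp add: mult pow Q.mult_mem Q.of_nat_mem Q.power_mem x y)
      qed
      finally show ?thesis by simp
    qed
    \<comment> \<open>Bernoulli's inequality is linear in k, like the bound. Squared and compared
      with the bound for 2 k it reads (1 + k h)^2 <= 2 k + 1, which fails once k h^2 > 2.\<close>
    obtain k :: nat where k: "2 / h\<^sup>2 < real k" using reals_Archimedean2 by blast
    have "(1 + real k * h)\<^sup>2 \<le> ((1 + h) ^ k)\<^sup>2"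
      using Bernoulli_inequality[of h k] h by (intro power_mono) auto
    also have "\<dots> \<le> real (2 * k) + 1"
      using bound[of "2 * k"] by (simp add: power_mult mult.commute[of 2 k])
    finally have "real k * (real k * h\<^sup>2) + 2 * (real k * h) \<le> real k * 2"
      by (simp add: power2_eq_square algebra_simps)
    moreover have "0 < 2 / h\<^sup>2" using h by simp
    with k have k0: "0 < real k" by linarith
    have "2 < real k * h\<^sup>2" using k h by (simp add: field_simps)
    then have "real k * 2 < real k * (real k * h\<^sup>2)" using k0 by (intro mult_strict_left_mono)
    moreover have "0 \<le> 2 * (real k * h)" using k0 h by simp
    ultimately show False by linarith
  qed
  show ?thesis
  proof
    show "- x \<in> {x \<in> Qp. av x \<le> 1}" if "x \<in> {x \<in> Qp. av x \<le> 1}" for x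
      using that mult[OF Q.uminus_mem[OF Q.one_mem], of x] by (simp add: m1 Q.uminus_mem)
    show "x * y \<in> {x \<in> Qp. av x \<le> 1}"
      if "x \<in> {x \<in> Qp. av x \<le> 1}" "y \<in> {x \<in> Qp. av x \<le> 1}" for x y
      using that by (simp add: mult Q.mult_mem mult_le_one pos)
  qed (simp_all add: av0 av1 Q.zero_mem Q.one_mem Q.add_mem ultra)
qed

section \<open>Adjunction of an element, power series rings and fraction fields\<close>

lemma unital_subring_adjoin:
  fixes z :: "'a::field"
  assumes "unital_subring R"
  shows "unital_subring (adjoin R z)"
proof -
  interpret unital_subring R by fact
  interpret P: unital_subring "{q. \<forall>i. poly.coeff q i \<in> R}" by (rule polys_over)
  have eq: "adjoin R z = (\<lambda>q. poly q z) ` {q. \<forall>i. poly.coeff q i \<in> R}"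
    by (auto simp: adjoin_def)
  show ?thesis unfolding eq
  proof
    show "0 \<in> (\<lambda>q. poly q z) ` {q. \<forall>i. poly.coeff q i \<in> R}"
      using P.zero_mem by (intro image_eqI[of _ _ 0]) auto
    show "1 \<in> (\<lambda>q. poly q z) ` {q. \<forall>i. poly.coeff q i \<in> R}"
      using P.one_mem by (intro image_eqI[of _ _ 1]) auto
  next
    fix x y assume "x \<in> (\<lambda>q. poly q z) ` {q. \<forall>i. poly.coeff q i \<in> R}"
      "y \<in> (\<lambda>q. poly q z) ` {q. \<forall>i. poly.coeff q i \<in> R}"
    then obtain q q' where "q \<in> {q. \<forall>i. poly.coeff q i \<in> R}" "q' \<in> {q. \<forall>i. poly.coeff q i \<in> R}"
      "x = poly q z" "y = poly q' z" by blast
    then show "x + y \<in> (\<lambda>q. poly q z) ` {q. \<forall>i. poly.coeff q i \<in> R}"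
      "x * y \<in> (\<lambda>q. poly q z) ` {q. \<forall>i. poly.coeff q i \<in> R}"
      by (intro image_eqI[of _ _ "q + q'"] image_eqI[of _ _ "q * q'"] P.add_mem P.mult_mem; simp)+
  next
    fix x assume "x \<in> (\<lambda>q. poly q z) ` {q. \<forall>i. poly.coeff q i \<in> R}"
    then obtain q where "q \<in> {q. \<forall>i. poly.coeff q i \<in> R}" "x = poly q z" by blast
    then show "- x \<in> (\<lambda>q. poly q z) ` {q. \<forall>i. poly.coeff q i \<in> R}"
      by (intro image_eqI[of _ _ "- q"] P.uminus_mem) simp_all
  qed
qed

lemma adjoin_gen_mem: "unital_subring R \<Longrightarrow> z \<in> adjoin R z"
  unfolding adjoin_def unital_subring_def
  by (intro CollectI exI[of _ "[:0, 1:]"]) (auto simp: coeff_pCons split: nat.split)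

lemma adjoin_base_mem: "unital_subring R \<Longrightarrow> x \<in> R \<Longrightarrow> x \<in> adjoin R z"
  unfolding adjoin_def unital_subring_def
  by (intro CollectI exI[of _ "[:x:]"]) (auto simp: coeff_pCons split: nat.split)

lemma adjoin_subset:
  assumes S: "unital_subring S" "R \<subseteq> S" "z \<in> S"
  shows "adjoin R z \<subseteq> S"
  using unital_subring.poly_mem[OF S(1) _ S(3)] S(2) unfolding adjoin_def by blast

text \<open>The exponents of a polynomial in z are grouped by their residue modulo N. This gives
  existence of coordinates without a minimal polynomial; their uniqueness comes later, from
  orthogonality of the conjugates.\<close>

lemma adjoin_expansion:
  fixes z :: "'a::field"
  assumes R: "unital_subring R" and x: "x \<in> adjoin R z" and N: "N > 0"
  obtains a where "\<And>t. a t \<in> adjoin R (z ^ N)" "x = (\<Sum>t<N. a t * z ^ t)"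
proof -
  interpret unital_subring "adjoin R (z ^ N)" by (rule unital_subring_adjoin[OF R])
  obtain q where q: "x = poly q z" "\<And>i. poly.coeff q i \<in> R" using x by (auto simp: adjoin_def)
  define a where
    "a t = (\<Sum>i | i \<le> degree q \<and> i mod N = t. poly.coeff q i * (z ^ N) ^ (i div N))" for t
  have "x = (\<Sum>i\<le>degree q. poly.coeff q i * z ^ i)" by (simp add: q poly_altdef)
  also have "\<dots> = (\<Sum>t<N. \<Sum>i | i \<in> {..degree q} \<and> i mod N = t. poly.coeff q i * z ^ i)"
    using N by (intro sum.group[symmetric]) auto
  also have "\<dots> = (\<Sum>t<N. a t * z ^ t)"
    unfolding a_def sum_distrib_right
  proof (intro sum.cong refl)
    fix t i assume "i \<in> {i. i \<le> degree q \<and> i mod N = t}"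
    then have t: "i mod N = t" by simp
    have "z ^ i = z ^ (N * (i div N) + i mod N)" by simp
    then have "z ^ i = (z ^ N) ^ (i div N) * z ^ t" unfolding t by (simp only: power_add power_mult)
    then show "poly.coeff q i * z ^ i = poly.coeff q i * (z ^ N) ^ (i div N) * z ^ t" by simp
  qed auto
  finally show ?thesis
    by (rule that[rotated])
       (auto simp: a_def intro!: sum_mem mult_mem[OF adjoin_base_mem[OF R q(2)]]
          power_mem[OF adjoin_gen_mem[OF R]])
qed

lemma unital_subring_power_series_ring:
  assumes "unital_subring R"
  shows "unital_subring (power_series_ring R)"
proof -
  interpret unital_subring R by fact
  have mem: "fps_to_fls f \<in> power_series_ring R \<longleftrightarrow> (\<forall>i. fps_nth f i \<in> R)" for f
    by (auto simp: power_series_ring_def)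
  have ex: "\<exists>f. x = fps_to_fls f \<and> (\<forall>i. fps_nth f i \<in> R)" if "x \<in> power_series_ring R" for x
    using that by (auto simp: power_series_ring_def)
  show ?thesis
  proof
    show "0 \<in> power_series_ring R" "1 \<in> power_series_ring R"
      using mem[of 0] mem[of 1] by (auto simp: zero_mem one_mem)
  next
    fix x y assume "x \<in> power_series_ring R" "y \<in> power_series_ring R"
    then obtain f h where fh: "x = fps_to_fls f" "\<forall>i. fps_nth f i \<in> R"
      "y = fps_to_fls h" "\<forall>i. fps_nth h i \<in> R"
      using ex by blast
    show "x + y \<in> power_series_ring R"
      using mem[of "f + h"] fh by (simp add: add_mem)
    show "x * y \<in> power_series_ring R"
      using mem[of "f * h"] fh by (simp add: fls_times_fps_to_fls fps_mult_nth sum_mem mult_mem)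
  next
    fix x assume "x \<in> power_series_ring R"
    then obtain f where "x = fps_to_fls f" "\<forall>i. fps_nth f i \<in> R"
      using ex by blast
    then show "- x \<in> power_series_ring R"
      using mem[of "- f"] by (simp add: uminus_mem)
  qed
qed

lemma fls_const_mem_power_series_ring:
  assumes "unital_subring R" "x \<in> R"
  shows "fls_const x \<in> power_series_ring R"
proof -
  interpret unital_subring R by fact
  show ?thesis unfolding power_series_ring_def
    by (rule image_eqI[of _ _ "fps_const x"]) (auto simp: assms zero_mem)
qed

lemma fls_X_mem_power_series_ring:
  assumes "unital_subring R"
  shows "fls_X \<in> power_series_ring R"
proof -
  interpret unital_subring R by fact
  show ?thesis unfolding power_series_ring_def
    by (rule image_eqI[of _ _ "fps_X"]) (auto simp: fps_X_nth zero_mem one_mem)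
qed

lemma power_series_ring_mono: "R \<subseteq> S \<Longrightarrow> power_series_ring R \<subseteq> power_series_ring S"
  by (auto simp: power_series_ring_def)

lemma fps_to_fls_sum: "fps_to_fls (sum f I) = (\<Sum>i\<in>I. fps_to_fls (f i))"
  by (induction I rule: infinite_finite_induct) auto

text \<open>The same finite list of powers of z serves all coefficients of the series, so the
  coordinates belonging to one power can be collected into a power series over
  \<open>R\<close>.\<close>

lemma power_series_ring_expansion:
  assumes f: "f \<in> power_series_ring S"
    and S: "\<And>x. x \<in> S \<Longrightarrow> \<exists>a. (\<forall>t. a t \<in> R) \<and> x = (\<Sum>t<N. a t * z ^ t)"
  obtains a where "\<And>t. a t \<in> power_series_ring R" "f = (\<Sum>t<N. a t * fls_const z ^ t)"
proof -
  obtain h where h: "f = fps_to_fls h" "\<And>i. fps_nth h i \<in> S"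
    using f by (auto simp: power_series_ring_def)
  obtain a where a: "\<And>i t. a i t \<in> R" "\<And>i. fps_nth h i = (\<Sum>t<N. a i t * z ^ t)"
    using S[OF h(2)] by metis
  have "h = (\<Sum>t<N. Abs_fps (\<lambda>i. a i t) * fps_const (z ^ t))"
    by (rule fps_ext) (simp add: fps_sum_nth a(2))
  then have "f = (\<Sum>t<N. fps_to_fls (Abs_fps (\<lambda>i. a i t)) * fls_const z ^ t)"
    by (simp add: h(1) fps_to_fls_sum fls_times_fps_to_fls fls_const_power)
  then show ?thesis
    by (rule that[rotated]) (auto simp: power_series_ring_def a)
qed

lemma unital_subring_fraction_field:
  fixes R :: "'b::field set"
  assumes "unital_subring R"
  shows "unital_subring (fraction_field R)"
proof -
  interpret unital_subring R by fact
  show ?thesis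
  proof
    have "0 = 0 / (1 :: 'b)" "1 = 1 / (1 :: 'b)" by simp_all
    then show "0 \<in> fraction_field R" "1 \<in> fraction_field R"
      unfolding fraction_field_def using zero_mem one_mem one_neq_zero by blast+
  next
    fix x y assume "x \<in> fraction_field R" "y \<in> fraction_field R"
    then obtain a b c d where ab: "x = a / b" "a \<in> R" "b \<in> R" "b \<noteq> 0"
      and cd: "y = c / d" "c \<in> R" "d \<in> R" "d \<noteq> 0"
      unfolding fraction_field_def by blast
    have "x + y = (a * d + c * b) / (b * d)" using ab cd by (simp add: field_simps)
    then show "x + y \<in> fraction_field R"
      unfolding fraction_field_def using ab cd
      by (intro CollectI exI[of _ "a * d + c * b"] exI[of _ "b * d"])
         (auto intro: add_mem mult_mem)
    show "x * y \<in> fraction_field R"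
      unfolding fraction_field_def using ab cd
      by (intro CollectI exI[of _ "a * c"] exI[of _ "b * d"]) (auto intro: add_mem mult_mem)
  next
    fix x assume "x \<in> fraction_field R"
    then obtain a b where ab: "x = a / b" "a \<in> R" "b \<in> R" "b \<noteq> 0"
      unfolding fraction_field_def by blast
    then show "- x \<in> fraction_field R"
      unfolding fraction_field_def
      by (intro CollectI exI[of _ "- a"] exI[of _ b]) (auto intro: uminus_mem)
  qed
qed

lemma fraction_field_base:
  fixes R :: "'b::field set"
  assumes "unital_subring R"
  shows "R \<subseteq> fraction_field R"
  using assms unfolding fraction_field_def unital_subring_def
  by (intro subsetI CollectI) (metis div_by_1 zero_neq_one)

lemma fraction_field_mono: "R \<subseteq> S \<Longrightarrow> fraction_field R \<subseteq> fraction_field S"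
  unfolding fraction_field_def by blast

lemma fraction_field_inverse: "x \<in> fraction_field R \<Longrightarrow> inverse x \<in> fraction_field R"
proof -
  assume "x \<in> fraction_field R"
  then obtain a b where "x = a / b" "a \<in> R" "b \<in> R" "b \<noteq> 0"
    unfolding fraction_field_def by blast
  then show ?thesis
    unfolding fraction_field_def
    by (cases "a = 0") (force simp: field_simps)+
qed

text \<open>The way back to HOL-Algebra: \<open>splitting\<close> demands a \<open>subfield\<close>
  of the type ring, while a fraction field is handled here as a set closed under the field
  operations.\<close>

lemma subfield_of_unital_subring:
  fixes K :: "'b::field set"
  assumes "unital_subring K" and inv: "\<And>x. x \<in> K \<Longrightarrow> inverse x \<in> K"
  shows "subfield K ring_of_type_algebra"
proof -
  interpret unital_subring K by fact
  let ?R = "ring_of_type_algebra :: 'b ring"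
  interpret Field: field ?R by (rule field_from_type_algebra)
  have uminus: "\<ominus>\<^bsub>?R\<^esub> x = - x" for x
    by (rule Field.minus_equality) (auto simp: ring_of_type_algebra_def)
  have inverse: "inv\<^bsub>?R\<^esub> x = inverse x" if "x \<noteq> 0" for x
    by (rule Field.comm_inv_char) (use that in \<open>auto simp: ring_of_type_algebra_def\<close>)
  show ?thesis
  proof (rule Field.subfieldI'[OF Field.subringI])
    fix k assume "k \<in> K - {\<zero>\<^bsub>?R\<^esub>}"
    then show "inv\<^bsub>?R\<^esub> k \<in> K"
      using inverse inv by (auto simp: ring_of_type_algebra_def)
  next
    fix h assume "h \<in> K"
    then show "\<ominus>\<^bsub>?R\<^esub> h \<in> K" by (simp add: uminus uminus_mem)
  qed (auto simp: ring_of_type_algebra_def one_mem add_mem mult_mem)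
qed

section \<open>Independence of the reduced norm of the splitting\<close>

lemma sum_rotate3:
  "(\<Sum>a\<in>A. \<Sum>b\<in>B. \<Sum>c\<in>C. f a b c) = (\<Sum>c\<in>C. \<Sum>a\<in>A. \<Sum>b\<in>B. f a b c)"
proof -
  have "(\<Sum>a\<in>A. \<Sum>b\<in>B. \<Sum>c\<in>C. f a b c) = (\<Sum>a\<in>A. \<Sum>c\<in>C. \<Sum>b\<in>B. f a b c)"
    by (intro sum.cong refl sum.swap)
  also have "\<dots> = (\<Sum>c\<in>C. \<Sum>a\<in>A. \<Sum>b\<in>B. f a b c)" by (rule sum.swap)
  finally show ?thesis .
qed

text \<open>
  \<open>f a b i j\<close> is the entry \<open>(i, j)\<close> of a matrix unit \<open>f a b\<close>. The vectors \<open>w a\<close> are the images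
  \<open>f a 0 v\<close> of a unit vector \<open>v\<close> not killed by \<open>f 0 0\<close>.
\<close>

lemma matrix_units_basis:
  fixes f :: "nat \<Rightarrow> nat \<Rightarrow> nat \<Rightarrow> nat \<Rightarrow> 'b::field"
  assumes mu: "\<And>a b c d i j. \<lbrakk>a < m; b < m; c < m; d < m; i < k; j < k\<rbrakk> \<Longrightarrow>
      (\<Sum>l<k. f a b i l * f c d l j) = (if b = c then f a d i j else 0)"
    and one: "\<And>i j. \<lbrakk>i < k; j < k\<rbrakk> \<Longrightarrow> (\<Sum>a<m. f a a i j) = (if i = j then 1 else 0)"
    and k: "k > 0"
  obtains w where "m > 0" "m \<le> k"
    "\<And>a b c i. \<lbrakk>a < m; b < m; c < m; i < k\<rbrakk> \<Longrightarrow>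
       (\<Sum>l<k. f a b i l * w c l) = (if b = c then w a i else 0)"
    "\<And>x c. \<lbrakk>\<And>i. i < k \<Longrightarrow> (\<Sum>c<m. x c * w c i) = 0; c < m\<rbrakk> \<Longrightarrow> x c = 0"
proof -
  have m: "m > 0" using one[OF k k] by (cases m) auto
  \<comment> \<open>If f 0 0 vanished, then so would f a 0 = f a 0 f 0 0 and f a a = f a 0 f 0 a,
    although the latter sum to the identity.\<close>
  have "\<exists>i<k. \<exists>j<k. f 0 0 i j \<noteq> 0"
  proof (rule ccontr)
    assume "\<not> ?thesis"
    then have z: "f 0 0 i j = 0" if "i < k" "j < k" for i j using that by blast
    have "f a a 0 0 = 0" if a: "a < m" for a
    proof -
      have "f a 0 0 l = 0" if l: "l < k" for l
        using mu[of a 0 0 0 0 l] a m k l z by simp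
      then show ?thesis using mu[of a 0 0 a 0 0] a m k by simp
    qed
    then show False using one[OF k k] by simp
  qed
  then obtain i0 j0 where ij: "i0 < k" "j0 < k" "f 0 0 i0 j0 \<noteq> 0" by blast
  define w where "w a i = f a 0 i j0" for a i
  have act: "(\<Sum>l<k. f a b i l * w c l) = (if b = c then w a i else 0)"
    if "a < m" "b < m" "c < m" "i < k" for a b c i
    unfolding w_def using mu[of a b c 0 i j0] that m ij by simp
  have indep: "x c = 0" if x: "\<And>i. i < k \<Longrightarrow> (\<Sum>c<m. x c * w c i) = 0" and c: "c < m" for x c
  proof -
    \<comment> \<open>Applying f 0 c to the relation leaves x c times w 0, whose entry at
      \<open>i0\<close> is nonzero by the choice of \<open>j0\<close>.\<close>
    have "0 = (\<Sum>l<k. f 0 c i0 l * (\<Sum>c<m. x c * w c l))" by (simp add: x)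
    also have "\<dots> = (\<Sum>l<k. \<Sum>e<m. x e * (f 0 c i0 l * w e l))"
      by (simp add: sum_distrib_left mult_ac)
    also have "\<dots> = (\<Sum>e<m. x e * (\<Sum>l<k. f 0 c i0 l * w e l))"
      by (subst sum.swap) (simp add: sum_distrib_left)
    also have "\<dots> = (\<Sum>e<m. if e = c then x e * w 0 i0 else 0)"
      using act[OF m c _ ij(1)] by (intro sum.cong) auto
    also have "\<dots> = x c * w 0 i0" using c by simp
    finally show ?thesis using ij(3) by (simp add: w_def)
  qed
  have "m \<le> k"
  proof (rule ccontr)
    assume "\<not> m \<le> k"
    \<comment> \<open>The k by m matrix with columns w c, made square by zero rows. A zero row
      forces determinant 0, hence a nontrivial relation among the w c.\<close>
    define P where "P = mat m m (\<lambda>(i, j). if i < k then w j i else 0)"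
    have P: "P \<in> carrier_mat m m" by (simp add: P_def)
    have "transpose_mat P *\<^sub>v unit_vec m k = 0\<^sub>v m"
      using \<open>\<not> m \<le> k\<close> by (intro eq_vecI) (auto simp: P_def scalar_prod_def unit_vec_def intro!: sum.neutral)
    moreover have "unit_vec m k \<noteq> (0\<^sub>v m :: 'b vec)" using \<open>\<not> m \<le> k\<close> by (auto simp: unit_vec_def vec_eq_iff)
    ultimately have "det (transpose_mat P) = 0"
      using det_0_iff_vec_prod_zero[OF transpose_carrier_mat[THEN iffD2, OF P]] unit_vec_carrier by blast
    then have "det P = 0" using det_transpose[OF P] by simp
    then obtain v where v: "v \<in> carrier_vec m" "v \<noteq> 0\<^sub>v m" "P *\<^sub>v v = 0\<^sub>v m"
      using det_0_iff_vec_prod_zero[OF P] by auto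
    have "(\<Sum>c<m. v $ c * w c i) = 0" if i: "i < k" for i
    proof -
      have "(\<Sum>c<m. v $ c * w c i) = (P *\<^sub>v v) $ i"
        using i v(1) \<open>\<not> m \<le> k\<close> by (auto simp: P_def scalar_prod_def mult.commute atLeast0LessThan)
      then show ?thesis using v i \<open>\<not> m \<le> k\<close> by simp
    qed
    then have "v $ c = 0" if "c < m" for c using indep[of "\<lambda>c. v $ c"] that by blast
    then show False using v by (auto simp: vec_eq_iff)
  qed
  then show ?thesis using that m act indep by blast
qed

text \<open>Linear combinations and their images under matrix representations refer to no more
  structure than this, so the cyclic algebra enters without a proof of its ring axioms.\<close>

locale algebra_over = abelian_monoid D for D :: "'d ring" (structure) +
  fixes K :: "'b::field set" and \<iota> :: "'b \<Rightarrow> 'd"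
  assumes iota_closed: "a \<in> K \<Longrightarrow> \<iota> a \<in> carrier D"
    and m_closed: "x \<in> carrier D \<Longrightarrow> y \<in> carrier D \<Longrightarrow> x \<otimes> y \<in> carrier D"
    and one_closed: "\<one> \<in> carrier D"
begin

text \<open>A splitting stripped of its coefficient field and its basis condition: the role that one
  of two splittings plays when it is compared with the other.\<close>

definition matrix_rep :: "nat \<Rightarrow> ('d \<Rightarrow> 'b mat) \<Rightarrow> bool" where
  "matrix_rep m \<rho> \<longleftrightarrow> \<rho> \<in> Ring.ring_hom D (ring_mat TYPE('b) m ()) \<and> (\<forall>a\<in>K. \<rho> (\<iota> a) = a \<cdot>\<^sub>m 1\<^sub>m m)"

lemma matrix_rep_carrier: "matrix_rep m \<rho> \<Longrightarrow> x \<in> carrier D \<Longrightarrow> \<rho> x \<in> carrier_mat m m"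
  by (auto simp: matrix_rep_def Ring.ring_hom_def ring_mat_def)

lemma matrix_rep_mult:
  "matrix_rep m \<rho> \<Longrightarrow> x \<in> carrier D \<Longrightarrow> y \<in> carrier D \<Longrightarrow> \<rho> (x \<otimes> y) = \<rho> x * \<rho> y"
  by (auto simp: matrix_rep_def Ring.ring_hom_def ring_mat_def)

lemma matrix_rep_mult_index:
  assumes "matrix_rep m \<rho>" "x \<in> carrier D" "y \<in> carrier D" "i < m" "j < m"
  shows "\<rho> (x \<otimes> y) $$ (i, j) = (\<Sum>k<m. \<rho> x $$ (i, k) * \<rho> y $$ (k, j))"
  using matrix_rep_carrier[OF assms(1,2)] matrix_rep_carrier[OF assms(1,3)] assms(4,5)
  by (auto simp: matrix_rep_mult[OF assms(1-3)] scalar_prod_def atLeast0LessThan)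

lemma matrix_rep_add:
  "matrix_rep m \<rho> \<Longrightarrow> x \<in> carrier D \<Longrightarrow> y \<in> carrier D \<Longrightarrow> \<rho> (x \<oplus> y) = \<rho> x + \<rho> y"
  by (auto simp: matrix_rep_def Ring.ring_hom_def ring_mat_def)

lemma matrix_rep_one: "matrix_rep m \<rho> \<Longrightarrow> \<rho> \<one> = 1\<^sub>m m"
  by (auto simp: matrix_rep_def Ring.ring_hom_def ring_mat_def)

lemma matrix_rep_zero_index:
  assumes "matrix_rep m \<rho>" "i < m" "j < m"
  shows "\<rho> \<zero> $$ (i, j) = 0"
proof -
  have "\<rho> \<zero> = \<rho> \<zero> + \<rho> \<zero>" using matrix_rep_add[OF assms(1), of \<zero> \<zero>] by simp
  then have "\<rho> \<zero> $$ (i, j) = \<rho> \<zero> $$ (i, j) + \<rho> \<zero> $$ (i, j)"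
    using matrix_rep_carrier[OF assms(1) zero_closed] assms by (metis carrier_matD index_add_mat(1))
  then show ?thesis by (simp only: add_cancel_right_right)
qed

lemma matrix_rep_combination:
  fixes N :: nat
  assumes "matrix_rep m \<rho>" "\<And>l. l < N \<Longrightarrow> c l \<in> K" "\<And>l. l < N \<Longrightarrow> x l \<in> carrier D" "i < m" "j < m"
  shows "\<rho> (\<Oplus>l\<in>{..<N}. \<iota> (c l) \<otimes> x l) $$ (i, j) = (\<Sum>l<N. c l * \<rho> (x l) $$ (i, j))"
  using assms(2,3)
proof (induction N)
  case 0
  show ?case using matrix_rep_zero_index[OF assms(1,4,5)] by simp
next
  case (Suc N)
  let ?S = "\<Oplus>l\<in>{..<N}. \<iota> (c l) \<otimes> x l"
  have mem: "\<iota> (c l) \<otimes> x l \<in> carrier D" if "l < Suc N" for l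
    using Suc.prems that by (intro m_closed iota_closed)
  have S: "?S \<in> carrier D" using mem by (intro finsum_closed) auto
  have "(\<Oplus>l\<in>{..<Suc N}. \<iota> (c l) \<otimes> x l) = \<iota> (c N) \<otimes> x N \<oplus> ?S"
    unfolding lessThan_Suc using mem by (intro finsum_insert) auto
  then have "\<rho> (\<Oplus>l\<in>{..<Suc N}. \<iota> (c l) \<otimes> x l) $$ (i, j)
      = \<rho> (\<iota> (c N) \<otimes> x N) $$ (i, j) + \<rho> ?S $$ (i, j)"
    using matrix_rep_add[OF assms(1) mem[of N] S] matrix_rep_carrier[OF assms(1) S] assms(4,5) by simp
  also have "\<rho> (\<iota> (c N) \<otimes> x N) $$ (i, j) = c N * \<rho> (x N) $$ (i, j)"
  proof -
    have "\<rho> (\<iota> (c N)) = c N \<cdot>\<^sub>m 1\<^sub>m m" using assms(1) Suc.prems by (auto simp: matrix_rep_def)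
    then have "\<rho> (\<iota> (c N) \<otimes> x N) = (c N \<cdot>\<^sub>m 1\<^sub>m m) * \<rho> (x N)"
      using Suc.prems matrix_rep_mult[OF assms(1) iota_closed, of "c N" "x N"] by simp
    also have "\<dots> = c N \<cdot>\<^sub>m \<rho> (x N)"
      using matrix_rep_carrier[OF assms(1), of "x N"] Suc.prems
      by (simp add: mult_smult_assoc_mat[of _ m m _ m])
    finally show ?thesis using matrix_rep_carrier[OF assms(1), of "x N"] Suc.prems assms(4,5) by simp
  qed
  also have "\<rho> ?S $$ (i, j) = (\<Sum>l<N. c l * \<rho> (x l) $$ (i, j))" by (intro Suc.IH) (use Suc.prems in auto)
  finally show ?case by simp
qed

text \<open>\<open>C a b\<close> are the coordinates of the elementary matrix (a, b) in the basis
  \<open>\<rho> (x l)\<close>; the two families of relations say that \<open>C\<close> and the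
  entries of the \<open>\<rho> (x l)\<close> are mutually inverse. The field \<open>E\<close> is
  gone from the conclusion, which allows splittings over different fields to be compared.\<close>

lemma splitting_dual_basis:
  assumes "splitting K \<iota> D E m \<rho>"
  obtains N :: nat and x C where
    "\<forall>l<N. x l \<in> carrier D"
    "\<forall>d\<in>carrier D. \<exists>c. (\<forall>l<N. c l \<in> K) \<and> d = (\<Oplus>l\<in>{..<N}. \<iota> (c l) \<otimes> x l)"
    "\<forall>a<m. \<forall>b<m. \<forall>i<m. \<forall>j<m.
       (\<Sum>l<N. C a b l * \<rho> (x l) $$ (i, j)) = (if i = a \<and> j = b then 1 else 0)"
    "\<forall>k<N. \<forall>l<N. (\<Sum>a<m. \<Sum>b<m. \<rho> (x k) $$ (a, b) * C a b l) = (if k = l then 1 else 0)"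
proof -
  from assms obtain N x where E: "subfield E ring_of_type_algebra"
    and img: "\<rho> ` carrier D \<subseteq> matrices_over E m"
    and x: "\<forall>i<N. x i \<in> carrier D"
    and KB: "\<forall>d\<in>carrier D. \<exists>!c. c \<in> {..<N::nat} \<rightarrow>\<^sub>E K \<and> d = (\<Oplus>i\<in>{..<N}. \<iota> (c i) \<otimes> x i)"
    and EB: "\<forall>M\<in>matrices_over E m. \<exists>!c. c \<in> {..<N} \<rightarrow>\<^sub>E E \<and>
           M = mat m m (\<lambda>(i, j). \<Sum>l<N. c l * \<rho> (x l) $$ (i, j))"
    unfolding splitting_def by (elim conjE exE) (rule that; assumption)
  interpret E: unital_subring E by (rule unital_subring_subfield[OF E])
  define U where "U a b = mat m m (\<lambda>(i, j). if i = a \<and> j = b then 1 else (0::'b))" for a b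
  have U: "U a b \<in> matrices_over E m" for a b
    by (auto simp: U_def matrices_over_def elements_mat_def E.zero_mem E.one_mem)
  define C where "C a b = (SOME c. c \<in> {..<N} \<rightarrow>\<^sub>E E \<and>
           U a b = mat m m (\<lambda>(i, j). \<Sum>l<N. c l * \<rho> (x l) $$ (i, j)))" for a b
  have C: "C a b \<in> {..<N} \<rightarrow>\<^sub>E E" "U a b = mat m m (\<lambda>(i, j). \<Sum>l<N. C a b l * \<rho> (x l) $$ (i, j))"
    for a b
    using someI_ex[OF ex1_implies_ex[OF bspec[OF EB U[of a b]]], folded C_def] by blast+
  have Crho: "(\<Sum>l<N. C a b l * \<rho> (x l) $$ (i, j)) = (if i = a \<and> j = b then 1 else 0)"
    if "i < m" "j < m" for a b i j
    using arg_cong[OF C(2), of "\<lambda>M. M $$ (i, j)", of a b] that by (simp add: U_def)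
  have "(\<Sum>a<m. \<Sum>b<m. \<rho> (x k) $$ (a, b) * C a b l) = (if k = l then 1 else 0)"
    if k: "k < N" and l: "l < N" for k l
  proof -
    have rk: "\<rho> (x k) \<in> matrices_over E m" using img x k by blast
    then have rE: "\<rho> (x k) $$ (a, b) \<in> E" if "a < m" "b < m" for a b
      using that by (fastforce simp: matrices_over_def elements_mat_def)
    \<comment> \<open>Two coordinate vectors of \<open>\<rho> (x k)\<close>: one through its
      expansion in elementary matrices, one the unit vector. Uniqueness of coordinates identifies
      them.\<close>
    define c1 where "c1 = restrict (\<lambda>l. \<Sum>a<m. \<Sum>b<m. \<rho> (x k) $$ (a, b) * C a b l) {..<N}"
    define c2 where "c2 = restrict (\<lambda>l. if k = l then 1 else (0::'b)) {..<N}"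
    have "c1 \<in> {..<N} \<rightarrow>\<^sub>E E" unfolding c1_def restrict_PiE_iff
      using C(1) by (intro ballI E.sum_mem E.mult_mem rE) auto
    moreover have "c2 \<in> {..<N} \<rightarrow>\<^sub>E E" by (auto simp: c2_def E.zero_mem E.one_mem)
    moreover have "\<rho> (x k) = mat m m (\<lambda>(i, j). \<Sum>l<N. c2 l * \<rho> (x l) $$ (i, j))"
      using rk k by (intro eq_matI)
        (auto simp: matrices_over_def c2_def if_distrib[of "\<lambda>x. x * _"] cong: if_cong)
    moreover have "\<rho> (x k) = mat m m (\<lambda>(i, j). \<Sum>l<N. c1 l * \<rho> (x l) $$ (i, j))"
    proof (rule eq_matI)
      fix i j assume "i < dim_row (mat m m (\<lambda>(i, j). \<Sum>l<N. c1 l * \<rho> (x l) $$ (i, j)))"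
        "j < dim_col (mat m m (\<lambda>(i, j). \<Sum>l<N. c1 l * \<rho> (x l) $$ (i, j)))"
      then have ij: "i < m" "j < m" by auto
      have "(\<Sum>l<N. c1 l * \<rho> (x l) $$ (i, j))
          = (\<Sum>l<N. \<Sum>a<m. \<Sum>b<m. \<rho> (x k) $$ (a, b) * (C a b l * \<rho> (x l) $$ (i, j)))"
        by (simp add: c1_def sum_distrib_right mult.assoc)
      also have "\<dots> = (\<Sum>a<m. \<Sum>b<m. \<Sum>l<N. \<rho> (x k) $$ (a, b) * (C a b l * \<rho> (x l) $$ (i, j)))"
        by (rule sum_rotate3[symmetric])
      also have "\<dots> = (\<Sum>a<m. \<Sum>b<m. \<rho> (x k) $$ (a, b) * (if i = a \<and> j = b then 1 else 0))"
        using ij by (simp add: Crho flip: sum_distrib_left)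
      also have "\<dots> = (\<Sum>a<m. \<Sum>b<m. if b = j then if a = i then \<rho> (x k) $$ (a, b) else 0 else 0)"
        by (intro sum.cong refl) auto
      also have "\<dots> = \<rho> (x k) $$ (i, j)" using ij by simp
      finally show "\<rho> (x k) $$ (i, j) = mat m m (\<lambda>(i, j). \<Sum>l<N. c1 l * \<rho> (x l) $$ (i, j)) $$ (i, j)"
        using ij by simp
    qed (use rk in \<open>auto simp: matrices_over_def\<close>)
    ultimately have "c1 = c2" using bspec[OF EB rk] by blast
    then have "c1 l = c2 l" by simp
    then show ?thesis using l by (simp add: c1_def c2_def)
  qed
  moreover have "\<exists>c. (\<forall>l<N. c l \<in> K) \<and> d = (\<Oplus>l\<in>{..<N}. \<iota> (c l) \<otimes> x l)" if "d \<in> carrier D" for d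
    using bspec[OF KB that] by (auto simp: PiE_def Pi_def)
  ultimately show ?thesis using x Crho by (intro that[of N x C]) blast+
qed

text \<open>
  Expressing matrix units through the images \<open>\<rho> (x l)\<close> of a basis and replacing \<open>\<rho>\<close> by \<open>\<rho>'\<close> gives
  matrix units again; these are simultaneously conjugate to the standard ones.
\<close>

lemma splitting_conjugate:
  assumes split: "splitting K \<iota> D E m \<rho>" and rep': "matrix_rep k \<rho>'" and k: "k > 0"
  shows "m > 0 \<and> m \<le> k \<and> (m = k \<longrightarrow> (\<forall>d\<in>carrier D. det (\<rho> d) = det (\<rho>' d)))"
proof -
  have rep: "matrix_rep m \<rho>" using split by (auto simp: splitting_def matrix_rep_def)
  obtain N :: nat and x C where *: "\<forall>l<N. x l \<in> carrier D"
    "\<forall>d\<in>carrier D. \<exists>c. (\<forall>l<N. c l \<in> K) \<and> d = (\<Oplus>l\<in>{..<N}. \<iota> (c l) \<otimes> x l)"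
    "\<forall>a<m. \<forall>b<m. \<forall>i<m. \<forall>j<m.
       (\<Sum>l<N. C a b l * \<rho> (x l) $$ (i, j)) = (if i = a \<and> j = b then 1 else 0)"
    "\<forall>k<N. \<forall>l<N. (\<Sum>a<m. \<Sum>b<m. \<rho> (x k) $$ (a, b) * C a b l) = (if k = l then 1 else 0)"
    by (rule splitting_dual_basis[OF split]) (rule that; assumption)
  note x = *(1)[rule_format] and span = *(2)[rule_format]
    and CR = *(3)[rule_format] and RC = *(4)[rule_format]
  have indep: "c l = 0" if c: "\<And>a b. a < m \<Longrightarrow> b < m \<Longrightarrow> (\<Sum>k<N. c k * \<rho> (x k) $$ (a, b)) = 0"
    and l: "l < N" for c l
  proof -
    have "0 = (\<Sum>a<m. \<Sum>b<m. (\<Sum>k<N. c k * \<rho> (x k) $$ (a, b)) * C a b l)" using c by simp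
    also have "\<dots> = (\<Sum>a<m. \<Sum>b<m. \<Sum>k<N. c k * (\<rho> (x k) $$ (a, b) * C a b l))"
      by (simp add: sum_distrib_right mult.assoc)
    also have "\<dots> = (\<Sum>k<N. c k * (\<Sum>a<m. \<Sum>b<m. \<rho> (x k) $$ (a, b) * C a b l))"
      unfolding sum_distrib_left by (rule sum_rotate3)
    also have "\<dots> = (\<Sum>k<N. if k = l then c k else 0)" using RC[OF _ l] by (intro sum.cong) auto
    finally show ?thesis using l by simp
  qed
  have eq_coeffs: "c l = c' l"
    if "\<And>a b. a < m \<Longrightarrow> b < m \<Longrightarrow>
          (\<Sum>k<N. c k * \<rho> (x k) $$ (a, b)) = (\<Sum>k<N. c' k * \<rho> (x k) $$ (a, b))" "l < N" for c c' l
    using indep[of "\<lambda>l. c l - c' l" l] that by (simp add: left_diff_distrib sum_subtractf)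
  define f where "f a b i j = (\<Sum>l<N. C a b l * \<rho>' (x l) $$ (i, j))" for a b i j
  have "\<forall>l<N. \<forall>n<N. \<exists>c. (\<forall>e<N. c e \<in> K) \<and> x l \<otimes> x n = (\<Oplus>e\<in>{..<N}. \<iota> (c e) \<otimes> x e)"
    using span m_closed x by blast
  \<comment> \<open>Structure constants of the algebra in the basis x. They lie in \<open>K\<close>,
    hence \<open>\<rho>\<close> and \<open>\<rho>'\<close> transport them identically, and a product
    identity valid for one can be moved to the other.\<close>
  then obtain \<gamma> where \<gamma>: "\<And>l n e. \<lbrakk>l < N; n < N; e < N\<rbrakk> \<Longrightarrow> \<gamma> l n e \<in> K"
    "\<And>l n. \<lbrakk>l < N; n < N\<rbrakk> \<Longrightarrow> x l \<otimes> x n = (\<Oplus>e\<in>{..<N}. \<iota> (\<gamma> l n e) \<otimes> x e)"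
    by metis
  have prod: "(\<Sum>h<M. (\<Sum>l<N. u l * \<sigma> (x l) $$ (i, h)) * (\<Sum>n<N. v n * \<sigma> (x n) $$ (h, j)))
      = (\<Sum>e<N. (\<Sum>l<N. \<Sum>n<N. u l * v n * \<gamma> l n e) * \<sigma> (x e) $$ (i, j))"
    if \<sigma>: "matrix_rep M \<sigma>" and ij: "i < M" "j < M" for M \<sigma> u v i j
  proof -
    have "(\<Sum>h<M. (\<Sum>l<N. u l * \<sigma> (x l) $$ (i, h)) * (\<Sum>n<N. v n * \<sigma> (x n) $$ (h, j)))
      = (\<Sum>h<M. \<Sum>l<N. \<Sum>n<N. u l * v n * (\<sigma> (x l) $$ (i, h) * \<sigma> (x n) $$ (h, j)))"
      by (simp add: sum_product mult_ac)
    also have "\<dots> = (\<Sum>l<N. \<Sum>n<N. u l * v n * (\<Sum>h<M. \<sigma> (x l) $$ (i, h) * \<sigma> (x n) $$ (h, j)))"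
      unfolding sum_distrib_left by (rule sum_rotate3[symmetric])
    also have "\<dots> = (\<Sum>l<N. \<Sum>n<N. \<Sum>e<N. u l * v n * \<gamma> l n e * \<sigma> (x e) $$ (i, j))"
    proof (intro sum.cong refl)
      fix l n assume "l \<in> {..<N}" "n \<in> {..<N}"
      then have ln: "l < N" "n < N" by auto
      have "(\<Sum>h<M. \<sigma> (x l) $$ (i, h) * \<sigma> (x n) $$ (h, j)) = \<sigma> (x l \<otimes> x n) $$ (i, j)"
        using matrix_rep_mult_index[OF \<sigma>] x ln ij by simp
      also have "\<dots> = (\<Sum>e<N. \<gamma> l n e * \<sigma> (x e) $$ (i, j))"
        unfolding \<gamma>(2)[OF ln] using \<gamma>(1)[OF ln] x by (intro matrix_rep_combination[OF \<sigma>] ij) auto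
      finally show "u l * v n * (\<Sum>h<M. \<sigma> (x l) $$ (i, h) * \<sigma> (x n) $$ (h, j))
          = (\<Sum>e<N. u l * v n * \<gamma> l n e * \<sigma> (x e) $$ (i, j))"
        by (simp add: sum_distrib_left mult.assoc)
    qed
    also have "\<dots> = (\<Sum>e<N. (\<Sum>l<N. \<Sum>n<N. u l * v n * \<gamma> l n e) * \<sigma> (x e) $$ (i, j))"
      unfolding sum_distrib_right by (rule sum_rotate3)
    finally show ?thesis .
  qed
  have mu: "(\<Sum>h<k. f a b i h * f c d h j) = (if b = c then f a d i j else 0)"
    if "a < m" "b < m" "c < m" "d < m" "i < k" "j < k" for a b c d i j
  proof -
    \<comment> \<open>The matrix unit relations hold for \<open>\<rho>\<close> by the choice of
      \<open>C\<close>. Independence of the \<open>\<rho> (x l)\<close> turns them into identities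
      between coordinates, which no longer mention a representation.\<close>
    have coeff: "(\<Sum>l<N. \<Sum>n<N. C a b l * C c d n * \<gamma> l n e) = (if b = c then C a d e else 0)"
      if e: "e < N" for e
    proof (rule eq_coeffs[OF _ e])
      fix i j assume ij: "i < m" "j < m"
      have "(\<Sum>e<N. (\<Sum>l<N. \<Sum>n<N. C a b l * C c d n * \<gamma> l n e) * \<rho> (x e) $$ (i, j))
          = (\<Sum>h<m. (if i = a \<and> h = b then 1 else 0) * (if h = c \<and> j = d then 1 else 0))"
        using \<open>a < m\<close> \<open>b < m\<close> \<open>c < m\<close> \<open>d < m\<close> ij CR by (subst prod[OF rep ij, symmetric]) simp
      also have "\<dots> = (\<Sum>h<m. if h = b then if i = a \<and> b = c \<and> j = d then 1 else 0 else 0)"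
        by (intro sum.cong) auto
      also have "\<dots> = (\<Sum>e<N. (if b = c then C a d e else 0) * \<rho> (x e) $$ (i, j))"
        using \<open>a < m\<close> \<open>b < m\<close> \<open>c < m\<close> \<open>d < m\<close> ij CR by (cases "b = c") auto
      finally show "(\<Sum>e<N. (\<Sum>l<N. \<Sum>n<N. C a b l * C c d n * \<gamma> l n e) * \<rho> (x e) $$ (i, j))
         = (\<Sum>e<N. (if b = c then C a d e else 0) * \<rho> (x e) $$ (i, j))" .
    qed
    show ?thesis unfolding f_def prod[OF rep' \<open>i < k\<close> \<open>j < k\<close>] using coeff by auto
  qed
  have one: "(\<Sum>a<m. f a a i j) = (if i = j then 1 else 0)" if ij: "i < k" "j < k" for i j
  proof -
    obtain \<epsilon> where \<epsilon>: "\<forall>l<N. \<epsilon> l \<in> K" "\<one> = (\<Oplus>l\<in>{..<N}. \<iota> (\<epsilon> l) \<otimes> x l)"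
      using span[OF one_closed] by blast
    have rep_one: "(\<Sum>l<N. \<epsilon> l * \<sigma> (x l) $$ (i, j)) = (if i = j then 1 else 0)"
      if "matrix_rep M \<sigma>" "i < M" "j < M" for M \<sigma> i j
      using matrix_rep_combination[OF that(1) _ _ that(2,3), of N \<epsilon> x] \<epsilon> x
        matrix_rep_one[OF that(1)] that(2,3) by simp
    have "(\<Sum>a<m. C a a l) = \<epsilon> l" if l: "l < N" for l
    proof (rule eq_coeffs[OF _ l])
      fix i j assume ij: "i < m" "j < m"
      have "(\<Sum>l<N. (\<Sum>a<m. C a a l) * \<rho> (x l) $$ (i, j))
          = (\<Sum>a<m. \<Sum>l<N. C a a l * \<rho> (x l) $$ (i, j))"
        unfolding sum_distrib_right by (rule sum.swap)
      also have "\<dots> = (\<Sum>a<m. if a = i then if i = j then 1 else 0 else 0)"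
        using ij CR by (intro sum.cong) auto
      finally show "(\<Sum>l<N. (\<Sum>a<m. C a a l) * \<rho> (x l) $$ (i, j)) = (\<Sum>l<N. \<epsilon> l * \<rho> (x l) $$ (i, j))"
        using rep_one[OF rep ij] ij by simp
    qed
    moreover have "(\<Sum>a<m. f a a i j) = (\<Sum>l<N. (\<Sum>a<m. C a a l) * \<rho>' (x l) $$ (i, j))"
      unfolding f_def sum_distrib_right by (rule sum.swap)
    ultimately show ?thesis using rep_one[OF rep' ij] by simp
  qed
  obtain w where m: "m > 0" "m \<le> k"
    and act: "\<And>a b c i. \<lbrakk>a < m; b < m; c < m; i < k\<rbrakk> \<Longrightarrow>
       (\<Sum>l<k. f a b i l * w c l) = (if b = c then w a i else 0)"
    and w: "\<And>x c. \<lbrakk>\<And>i. i < k \<Longrightarrow> (\<Sum>c<m. x c * w c i) = 0; c < m\<rbrakk> \<Longrightarrow> x c = 0"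
    by (rule matrix_units_basis[of m k f, OF mu one k]) (assumption | rule that | blast)+
  have "det (\<rho> d) = det (\<rho>' d)" if "m = k" and d: "d \<in> carrier D" for d
  proof -
    define P where "P = mat m m (\<lambda>(i, c). w c i)"
    have P: "P \<in> carrier_mat m m" by (simp add: P_def)
    have rd: "\<rho> d \<in> carrier_mat m m" "\<rho>' d \<in> carrier_mat m m"
      using matrix_rep_carrier[OF rep d] matrix_rep_carrier[OF rep' d] \<open>m = k\<close> by auto
    have "det P \<noteq> 0"
    proof
      assume "det P = 0"
      then obtain v where v: "v \<in> carrier_vec m" "v \<noteq> 0\<^sub>v m" "P *\<^sub>v v = 0\<^sub>v m"
        using det_0_iff_vec_prod_zero[OF P] by auto
      have "(\<Sum>c<m. v $ c * w c i) = 0" if i: "i < k" for i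
      proof -
        have "(\<Sum>c<m. v $ c * w c i) = (P *\<^sub>v v) $ i"
          using i v(1) \<open>m = k\<close> by (auto simp: P_def scalar_prod_def mult.commute atLeast0LessThan)
        then show ?thesis using v i \<open>m = k\<close> by simp
      qed
      then have "v $ c = 0" if "c < m" for c using w[of "\<lambda>c. v $ c"] that by blast
      then show False using v by (auto simp: vec_eq_iff)
    qed
    obtain c where c: "\<forall>l<N. c l \<in> K" "d = (\<Oplus>l\<in>{..<N}. \<iota> (c l) \<otimes> x l)"
      using span[OF d] by blast
    \<comment> \<open>\<open>\<rho>'\<close> factors through matrices: the elementary matrix (a, b)
      goes to f a b.\<close>
    have rho': "\<rho>' d $$ (i, j) = (\<Sum>a<m. \<Sum>b<m. \<rho> d $$ (a, b) * f a b i j)"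
      if ij: "i < k" "j < k" for i j
    proof -
      have "(\<Sum>a<m. \<Sum>b<m. \<rho> d $$ (a, b) * f a b i j)
          = (\<Sum>a<m. \<Sum>b<m. \<Sum>l<N. \<Sum>n<N. c l * \<rho>' (x n) $$ (i, j) * (\<rho> (x l) $$ (a, b) * C a b n))"
        using c x by (simp add: matrix_rep_combination[OF rep] f_def sum_product mult_ac)
      also have "\<dots> = (\<Sum>l<N. \<Sum>n<N. c l * \<rho>' (x n) $$ (i, j) *
                        (\<Sum>a<m. \<Sum>b<m. \<rho> (x l) $$ (a, b) * C a b n))"
        unfolding sum_distrib_left
        by (subst sum_rotate3, intro sum.cong refl sum_rotate3)
      also have "\<dots> = (\<Sum>l<N. \<Sum>n<N. if n = l then c l * \<rho>' (x n) $$ (i, j) else 0)"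
        using RC by (intro sum.cong) auto
      also have "\<dots> = (\<Sum>l<N. c l * \<rho>' (x l) $$ (i, j))" by simp
      also have "\<dots> = \<rho>' d $$ (i, j)" using c x ij by (simp add: matrix_rep_combination[OF rep'])
      finally show ?thesis by simp
    qed
    \<comment> \<open>The f a b permute the columns of P as elementary matrices permute the standard
      basis, so P intertwines the two representations.\<close>
    have "\<rho>' d * P = P * \<rho> d"
    proof (rule eq_matI)
      fix i e assume "i < dim_row (P * \<rho> d)" "e < dim_col (P * \<rho> d)"
      then have ie: "i < m" "e < m" using P rd by auto
      have "(\<rho>' d * P) $$ (i, e) = (\<Sum>j<k. \<rho>' d $$ (i, j) * w e j)"
        using ie rd \<open>m = k\<close> by (simp add: P_def scalar_prod_def atLeast0LessThan)
      also have "\<dots> = (\<Sum>j<k. \<Sum>a<m. \<Sum>b<m. \<rho> d $$ (a, b) * (f a b i j * w e j))"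
        using ie \<open>m = k\<close> by (simp add: rho' sum_distrib_right mult.assoc)
      also have "\<dots> = (\<Sum>a<m. \<Sum>b<m. \<rho> d $$ (a, b) * (\<Sum>j<k. f a b i j * w e j))"
        unfolding sum_distrib_left by (rule sum_rotate3[symmetric])
      also have "\<dots> = (\<Sum>a<m. \<Sum>b<m. if b = e then \<rho> d $$ (a, b) * w a i else 0)"
        using act ie \<open>m = k\<close> by (intro sum.cong) auto
      also have "\<dots> = (P * \<rho> d) $$ (i, e)"
        using ie rd by (simp add: P_def scalar_prod_def atLeast0LessThan mult.commute)
      finally show "(\<rho>' d * P) $$ (i, e) = (P * \<rho> d) $$ (i, e)" .
    qed (use P rd in auto)
    then have "det (\<rho>' d) * det P = det P * det (\<rho> d)"
      using det_mult[OF rd(2) P] det_mult[OF P rd(1)] by argo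
    then show ?thesis using \<open>det P \<noteq> 0\<close> by (simp add: mult.commute)
  qed
  then show ?thesis using m by blast
qed

text \<open>Each of two splittings serves as the representation to which the other is compared. This
  forces equal sizes, and conjugacy then gives equal determinants.\<close>

theorem reduced_norm_eq_det:
  assumes split: "splitting K \<iota> D E m \<rho>" and d: "d \<in> carrier D"
  shows "reduced_norm K \<iota> D d = det (\<rho> d)"
  unfolding reduced_norm_def
proof (rule the_equality)
  show "\<exists>E m \<rho>'. splitting K \<iota> D E m \<rho>' \<and> det (\<rho> d) = det (\<rho>' d)" using split by blast
next
  fix z assume "\<exists>E m \<rho>. splitting K \<iota> D E m \<rho> \<and> z = det (\<rho> d)"
  then obtain E' m' \<rho>' where split': "splitting K \<iota> D E' m' \<rho>'" and z: "z = det (\<rho>' d)" by blast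
  have rep: "matrix_rep m \<rho>" "matrix_rep m' \<rho>'"
    using split split' by (auto simp: splitting_def matrix_rep_def)
  have "m' > 0 \<Longrightarrow> m > 0 \<and> m \<le> m' \<and> (m = m' \<longrightarrow> det (\<rho> d) = det (\<rho>' d))"
    using splitting_conjugate[OF split rep(2)] d by blast
  moreover have "m > 0 \<Longrightarrow> m' > 0 \<and> m' \<le> m"
    using splitting_conjugate[OF split' rep(1)] by blast
  \<comment> \<open>The comparison requires a positive size; in size 0 both determinants are
    1.\<close>
  moreover have "det (\<rho> d) = det (\<rho>' d)" if "m = 0" "m' = 0"
    using matrix_rep_carrier[OF rep(1) d] matrix_rep_carrier[OF rep(2) d] that by simp
  ultimately show "z = det (\<rho> d)" unfolding z by (metis le_antisym not_gr_zero)
qed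

end

section \<open>Roots of unity\<close>

lemma primitive_root_power_eq_1_iff:
  assumes "primitive_root_of_unity N z" "N > 0"
  shows "z ^ e = 1 \<longleftrightarrow> N dvd e"
proof -
  have "z ^ e = z ^ (N * (e div N) + e mod N)" by simp
  also have "\<dots> = z ^ (e mod N)"
    using assms(1) by (simp only: power_add power_mult primitive_root_of_unity_def power_one mult_1_left)
  finally have "z ^ e = 1 \<longleftrightarrow> e mod N = 0"
    using assms by (auto simp: primitive_root_of_unity_def intro: gr0I)
  then show ?thesis by (simp add: dvd_eq_mod_eq_0)
qed

lemma primitive_root_nonzero: "primitive_root_of_unity N z \<Longrightarrow> N > 0 \<Longrightarrow> z \<noteq> 0"
  by (auto simp: primitive_root_of_unity_def power_0_left split: if_splits)

lemma primitive_root_power_eq_iff: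
  assumes z: "primitive_root_of_unity N z" and N: "N > 0"
  shows "z ^ a = z ^ b \<longleftrightarrow> [a = b] (mod N)"
proof -
  have z0: "z \<noteq> 0" by (rule primitive_root_nonzero[OF assms])
  have *: "z ^ a = z ^ b \<longleftrightarrow> [a = b] (mod N)" if "a \<le> b" for a b
  proof -
    have "z ^ b = z ^ a * z ^ (b - a)" using that by (simp flip: power_add)
    then have "z ^ a = z ^ b \<longleftrightarrow> z ^ (b - a) = 1" using z0 by auto
    also have "\<dots> \<longleftrightarrow> [a = b] (mod N)"
      using that by (simp add: primitive_root_power_eq_1_iff[OF assms] cong_sym_eq[of a] cong_altdef_nat)
    finally show ?thesis .
  qed
  show ?thesis using *[of a b] *[of b a] by (cases "a \<le> b") (auto simp: cong_sym_eq eq_commute)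
qed

text \<open>Otherwise the difference would be nonzero of degree less than the number of its
  roots.\<close>

lemma monic_eq_prod_roots:
  fixes P :: "'b::field poly"
  assumes "finite S" "card S = degree P" "lead_coeff P = 1" and roots: "\<And>x. x \<in> S \<Longrightarrow> poly P x = 0"
  shows "P = (\<Prod>x\<in>S. [:- x, 1:])"
proof (rule ccontr)
  assume ne: "P \<noteq> (\<Prod>x\<in>S. [:- x, 1:])"
  let ?Q = "\<Prod>x\<in>S. [:- x, 1:]"
  have deg: "degree ?Q = degree P"
    using assms by (subst degree_prod_eq_sum_degree) auto
  moreover have "lead_coeff ?Q = 1" by (simp add: lead_coeff_prod)
  ultimately have "coeff (P - ?Q) (degree P) = 0" using assms(3) by simp
  moreover have "degree (P - ?Q) \<le> degree P" using deg degree_diff_le by (metis order_refl)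
  ultimately have "degree (P - ?Q) < degree P"
    using ne by (metis le_neq_implies_less leading_coeff_0_iff right_minus_eq)
  moreover have "card S \<le> card {x. poly (P - ?Q) x = 0}"
    using assms(1) roots ne
    by (intro card_mono poly_roots_finite) (auto simp: poly_prod prod_zero_iff)
  moreover have "card {x. poly (P - ?Q) x = 0} \<le> degree (P - ?Q)"
    using ne by (intro card_poly_roots_bound) auto
  ultimately show False using assms(2) by simp
qed

text \<open>The nontrivial powers of w are the roots of 1 + X + ... + X^(N-1); the claim is this
  factorisation evaluated at 1.\<close>

lemma prod_one_minus_root_powers:
  fixes w :: "'b::field"
  assumes w: "primitive_root_of_unity N w" and N: "N > 0"
  shows "(\<Prod>i\<in>{0<..<N}. 1 - w ^ i) = of_nat N"
proof -
  define P where "P = (\<Sum>i<N. monom (1::'b) i)"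
  have coeff: "coeff P k = (if k < N then 1 else 0)" for k
    by (simp add: P_def coeff_sum if_distrib cong: if_cong)
  have deg: "degree P = N - 1"
    using N by (intro antisym degree_le le_degree) (auto simp: coeff)
  have inj: "inj_on (\<lambda>i. w ^ i) {0<..<N}"
    by (auto simp: inj_on_def primitive_root_power_eq_iff[OF w N] cong_less_modulus_unique_nat)
  have "P = (\<Prod>x\<in>(\<lambda>i. w ^ i) ` {0<..<N}. [:- x, 1:])"
  proof (rule monic_eq_prod_roots)
    show "card ((\<lambda>i. w ^ i) ` {0<..<N}) = degree P" using inj by (simp add: card_image deg)
    show "lead_coeff P = 1" using N by (simp add: deg coeff)
  next
    fix x assume "x \<in> (\<lambda>i. w ^ i) ` {0<..<N}"
    then obtain i where i: "0 < i" "i < N" "x = w ^ i" by auto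
    have "x \<noteq> 1" using i by (simp add: primitive_root_power_eq_1_iff[OF w N] nat_dvd_not_less)
    moreover have "x ^ N = 1"
      using i by (simp add: primitive_root_power_eq_1_iff[OF w N] flip: power_mult)
    ultimately show "poly P x = 0"
      by (simp add: P_def poly_sum poly_monom geometric_sum)
  qed simp
  then have "poly P 1 = (\<Prod>i\<in>{0<..<N}. 1 - w ^ i)"
    using inj by (simp add: poly_prod prod.reindex)
  then show ?thesis by (simp add: P_def poly_sum poly_monom)
qed

lemma primitive_root_power:
  assumes "primitive_root_of_unity (a * b) z" "a > 0" "b > 0"
  shows "primitive_root_of_unity b (z ^ a)"
  unfolding primitive_root_of_unity_def power_mult[symmetric]
  using assms by (auto simp: primitive_root_power_eq_1_iff[OF assms(1)] dest: dvd_imp_le)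

text \<open>The value of a cyclotomic polynomial at 1, obtained as a quotient: in the product for
  p^r the exponents divisible by p form the product for p^(r-1) and the root z^p.\<close>

lemma prime_eq_prod_root_powers:
  fixes z :: "'b::field"
  assumes p: "prime p" and z: "primitive_root_of_unity (p ^ r) z" and r: "r \<ge> 1"
    and nz: "of_nat p \<noteq> (0::'b)"
  shows "of_nat p = (\<Prod>i\<in>totatives (p ^ r). 1 - z ^ i)"
proof -
  have p1: "p > 1" using prime_gt_1_nat[OF p] .
  have pr: "p ^ r = p * p ^ (r - 1)" using r by (simp flip: power_Suc)
  have zp: "primitive_root_of_unity (p ^ (r - 1)) (z ^ p)"
    using z p1 unfolding pr by (intro primitive_root_power) auto
  have tot: "totatives (p ^ r) = {i \<in> {0<..<p ^ r}. \<not> p dvd i}"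
  proof -
    have cop: "coprime i p \<longleftrightarrow> \<not> p dvd i" for i
      using p1 prime_imp_coprime[OF p, of i] coprime_common_divisor[of i p p]
      by (auto simp: coprime_commute)
    have mem: "i \<in> totatives (p ^ r) \<longleftrightarrow> 0 < i \<and> i \<le> p ^ r \<and> \<not> p dvd i" for i
      using r unfolding totatives_def mem_Collect_eq greaterThanAtMost_iff coprime_power_right_iff cop
      by simp
    have "i < p ^ r" if "i \<le> p ^ r" "\<not> p dvd i" for i
      using that pr by (metis dvd_triv_left le_neq_implies_less)
    then show ?thesis by (auto simp: mem)
  qed
  have split: "{0<..<p ^ r} = totatives (p ^ r) \<union> (\<lambda>j. p * j) ` {0<..<p ^ (r - 1)}"
    unfolding tot unfolding pr using p1 by (auto elim!: dvdE)
  have "of_nat p * of_nat (p ^ (r - 1)) = (of_nat (p ^ r) :: 'b)" by (simp add: pr)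
  also have "\<dots> = (\<Prod>i\<in>{0<..<p ^ r}. 1 - z ^ i)"
    using p1 by (intro prod_one_minus_root_powers[OF z, symmetric]) simp
  also have "\<dots> = (\<Prod>i\<in>totatives (p ^ r). 1 - z ^ i) * (\<Prod>i\<in>(\<lambda>j. p * j) ` {0<..<p ^ (r - 1)}. 1 - z ^ i)"
    unfolding split by (intro prod.union_disjoint) (auto simp: tot)
  also have "(\<Prod>i\<in>(\<lambda>j. p * j) ` {0<..<p ^ (r - 1)}. 1 - z ^ i)
      = (\<Prod>j\<in>{0<..<p ^ (r - 1)}. 1 - (z ^ p) ^ j)"
    using p1 by (subst prod.reindex) (auto simp: inj_on_def power_mult)
  also have "\<dots> = of_nat (p ^ (r - 1))"
    using p1 by (intro prod_one_minus_root_powers[OF zp]) simp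
  finally show ?thesis using nz by simp
qed

text \<open>Each factor 1 - w^i in the product for p is a multiple of 1 - w, and there are
  \<phi>(p^r) factors. This is where the totient in \<open>Phi_k\<close> originates.\<close>

lemma prime_mem_power_ideal:
  assumes "unital_subring (A :: 'b::field set)" "w \<in> A"
    and "prime p" "primitive_root_of_unity (p ^ r) w" "r \<ge> 1" "of_nat p \<noteq> (0::'b)"
  shows "\<exists>a\<in>A. of_nat p = (1 - w) ^ totient (p ^ r) * a"
proof -
  interpret A: unital_subring A by fact
  have "of_nat p = (\<Prod>i\<in>totatives (p ^ r). (1 - w) * (\<Sum>j<i. w ^ j))"
    using prime_eq_prod_root_powers[OF assms(3-6)] by (simp add: one_diff_power_eq)
  also have "\<dots> = (1 - w) ^ totient (p ^ r) * (\<Prod>i\<in>totatives (p ^ r). \<Sum>j<i. w ^ j)"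
    by (simp add: prod.distrib totient_def)
  finally show ?thesis by (auto intro!: A.prod_mem A.sum_mem A.power_mem assms)
qed

section \<open>Congruences for p-th powers\<close>

lemma (in unital_subring) frobenius:
  assumes p: "prime p" and "x \<in> R" "y \<in> R"
  shows "\<exists>w\<in>R. (x + y) ^ p = x ^ p + y ^ p + of_nat p * w"
proof -
  have p1: "p > 1" using prime_gt_1_nat[OF p] .
  have "(x + y) ^ p = (\<Sum>k\<in>{..p}. of_nat (p choose k) * x ^ k * y ^ (p - k))"
    by (rule binomial_ring)
  also have "{..p} = insert 0 (insert p {0<..<p})" using p1 by auto
  also have "(\<Sum>k\<in>\<dots>. of_nat (p choose k) * x ^ k * y ^ (p - k))
      = x ^ p + y ^ p + (\<Sum>k\<in>{0<..<p}. of_nat (p choose k) * x ^ k * y ^ (p - k))"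
    using p1 by simp
  also have "(\<Sum>k\<in>{0<..<p}. of_nat (p choose k) * x ^ k * y ^ (p - k))
      = (\<Sum>k\<in>{0<..<p}. of_nat p * (of_nat ((p choose k) div p) * x ^ k * y ^ (p - k)))"
  proof (intro sum.cong refl)
    fix k assume "k \<in> {0<..<p}"
    then have "p dvd p choose k" using p by (intro dvd_choose_prime) auto
    then have "(of_nat (p choose k) :: 'a) = of_nat p * of_nat ((p choose k) div p)"
      by (simp flip: of_nat_mult)
    then show "of_nat (p choose k) * x ^ k * y ^ (p - k)
        = of_nat p * (of_nat ((p choose k) div p) * x ^ k * y ^ (p - k))"
      by (simp add: mult.assoc)
  qed
  also have "\<dots> = of_nat p * (\<Sum>k\<in>{0<..<p}. of_nat ((p choose k) div p) * x ^ k * y ^ (p - k))"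
    by (simp add: sum_distrib_left)
  finally show ?thesis
    by (rule bexI) (intro sum_mem mult_mem of_nat_mem power_mem assms)
qed

text \<open>Iterated Frobenius congruence modulo p. Oddness of p preserves the minus sign at each
  step, and the error p w of the previous step stays divisible by p when raised to the p-th
  power.\<close>

lemma (in unital_subring) frobenius_one_minus:
  assumes p: "prime p" "odd p" and x: "x \<in> R"
  shows "\<exists>w\<in>R. (1 - x) ^ (p ^ k) = 1 - x ^ (p ^ k) + of_nat p * w"
proof (induction k)
  case 0
  show ?case by (intro bexI[of _ 0]) (auto simp: zero_mem)
next
  case (Suc k)
  then obtain w where w: "w \<in> R" "(1 - x) ^ (p ^ k) = 1 - x ^ (p ^ k) + of_nat p * w" by blast
  let ?y = "x ^ (p ^ k)"
  have y: "?y \<in> R" by (intro power_mem x)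
  have odd: "(- ?y) ^ p = - (?y ^ p)" using p(2) by (simp add: power_minus_odd)
  obtain v where v: "v \<in> R" "(1 + - ?y) ^ p = 1 ^ p + (- ?y) ^ p + of_nat p * v"
    using frobenius[OF p(1) one_mem uminus_mem[OF y]] by blast
  obtain u where u: "u \<in> R"
    "(1 - ?y + of_nat p * w) ^ p = (1 - ?y) ^ p + (of_nat p * w) ^ p + of_nat p * u"
    using frobenius[OF p(1), of "1 - ?y" "of_nat p * w"] w(1) y
    by (auto intro: diff_mem one_mem mult_mem of_nat_mem)
  have p0: "(of_nat p * w) ^ p = of_nat p * (of_nat p ^ (p - 1) * w ^ p)"
    using prime_gt_0_nat[OF p(1)] by (cases p) (simp_all add: power_mult_distrib mult.assoc)
  have "(1 - x) ^ (p ^ Suc k) = ((1 - x) ^ (p ^ k)) ^ p" by (simp add: mult.commute flip: power_mult)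
  also have "\<dots> = 1 - ?y ^ p + of_nat p * (v + of_nat p ^ (p - 1) * w ^ p + u)"
    using v(2) unfolding w(2) u(2) p0 odd by (simp add: algebra_simps)
  also have "?y ^ p = x ^ (p ^ Suc k)" by (simp add: mult.commute flip: power_mult)
  finally show ?case
    by (rule bexI) (intro add_mem mult_mem power_mem of_nat_mem v u w)
qed

text \<open>For odd p, raising a number congruent to 1 modulo p to the p-th power increases the
  p-adic valuation of its distance from 1 by exactly one.\<close>

lemma one_plus_prime_power_pow:
  fixes p :: nat
  assumes p: "prime p" "odd p" and r: "r \<ge> 1"
  shows "\<exists>u. \<not> p dvd u \<and> (1 + p ^ r) ^ (p ^ k) = 1 + p ^ (r + k) * u"
proof (induction k)
  case 0
  show ?case using prime_gt_1_nat[OF p(1)] by (intro exI[of _ 1]) auto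
next
  case (Suc k)
  then obtain u where u: "\<not> p dvd u" "(1 + p ^ r) ^ (p ^ k) = 1 + p ^ (r + k) * u" by blast
  define m where "m = r + k"
  define x where "x = p ^ m * u"
  have m: "m \<ge> 1" using r by (simp add: m_def)
  have "p \<noteq> 2" using p(2) by auto
  then have p3: "p \<ge> 3" using prime_ge_2_nat[OF p(1)] by linarith
  have "(1 + x) ^ p = (\<Sum>i\<in>{..p}. (p choose i) * x ^ i)"
    using binomial[of x 1 p] by (simp add: add.commute)
  also have "{..p} = insert 0 (insert 1 {2..p})" using p3 by auto
  also have "(\<Sum>i\<in>\<dots>. (p choose i) * x ^ i) = 1 + p * x + (\<Sum>i\<in>{2..p}. (p choose i) * x ^ i)"
    by simp
  finally have exp: "(1 + x) ^ p = 1 + p * x + (\<Sum>i\<in>{2..p}. (p choose i) * x ^ i)" .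
  \<comment> \<open>One power more than the linear term p x contains. For i = 2 the binomial
    coefficient contributes a factor p, since p > 2, and 2 m + 1 >= m + 2; for i >= 3 one has 3 m >=
    m + 2.\<close>
  have "p ^ (m + 2) dvd (p choose i) * x ^ i" if i: "i \<in> {2..p}" for i
  proof (cases "i = 2")
    case True
    have "p dvd p choose i" using p(1) p3 True by (intro dvd_choose_prime) auto
    moreover have "p ^ (m + m) dvd x ^ i" using True by (simp add: x_def power2_eq_square power_add)
    ultimately have "p * p ^ (m + m) dvd (p choose i) * x ^ i" by (rule mult_dvd_mono)
    moreover have "p ^ (m + 2) dvd p * p ^ (m + m)"
      using m by (simp add: le_imp_power_dvd flip: power_Suc)
    ultimately show ?thesis by (rule dvd_trans[rotated])
  next
    case False
    then have i3: "i \<ge> 3" using i by auto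
    have "m + 2 \<le> m * 3" using m by simp
    also have "\<dots> \<le> m * i" using i3 by simp
    finally have "p ^ (m + 2) dvd (p ^ m) ^ i"
      unfolding power_mult[symmetric] by (rule le_imp_power_dvd)
    then show ?thesis by (simp add: x_def power_mult_distrib)
  qed
  then have "p ^ (m + 2) dvd (\<Sum>i\<in>{2..p}. (p choose i) * x ^ i)" by (rule dvd_sum)
  then obtain w where w: "(\<Sum>i\<in>{2..p}. (p choose i) * x ^ i) = p ^ (m + 2) * w" by (elim dvdE)
  have "(1 + p ^ r) ^ (p ^ Suc k) = (1 + x) ^ p"
    unfolding x_def m_def u(2)[symmetric] by (simp add: mult.commute flip: power_mult)
  also have "\<dots> = 1 + p ^ (r + Suc k) * (u + p * w)"
    unfolding exp w by (simp add: x_def m_def algebra_simps)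
  finally show ?case
    using u(1) by (intro exI[of _ "u + p * w"]) (auto simp: dvd_add_left_iff)
qed

text \<open>The multiplicative order of 1 + p^r modulo p^(r+s) divides p^s, so it is a power of p,
  and exact valuations single out p^s. Hence \<open>g\<close> acts on z with order exactly
  p^s.\<close>

lemma one_plus_prime_power_cong_1_iff:
  fixes p :: nat
  assumes p: "prime p" "odd p" and r: "r \<ge> 1"
  shows "[(1 + p ^ r) ^ i = 1] (mod p ^ (r + s)) \<longleftrightarrow> p ^ s dvd i"
proof -
  have p1: "p > 1" using prime_gt_1_nat[OF p(1)] .
  have cong: "[(1 + p ^ r) ^ (p ^ k) = 1] (mod p ^ (r + s)) \<longleftrightarrow> s \<le> k" for k
  proof -
    obtain u where u: "\<not> p dvd u" "(1 + p ^ r) ^ (p ^ k) = 1 + p ^ (r + k) * u"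
      using one_plus_prime_power_pow[OF assms] by blast
    have "[1 + p ^ (r + k) * u = 1] (mod p ^ (r + s)) \<longleftrightarrow> p ^ (r + s) dvd p ^ (r + k) * u"
      using cong_to_1_nat[of "1 + p ^ (r + k) * u" "p ^ (r + s)"]
      by (auto simp: cong_altdef_nat)
    also have "\<dots> \<longleftrightarrow> s \<le> k"
    proof
      assume "s \<le> k"
      then show "p ^ (r + s) dvd p ^ (r + k) * u" by (intro dvd_mult2 le_imp_power_dvd) simp
    next
      assume d: "p ^ (r + s) dvd p ^ (r + k) * u"
      show "s \<le> k"
      proof (rule ccontr)
        assume "\<not> s \<le> k"
        then have "p ^ (r + k + 1) dvd p ^ (r + s)" by (intro le_imp_power_dvd) simp
        from dvd_trans[OF this d] have "p ^ (r + k) * p dvd p ^ (r + k) * u"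
          by (simp add: mult.commute)
        then show False using u(1) p1 by simp
      qed
    qed
    finally show ?thesis unfolding u(2) .
  qed
  define e where "e = ord (p ^ (r + s)) (1 + p ^ r)"
  have div: "[(1 + p ^ r) ^ j = 1] (mod p ^ (r + s)) \<longleftrightarrow> e dvd j" for j
    unfolding e_def by (rule ord_divides)
  have "e dvd p ^ s" using cong[of s] div by simp
  then obtain k where k: "k \<le> s" "e = p ^ k" using divides_primepow_nat[OF p(1)] by blast
  have "s \<le> k" using cong[of k] div[of "p ^ k"] k by simp
  then show ?thesis using div k by simp
qed

section \<open>The cyclic extension\<close>

text \<open>The expression on the left encodes the difference k - i modulo N while avoiding
  truncated subtraction; the case k < i is the wrap-around.\<close>

lemma cyclic_diff_eq:
  fixes i k N :: nat
  assumes "i < N" "k < N"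
  shows "(k + N - i) mod N = (if k < i then k + N - i else k - i)"
proof (cases "k < i")
  case False
  then have eq: "k + N - i = k - i + N" by simp
  have "(k + N - i) mod N = (k - i) mod N" unfolding eq by (rule mod_add_self2)
  also have "\<dots> = k - i" using assms by (intro mod_less) simp
  finally show ?thesis using False by simp
qed (use assms in simp)

lemma cyclic_add_eq_iff:
  fixes i j k N :: nat
  assumes "i < N" "j < N" "k < N"
  shows "(i + j) mod N = k \<longleftrightarrow> j = (k + N - i) mod N"
proof -
  have "(i + j) mod N = (if i + j < N then i + j else i + j - N)"
    using assms by (simp add: mod_if)
  then show ?thesis using assms by (auto simp: cyclic_diff_eq)
qed

lemma cyclic_add_diff:
  fixes i j N :: nat
  assumes "i < N" "j < N"
  shows "((i + j) mod N + N - i) mod N = j" "(i + (j + N - i) mod N) mod N = j"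
  using cyclic_add_eq_iff[OF assms, of "(i + j) mod N"] assms
    cyclic_add_eq_iff[of i N "(j + N - i) mod N" j] by auto

text \<open>The carry of the sum of i and the residue of k - i. In the cyclic algebra it becomes the
  exponent of \<open>c\<close>.\<close>

lemma cyclic_add_div:
  fixes i k N :: nat
  assumes "i < N" "k < N"
  shows "(i + (k + N - i) mod N) div N = (if k < i then 1 else 0)"
  using assms by (auto simp: cyclic_diff_eq div_if)

text \<open>For iterates of an automorphism whose period closes after N steps, this says that a norm
  is fixed by the automorphism.\<close>

lemma prod_shift_invariant:
  fixes f :: "nat \<Rightarrow> 'c::comm_monoid_mult"
  assumes "f N = f 0"
  shows "(\<Prod>i<N. f (Suc i)) = (\<Prod>i<N. f i)"
proof -
  show ?thesis
  proof (cases N)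
    case (Suc n)
    have "(\<Prod>i<N. f (Suc i)) = (\<Prod>i<n. f (Suc i)) * f N" by (simp add: Suc)
    also have "\<dots> = (\<Prod>i<N. f i)"
      unfolding Suc assms[unfolded Suc] by (subst prod.lessThan_Suc_shift) (rule mult.commute)
    finally show ?thesis .
  qed simp
qed

text \<open>The situation of the theorem with power series forgotten: no completeness and no residue
  field appear. \<open>B_expansion\<close> asserts only existence of coordinates, and
  \<open>c\<close> stands for u^(p^s), that is 1 + T.\<close>

locale cyclic_extension =
  fixes p r s :: nat and A B K L :: "'b::field set" and z c :: 'b and g :: "'b \<Rightarrow> 'b"
  assumes p: "prime p" "odd p" and r: "r \<ge> 1" and s: "s \<ge> 1"
    and p_nonzero: "of_nat p \<noteq> (0::'b)"
    and subring_A: "unital_subring A" and subring_B: "unital_subring B" and A_subset_B: "A \<subseteq> B"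
    and K_eq: "K = fraction_field A" and L_eq: "L = fraction_field B"
    and z_root: "primitive_root_of_unity (p ^ (r + s)) z"
    and z_mem: "z \<in> B" and z_power_mem: "z ^ (p ^ s) \<in> A"
    and B_expansion: "x \<in> B \<Longrightarrow> \<exists>a. (\<forall>t. a t \<in> A) \<and> x = (\<Sum>t<p ^ s. a t * z ^ t)"
    and g_closed: "x \<in> L \<Longrightarrow> g x \<in> L"
    and g_add: "x \<in> L \<Longrightarrow> y \<in> L \<Longrightarrow> g (x + y) = g x + g y"
    and g_mult: "x \<in> L \<Longrightarrow> y \<in> L \<Longrightarrow> g (x * y) = g x * g y"
    and g_fixes: "x \<in> K \<Longrightarrow> g x = x"
    and g_z: "g z = z ^ (1 + p ^ r)"
    and c_mem: "c \<in> A" and c_nonzero: "c \<noteq> 0"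
begin

sublocale A: unital_subring A by (rule subring_A)
sublocale B: unital_subring B by (rule subring_B)
sublocale K: unital_subring K unfolding K_eq by (rule unital_subring_fraction_field[OF subring_A])
sublocale L: unital_subring L unfolding L_eq by (rule unital_subring_fraction_field[OF subring_B])

definition q :: nat where "q = p ^ s"

lemma q_pos: "q > 0" using prime_gt_0_nat[OF p(1)] by (simp add: q_def)

lemma q_nonzero: "of_nat q \<noteq> (0::'b)" using p_nonzero by (simp add: q_def)

lemmas z_power_q_mem = z_power_mem[folded q_def] and B_expansion_q = B_expansion[folded q_def]

lemma A_subset_K: "A \<subseteq> K" unfolding K_eq by (rule fraction_field_base[OF subring_A])

lemma B_subset_L: "B \<subseteq> L" unfolding L_eq by (rule fraction_field_base[OF subring_B])

lemma K_subset_L: "K \<subseteq> L" unfolding K_eq L_eq by (rule fraction_field_mono[OF A_subset_B])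

lemma K_inverse: "x \<in> K \<Longrightarrow> inverse x \<in> K" unfolding K_eq by (rule fraction_field_inverse)

lemma L_inverse: "x \<in> L \<Longrightarrow> inverse x \<in> L" unfolding L_eq by (rule fraction_field_inverse)

lemma K_divide: "x \<in> K \<Longrightarrow> y \<in> K \<Longrightarrow> x / y \<in> K"
  using K.mult_mem[OF _ K_inverse] by (simp add: divide_inverse)

lemma z_nonzero: "z \<noteq> 0"
  using primitive_root_nonzero[OF z_root] prime_gt_0_nat[OF p(1)] by simp

lemma funpow_closed: "x \<in> L \<Longrightarrow> (g ^^ i) x \<in> L"
  by (induction i) (auto intro: g_closed)

lemma funpow_add_hom: "x \<in> L \<Longrightarrow> y \<in> L \<Longrightarrow> (g ^^ i) (x + y) = (g ^^ i) x + (g ^^ i) y"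
  by (induction i) (auto simp: g_add funpow_closed)

lemma funpow_mult_hom: "x \<in> L \<Longrightarrow> y \<in> L \<Longrightarrow> (g ^^ i) (x * y) = (g ^^ i) x * (g ^^ i) y"
  by (induction i) (auto simp: g_mult funpow_closed)

lemma funpow_fixes: "x \<in> K \<Longrightarrow> (g ^^ i) x = x"
  by (induction i) (auto simp: g_fixes)

lemma funpow_zero: "(g ^^ i) 0 = 0" by (rule funpow_fixes[OF K.zero_mem])

lemma funpow_one: "(g ^^ i) 1 = 1" by (rule funpow_fixes[OF K.one_mem])

lemma funpow_sum_hom: "(\<And>x. x \<in> I \<Longrightarrow> f x \<in> L) \<Longrightarrow> (g ^^ i) (sum f I) = (\<Sum>x\<in>I. (g ^^ i) (f x))"
  by (induction I rule: infinite_finite_induct) (auto simp: funpow_zero funpow_add_hom L.sum_mem)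

lemma funpow_prod_hom: "(\<And>x. x \<in> I \<Longrightarrow> f x \<in> L) \<Longrightarrow> (g ^^ i) (prod f I) = (\<Prod>x\<in>I. (g ^^ i) (f x))"
  by (induction I rule: infinite_finite_induct) (auto simp: funpow_one funpow_mult_hom L.prod_mem)

lemma funpow_power_hom: "x \<in> L \<Longrightarrow> (g ^^ i) (x ^ k) = (g ^^ i) x ^ k"
  by (induction k) (auto simp: funpow_one funpow_mult_hom L.power_mem)

lemma funpow_uminus_hom: "x \<in> L \<Longrightarrow> (g ^^ i) (- x) = - (g ^^ i) x"
  using funpow_mult_hom[of "- 1" x i] funpow_fixes[OF K.uminus_mem[OF K.one_mem]]
  by (simp add: L.uminus_mem L.one_mem)

lemma funpow_eq_0_iff:
  assumes "x \<in> L" shows "(g ^^ i) x = 0 \<longleftrightarrow> x = 0"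
  using funpow_mult_hom[OF assms L_inverse[OF assms], of i] funpow_zero funpow_one
  by (cases "x = 0") auto

section \<open>Conjugates of z, orthogonality, and coordinates of elements of L\<close>

definition conj_z :: "nat \<Rightarrow> 'b" where "conj_z i = (g ^^ i) z"

lemma z_mem_L: "z \<in> L" using z_mem B_subset_L by blast

lemma conj_z_eq: "conj_z i = z ^ ((1 + p ^ r) ^ i)"
proof (induction i)
  case (Suc i)
  have "conj_z (Suc i) = (g ^^ i) (z ^ (1 + p ^ r))"
    by (simp add: conj_z_def funpow_swap1 g_z)
  also have "\<dots> = conj_z i ^ (1 + p ^ r)" unfolding conj_z_def by (rule funpow_power_hom[OF z_mem_L])
  finally show ?case by (simp only: Suc power_mult[symmetric] power_Suc mult.commute)
qed (simp add: conj_z_def)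

lemma conj_z_mem: "conj_z i \<in> B" unfolding conj_z_eq by (intro B.power_mem z_mem)

lemma conj_z_nonzero: "conj_z i \<noteq> 0" by (simp add: conj_z_eq z_nonzero)

lemma conj_z_power_q: "conj_z i ^ q = z ^ q"
  using funpow_power_hom[OF z_mem_L, of i q] funpow_fixes[of "z ^ q"] z_power_q_mem A_subset_K
  by (auto simp: conj_z_def)

text \<open>Since 1 + p^r is prime to p, its powers in the exponents may be cancelled modulo
  p^(r+s), which leaves the order of 1 + p^r.\<close>

lemma conj_z_eq_iff: "conj_z i = conj_z j \<longleftrightarrow> [i = j] (mod q)"
proof -
  have *: "conj_z i = conj_z j \<longleftrightarrow> [i = j] (mod q)" if "i \<le> j" for i j
  proof -
    let ?a = "1 + p ^ r"
    have cop: "coprime (p ^ (r + s)) (?a ^ i)"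
    proof -
      have "p dvd p ^ r" using r by (simp add: dvd_power)
      then have "\<not> p dvd ?a" using p(1) by (metis dvd_add_left_iff not_prime_unit)
      then show ?thesis using prime_imp_coprime[OF p(1)] by simp
    qed
    have "conj_z i = conj_z j \<longleftrightarrow> [?a ^ i * 1 = ?a ^ i * ?a ^ (j - i)] (mod p ^ (r + s))"
      using that prime_gt_0_nat[OF p(1)] unfolding conj_z_eq
      by (subst primitive_root_power_eq_iff[OF z_root]) (simp_all flip: power_add)
    also have "\<dots> \<longleftrightarrow> [1 = ?a ^ (j - i)] (mod p ^ (r + s))"
      using cop by (intro cong_mult_lcancel_nat) (simp add: coprime_commute)
    also have "\<dots> \<longleftrightarrow> q dvd j - i"
      using one_plus_prime_power_cong_1_iff[OF p r, of "j - i" s] by (simp add: cong_sym_eq q_def)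
    also have "\<dots> \<longleftrightarrow> [i = j] (mod q)"
      using that by (simp add: cong_altdef_nat cong_sym_eq[of i])
    finally show ?thesis .
  qed
  show ?thesis using *[of i j] *[of j i] by (cases "i \<le> j") (auto simp: cong_sym_eq eq_commute)
qed

lemma conj_z_inj: "i < q \<Longrightarrow> j < q \<Longrightarrow> conj_z i = conj_z j \<longleftrightarrow> i = j"
  by (simp add: conj_z_eq_iff cong_def)

text \<open>The quotient of two different conjugates is a q-th root of unity other than 1, because
  both have q-th power z^q; its geometric sum vanishes.\<close>

lemma row_orthogonality:
  assumes "i < q" "j < q"
  shows "(\<Sum>t<q. conj_z i ^ t / conj_z j ^ t) = (if i = j then of_nat q else 0)"
proof (cases "i = j")
  case True
  then show ?thesis by (simp add: conj_z_nonzero)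
next
  case False
  let ?x = "conj_z i / conj_z j"
  have "?x \<noteq> 1" using False assms conj_z_inj by (simp add: conj_z_nonzero)
  moreover have "?x ^ q = 1" by (simp add: power_divide conj_z_power_q z_nonzero)
  ultimately show ?thesis using False by (simp add: geometric_sum flip: power_divide)
qed

text \<open>The row relations exhibit a right inverse of the square matrix of powers of conjugates.
  It is also a left inverse, which is the other family of relations.\<close>

lemma column_orthogonality:
  assumes "t < q" "t' < q"
  shows "(\<Sum>i<q. conj_z i ^ t / conj_z i ^ t') = (if t = t' then of_nat q else 0)"
proof -
  define V where "V = mat q q (\<lambda>(i, t). conj_z i ^ t)"
  define W where "W = mat q q (\<lambda>(t, j). 1 / (of_nat q * conj_z j ^ t))"
  have carr: "V \<in> carrier_mat q q" "W \<in> carrier_mat q q" by (auto simp: V_def W_def)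
  have "V * W = 1\<^sub>m q"
  proof (rule eq_matI)
    fix i j assume "i < dim_row (1\<^sub>m q :: 'b mat)" "j < dim_col (1\<^sub>m q :: 'b mat)"
    then have ij: "i < q" "j < q" by auto
    have "(V * W) $$ (i, j) = (\<Sum>t<q. conj_z i ^ t * (1 / (of_nat q * conj_z j ^ t)))"
      using ij by (simp add: V_def W_def scalar_prod_def atLeast0LessThan)
    also have "\<dots> = (\<Sum>t<q. conj_z i ^ t / conj_z j ^ t) / of_nat q"
      unfolding sum_divide_distrib by (intro sum.cong refl) simp
    also have "\<dots> = 1\<^sub>m q $$ (i, j)" using ij q_nonzero by (simp add: row_orthogonality)
    finally show "(V * W) $$ (i, j) = 1\<^sub>m q $$ (i, j)" .
  qed (auto simp: V_def W_def)
  then have "W * V = 1\<^sub>m q" by (rule mat_mult_left_right_inverse[OF carr])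
  then have "(W * V) $$ (t', t) = 1\<^sub>m q $$ (t', t)" by simp
  moreover have "(W * V) $$ (t', t) = (\<Sum>i<q. 1 / (of_nat q * conj_z i ^ t') * conj_z i ^ t)"
    using assms by (simp add: V_def W_def scalar_prod_def atLeast0LessThan)
  moreover have "\<dots> = (\<Sum>i<q. conj_z i ^ t / conj_z i ^ t') / of_nat q"
    unfolding sum_divide_distrib by (intro sum.cong refl) simp
  ultimately show ?thesis using assms q_nonzero by (auto simp: field_simps)
qed

lemma conj_expansion:
  assumes "\<And>t. t < q \<Longrightarrow> a t \<in> K"
  shows "(g ^^ i) (\<Sum>t<q. a t * z ^ t) = (\<Sum>t<q. a t * conj_z i ^ t)"
proof -
  have "(g ^^ i) (\<Sum>t<q. a t * z ^ t) = (\<Sum>t<q. (g ^^ i) (a t * z ^ t))"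
    using assms K_subset_L by (intro funpow_sum_hom L.mult_mem L.power_mem z_mem_L) auto
  also have "\<dots> = (\<Sum>t<q. a t * conj_z i ^ t)"
    using assms K_subset_L z_mem_L
    by (intro sum.cong refl)
       (auto simp: funpow_mult_hom L.power_mem funpow_fixes funpow_power_hom conj_z_def subset_iff)
  finally show ?thesis .
qed

text \<open>Inverse discrete Fourier transform. For \<open>y i\<close> the i-th conjugate of an
  element x and t = 0, the right-hand side is the full trace of x.\<close>

lemma expansion_coeff:
  assumes y: "\<And>i. i < q \<Longrightarrow> y i = (\<Sum>t<q. a t * conj_z i ^ t)" and t: "t < q"
  shows "of_nat q * a t = (\<Sum>i<q. y i / conj_z i ^ t)"
proof -
  have "(\<Sum>i<q. y i / conj_z i ^ t) = (\<Sum>i<q. \<Sum>t'<q. a t' * (conj_z i ^ t' / conj_z i ^ t))"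
    by (simp add: y sum_divide_distrib)
  also have "\<dots> = (\<Sum>t'<q. a t' * (\<Sum>i<q. conj_z i ^ t' / conj_z i ^ t))"
    unfolding sum_distrib_left by (rule sum.swap)
  also have "\<dots> = (\<Sum>t'<q. if t' = t then of_nat q * a t' else 0)"
    using t by (intro sum.cong) (auto simp: column_orthogonality)
  also have "\<dots> = of_nat q * a t" using t by simp
  finally show ?thesis by simp
qed

lemma B_expansion_K:
  assumes "x \<in> B"
  obtains a where "\<And>t. a t \<in> A" "\<And>i. (g ^^ i) x = (\<Sum>t<q. a t * conj_z i ^ t)"
proof -
  obtain a where a: "\<forall>t. a t \<in> A" "x = (\<Sum>t<q. a t * z ^ t)" using B_expansion_q[OF assms] by blast
  then have "a t \<in> K" for t using A_subset_K by blast
  then have "(g ^^ i) x = (\<Sum>t<q. a t * conj_z i ^ t)" for i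
    unfolding a(2) by (intro conj_expansion)
  with a(1) show ?thesis by (intro that) blast+
qed

lemma funpow_closed_B: "x \<in> B \<Longrightarrow> (g ^^ i) x \<in> B"
  by (erule B_expansion_K[of x])
     (use A_subset_B in \<open>auto intro!: B.sum_mem B.mult_mem B.power_mem conj_z_mem\<close>)

lemma conj_z_add_q: "conj_z (i + q) = conj_z i"
  by (simp add: conj_z_eq_iff cong_def)

lemma funpow_q_B:
  assumes "x \<in> B" shows "(g ^^ q) x = x"
proof -
  obtain a where "\<And>i. (g ^^ i) x = (\<Sum>t<q. a t * conj_z i ^ t)"
    using B_expansion_K[OF assms] by metis
  from this[of q] this[of 0] show ?thesis using conj_z_add_q[of 0] by simp
qed

text \<open>All q conjugates of x coincide, so q times the constant coordinate of x is q x; that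
  coordinate lies in \<open>A\<close>.\<close>

lemma fixed_mem_A:
  assumes x: "x \<in> B" "g x = x" shows "x \<in> A"
proof -
  obtain a where a: "\<And>t. a t \<in> A" "\<And>i. (g ^^ i) x = (\<Sum>t<q. a t * conj_z i ^ t)"
    using B_expansion_K[OF x(1)] by metis
  have "(g ^^ i) x = x" for i by (induction i) (auto simp: x)
  then have "of_nat q * a 0 = (\<Sum>i<q. x / conj_z i ^ 0)"
    using a(2) q_pos by (intro expansion_coeff[of "\<lambda>i. x"]) simp_all
  then have "x = a 0" using q_nonzero by simp
  then show ?thesis using a(1) by simp
qed

text \<open>The powers z^t with 0 < t < q have trace 0, so the trace is q times the constant
  coordinate. This is the source of the divisibility of traces by p^s.\<close>

lemma trace_B:
  assumes x: "x \<in> B"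
  obtains a where "a \<in> A" "(\<Sum>i<q. (g ^^ i) x) = of_nat q * a"
proof -
  obtain a where a: "\<And>t. a t \<in> A" "\<And>i. (g ^^ i) x = (\<Sum>t<q. a t * conj_z i ^ t)"
    using B_expansion_K[OF x] by metis
  show ?thesis
    using expansion_coeff[of "\<lambda>i. (g ^^ i) x" a 0] a q_pos by (intro that[of "a 0"]) simp_all
qed

text \<open>The denominator is rationalised by the product of its other conjugates; its norm is
  fixed by \<open>g\<close>, hence in \<open>A\<close>.\<close>

lemma L_denominator:
  assumes "x \<in> L"
  obtains b a where "b \<in> B" "a \<in> A" "a \<noteq> 0" "x = b / a"
proof -
  obtain b d where bd: "x = b / d" "b \<in> B" "d \<in> B" "d \<noteq> 0"
    using assms by (auto simp: L_eq fraction_field_def)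
  define N where "N = (\<Prod>i<q. (g ^^ i) d)"
  define M where "M = (\<Prod>i\<in>{..<q} - {0}. (g ^^ i) d)"
  have N: "N = d * M"
    unfolding N_def M_def using q_pos by (subst prod.remove[of _ 0]) auto
  have dL: "d \<in> L" using bd B_subset_L by blast
  have "N \<in> B" unfolding N_def by (intro B.prod_mem funpow_closed_B bd)
  moreover have "g N = N"
  proof -
    have "g N = (g ^^ 1) N" by simp
    also have "\<dots> = (\<Prod>i<q. (g ^^ Suc i) d)"
      unfolding N_def using dL by (subst funpow_prod_hom) (auto intro: funpow_closed)
    also have "\<dots> = N" unfolding N_def by (rule prod_shift_invariant) (simp add: funpow_q_B bd)
    finally show ?thesis .
  qed
  ultimately have "N \<in> A" by (rule fixed_mem_A)
  moreover have "N \<noteq> 0" unfolding N_def using dL bd by (simp add: funpow_eq_0_iff)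
  moreover have "b * M \<in> B" unfolding M_def by (intro B.mult_mem B.prod_mem funpow_closed_B bd)
  moreover have "x = b * M / N" using \<open>N \<noteq> 0\<close> by (simp add: N bd)
  ultimately show ?thesis by (intro that[of "b * M" N])
qed

lemma L_expansion:
  assumes "x \<in> L"
  shows "\<exists>a. (\<forall>t. a t \<in> K) \<and> x = (\<Sum>t<q. a t * z ^ t)"
proof -
  obtain b e where be: "b \<in> B" "e \<in> A" "e \<noteq> 0" "x = b / e" using L_denominator[OF assms] .
  obtain a where a: "\<forall>t. a t \<in> A" "b = (\<Sum>t<q. a t * z ^ t)" using B_expansion_q[OF be(1)] by blast
  have "x = (\<Sum>t<q. (a t / e) * z ^ t)" by (simp add: be(4) a(2) sum_divide_distrib)
  moreover have "a t / e \<in> K" for t using a be A_subset_K by (intro K_divide) auto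
  ultimately show ?thesis by (intro exI[of _ "\<lambda>t. a t / e"]) blast
qed

lemma funpow_q:
  assumes "x \<in> L" shows "(g ^^ q) x = x"
proof -
  obtain a where "\<forall>t. a t \<in> K" "x = (\<Sum>t<q. a t * z ^ t)" using L_expansion[OF assms] by blast
  then show ?thesis
    using conj_expansion[of a q] conj_expansion[of a 0] conj_z_add_q[of 0] by simp
qed

lemma funpow_mod_q: "x \<in> L \<Longrightarrow> (g ^^ i) x = (g ^^ (i mod q)) x"
proof -
  assume x: "x \<in> L"
  have "(g ^^ (q * k)) x = x" for k
    by (induction k) (auto simp: funpow_add funpow_q x)
  then have "(g ^^ (i mod q + q * (i div q))) x = (g ^^ (i mod q)) x" by (simp only: funpow_add o_apply)
  then show ?thesis by simp
qed

subsection \<open>The cyclic algebra\<close>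

abbreviation D :: "(nat \<Rightarrow> 'b) ring" where "D \<equiv> cyclic_algebra L g q c"

text \<open>Right multiplication by \<open>x\<close> in the left basis \<open>1, u, \<dots>, u\<^bsup>q-1\<^esup>\<close>.\<close>

definition rep :: "(nat \<Rightarrow> 'b) \<Rightarrow> 'b mat" where
  "rep x = mat q q (\<lambda>(i, k). (g ^^ i) (x ((k + q - i) mod q)) * (if k < i then c else 1))"

lemma carrier_D: "carrier D = {x. (\<forall>j<q. x j \<in> L) \<and> (\<forall>j\<ge>q. x j = 0)}"
  by (simp add: cyclic_algebra_def)

lemma D_ops: "one D = cyclic_embed 1" "ring.zero D = (\<lambda>j. 0)" "add D = (\<lambda>x y j. x j + y j)"
  by (auto simp: cyclic_algebra_def cyclic_embed_def)

lemma abelian_monoid_D: "abelian_monoid D"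
  by (rule abelian_monoidI)
     (auto simp: carrier_D D_ops add_ac intro: L.add_mem L.zero_mem)

lemma rep_carrier: "rep x \<in> carrier_mat q q" by (simp add: rep_def)

lemma rep_index: "i < q \<Longrightarrow> k < q \<Longrightarrow>
    rep x $$ (i, k) = (g ^^ i) (x ((k + q - i) mod q)) * (if k < i then c else 1)"
  by (simp add: rep_def)

lemma c_mem_L: "c \<in> L" using c_mem A_subset_B B_subset_L by blast

lemma c_mem_K: "c \<in> K" using c_mem A_subset_K by blast

lemma rep_mem: "x \<in> carrier D \<Longrightarrow> i < q \<Longrightarrow> k < q \<Longrightarrow> rep x $$ (i, k) \<in> L"
  using q_pos by (auto simp: rep_index carrier_D intro!: L.mult_mem funpow_closed c_mem_L L.one_mem)

text \<open>The product is a row vector times a matrix. Acting on rows is what makes right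
  multiplication a homomorphism instead of an antihomomorphism.\<close>

lemma mult_D:
  assumes k: "k < q"
  shows "(x \<otimes>\<^bsub>D\<^esub> y) k = (\<Sum>i<q. x i * rep y $$ (i, k))"
proof -
  have "(x \<otimes>\<^bsub>D\<^esub> y) k = (\<Sum>i<q. \<Sum>j<q.
        if (i + j) mod q = k then x i * (g ^^ i) (y j) * c ^ ((i + j) div q) else 0)"
    by (simp add: cyclic_algebra_def)
  also have "\<dots> = (\<Sum>i<q. x i * rep y $$ (i, k))"
  proof (intro sum.cong refl)
    fix i assume "i \<in> {..<q}"
    then have i: "i < q" by simp
    let ?j = "(k + q - i) mod q"
    note div = cyclic_add_div[OF i k]
    have "(\<Sum>j<q. if (i + j) mod q = k then x i * (g ^^ i) (y j) * c ^ ((i + j) div q) else 0)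
        = (\<Sum>j<q. if j = ?j then x i * (g ^^ i) (y j) * c ^ ((i + j) div q) else 0)"
      using cyclic_add_eq_iff[OF i _ k] by (intro sum.cong refl) simp
    also have "\<dots> = x i * (g ^^ i) (y ?j) * c ^ ((i + ?j) div q)"
      using q_pos by simp
    also have "\<dots> = x i * rep y $$ (i, k)"
      using i k by (simp add: div rep_index)
    finally show "(\<Sum>j<q. if (i + j) mod q = k then x i * (g ^^ i) (y j) * c ^ ((i + j) div q) else 0)
        = x i * rep y $$ (i, k)" .
  qed
  finally show ?thesis .
qed

lemma mult_D_ge:
  assumes "k \<ge> q"
  shows "(x \<otimes>\<^bsub>D\<^esub> y) k = 0"
proof -
  have "(i + j) mod q \<noteq> k" for i j
    using mod_less_divisor[OF q_pos, of "i + j"] assms by linarith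
  then show ?thesis by (simp add: cyclic_algebra_def)
qed

lemma mult_D_closed: "x \<in> carrier D \<Longrightarrow> y \<in> carrier D \<Longrightarrow> x \<otimes>\<^bsub>D\<^esub> y \<in> carrier D"
  unfolding carrier_D
  by (auto simp: mult_D mult_D_ge rep_mem carrier_D intro!: L.sum_mem L.mult_mem)

lemma cyclic_embed_closed: "x \<in> L \<Longrightarrow> cyclic_embed x \<in> carrier D"
  using q_pos by (auto simp: carrier_D cyclic_embed_def L.zero_mem)

sublocale D: algebra_over D K cyclic_embed
proof -
  interpret abelian_monoid D by (rule abelian_monoid_D)
  show "algebra_over D K cyclic_embed"
    using K_subset_L
    by unfold_locales (auto intro: mult_D_closed cyclic_embed_closed simp: D_ops L.one_mem)
qed

end

lemma sum_div_mod:
  fixes f :: "nat \<Rightarrow> nat \<Rightarrow> 'c::comm_monoid_add"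
  shows "(\<Sum>l<m * n. f (l div n) (l mod n)) = (\<Sum>t<m. \<Sum>j<n. f t j)"
proof (cases "n = 0")
  case False
  have "(\<Sum>l<m * n. f (l div n) (l mod n)) = (\<Sum>(t, j)\<in>{..<m} \<times> {..<n}. f t j)"
  proof (rule sum.reindex_bij_witness[of _ "\<lambda>(t, j). t * n + j" "\<lambda>l. (l div n, l mod n)"])
    fix x assume "x \<in> {..<m} \<times> {..<n}"
    then obtain t j where x: "x = (t, j)" "t < m" "j < n" by auto
    have "t * n + j < Suc t * n" using x by simp
    also have "\<dots> \<le> m * n" using x by (intro mult_le_mono1) simp
    finally show "(case x of (t, j) \<Rightarrow> t * n + j) \<in> {..<m * n}" using x by simp
  qed (use False in \<open>auto simp: less_mult_imp_div_less\<close>)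
  then show ?thesis by (simp add: sum.cartesian_product)
qed simp

context cyclic_extension
begin

text \<open>Row a of \<open>rep x\<close> holds the left coordinates of u^a x, so this is the
  associativity u^a (x y) = (u^a x) y. The summation index i corresponds to the intermediate row e =
  a + i modulo q.\<close>

lemma rep_mult:
  assumes x: "x \<in> carrier D" and y: "y \<in> carrier D"
  shows "rep (x \<otimes>\<^bsub>D\<^esub> y) = rep x * rep y"
proof (rule eq_matI)
  fix a b assume "a < dim_row (rep x * rep y)" "b < dim_col (rep x * rep y)"
  then have a: "a < q" and b: "b < q" by (auto simp: rep_def)
  define j where "j = (b + q - a) mod q"
  have j: "j = (if b < a then b + q - a else b - a)" "j < q"
    using a b q_pos by (auto simp: j_def cyclic_diff_eq)
  let ?c = "\<lambda>P. if P then c else 1"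
  have xL: "x i \<in> L" and yL: "y i \<in> L" if "i < q" for i
    using x y that by (auto simp: carrier_D)
  have "rep (x \<otimes>\<^bsub>D\<^esub> y) $$ (a, b) = (g ^^ a) (\<Sum>i<q. x i * rep y $$ (i, j)) * ?c (b < a)"
    using a b j by (simp add: rep_index mult_D flip: j_def)
  also have "\<dots> = (\<Sum>i<q. (g ^^ a) (x i * rep y $$ (i, j)) * ?c (b < a))"
    using xL rep_mem[OF y] j(2)
    by (subst funpow_sum_hom) (auto intro!: L.mult_mem simp only: sum_distrib_right lessThan_iff)
  also have "\<dots> = (\<Sum>i<q. rep x $$ (a, (a + i) mod q) * rep y $$ ((a + i) mod q, b))"
  proof (intro sum.cong refl)
    fix i assume "i \<in> {..<q}"
    then have i: "i < q" by simp
    define e where "e = (a + i) mod q"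
    have e: "e = (if a + i < q then a + i else a + i - q)" "e < q"
      using a i q_pos by (auto simp: e_def mod_if)
    have xe: "(e + q - a) mod q = i" using a i e by (auto simp: cyclic_diff_eq)
    define h where "h = (j + q - i) mod q"
    have h: "h < q" using q_pos by (simp add: h_def)
    have ye: "(b + q - e) mod q = h"
      unfolding h_def using a b i e j by (auto simp: cyclic_diff_eq)
    \<comment> \<open>The carries in a + (i + h) and in (a + i) + h agree in total: the cocycle
      identity behind associativity.\<close>
    have cc: "?c (j < i) * ?c (b < a) = ?c (e < a) * ?c (b < e)"
      using a b i e j by auto
    have "rep y $$ (i, j) = (g ^^ i) (y h) * ?c (j < i)"
      using i j(2) by (simp only: rep_index h_def)
    then have "(g ^^ a) (rep y $$ (i, j)) = (g ^^ a) ((g ^^ i) (y h)) * ?c (j < i)"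
      using yL[OF h] c_mem_L c_mem_K by (auto simp: funpow_mult_hom funpow_closed funpow_fixes)
    also have "(g ^^ a) ((g ^^ i) (y h)) = (g ^^ (a + i)) (y h)" by (simp add: funpow_add)
    also have "\<dots> = (g ^^ e) (y h)" unfolding e_def by (rule funpow_mod_q[OF yL[OF h]])
    finally have "(g ^^ a) (x i * rep y $$ (i, j)) * ?c (b < a)
        = (g ^^ a) (x i) * ((g ^^ e) (y h) * (?c (j < i) * ?c (b < a)))"
      using xL[OF i] rep_mem[OF y i j(2)] by (simp add: funpow_mult_hom mult.assoc)
    also have "\<dots> = rep x $$ (a, e) * rep y $$ (e, b)"
    proof -
      have "rep x $$ (a, e) = (g ^^ a) (x i) * ?c (e < a)" "rep y $$ (e, b) = (g ^^ e) (y h) * ?c (b < e)"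
        using a b e(2) by (simp_all only: rep_index xe ye)
      then show ?thesis unfolding cc by (simp only: mult_ac)
    qed
    finally show "(g ^^ a) (x i * rep y $$ (i, j)) * ?c (b < a)
        = rep x $$ (a, (a + i) mod q) * rep y $$ ((a + i) mod q, b)" by (simp add: e_def)
  qed
  also have "\<dots> = (\<Sum>e<q. rep x $$ (a, e) * rep y $$ (e, b))"
    by (rule sum.reindex_bij_witness[of _ "\<lambda>e. (e + q - a) mod q" "\<lambda>i. (a + i) mod q"])
       (use a q_pos in \<open>auto simp: cyclic_add_diff\<close>)
  also have "\<dots> = (rep x * rep y) $$ (a, b)"
    using a b by (simp add: rep_def scalar_prod_def atLeast0LessThan)
  finally show "rep (x \<otimes>\<^bsub>D\<^esub> y) $$ (a, b) = (rep x * rep y) $$ (a, b)" .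
qed (auto simp: rep_def)

lemma rep_add:
  assumes "x \<in> carrier D" "y \<in> carrier D"
  shows "rep (x \<oplus>\<^bsub>D\<^esub> y) = rep x + rep y"
proof (rule eq_matI)
  fix i k assume "i < dim_row (rep x + rep y)" "k < dim_col (rep x + rep y)"
  then have "i < q" "k < q" by (auto simp: rep_def)
  moreover have "x ((k + q - i) mod q) \<in> L" "y ((k + q - i) mod q) \<in> L"
    using assms q_pos by (auto simp: carrier_D)
  ultimately show "rep (x \<oplus>\<^bsub>D\<^esub> y) $$ (i, k) = (rep x + rep y) $$ (i, k)"
    by (simp add: rep_def D_ops funpow_add_hom distrib_right)
qed (auto simp: rep_def)

lemma cyclic_diff_eq_0_iff: "i < q \<Longrightarrow> k < q \<Longrightarrow> (k + q - i) mod q = 0 \<longleftrightarrow> k = i"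
  by (auto simp: cyclic_diff_eq)

lemma rep_scalar:
  assumes "a \<in> K"
  shows "rep (cyclic_embed a) = a \<cdot>\<^sub>m 1\<^sub>m q"
  by (rule eq_matI)
     (auto simp: rep_def cyclic_embed_def cyclic_diff_eq_0_iff funpow_fixes[OF assms] funpow_zero)

lemma rep_ring_hom: "rep \<in> Ring.ring_hom D (ring_mat TYPE('b) q ())"
  using rep_scalar[OF K.one_mem]
  by (auto simp: Ring.ring_hom_def ring_mat_def rep_mult rep_add rep_carrier D_ops(1))

section \<open>Coordinates of linear combinations and the splitting over L\<close>

lemma finsum_D:
  assumes "finite I" "\<And>l. l \<in> I \<Longrightarrow> f l \<in> carrier D"
  shows "(\<Oplus>\<^bsub>D\<^esub>l\<in>I. f l) = (\<lambda>j. \<Sum>l\<in>I. f l j)"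
  using assms
proof (induction I)
  case (insert l I)
  then have "(\<Oplus>\<^bsub>D\<^esub>l\<in>insert l I. f l) = f l \<oplus>\<^bsub>D\<^esub> (\<Oplus>\<^bsub>D\<^esub>l\<in>I. f l)"
    by (intro D.finsum_insert) auto
  with insert show ?case by (auto simp: D_ops(3))
qed (auto simp: D_ops(2))

lemma embed_mult_D:
  assumes "y \<in> carrier D"
  shows "cyclic_embed a \<otimes>\<^bsub>D\<^esub> y = (\<lambda>j. a * y j)"
proof
  fix j
  show "(cyclic_embed a \<otimes>\<^bsub>D\<^esub> y) j = a * y j"
  proof (cases "j < q")
    case True
    have "(cyclic_embed a \<otimes>\<^bsub>D\<^esub> y) j = (\<Sum>i<q. if i = 0 then a * rep y $$ (i, j) else 0)"
      unfolding mult_D[OF True] by (intro sum.cong) (auto simp: cyclic_embed_def)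
    then show ?thesis using True q_pos by (simp add: rep_index)
  next
    case False
    then show ?thesis using assms by (simp add: mult_D_ge carrier_D)
  qed
qed

text \<open>The inverse transform in explicit form, verified by row orthogonality. It produces the
  coordinates of an arbitrary matrix along one cyclic diagonal.\<close>

lemma interpolation:
  assumes y: "\<And>i. i < q \<Longrightarrow> y i \<in> L"
  shows "\<exists>a. (\<forall>t. a t \<in> L) \<and> (\<forall>i<q. y i = (\<Sum>t<q. a t * conj_z i ^ t))"
proof -
  define a where "a t = (\<Sum>i<q. y i / conj_z i ^ t) / of_nat q" for t
  have "(\<Sum>t<q. a t * conj_z i ^ t) = y i" if i: "i < q" for i
  proof -
    have "(\<Sum>t<q. a t * conj_z i ^ t)
        = (\<Sum>t<q. \<Sum>h<q. y h * (conj_z i ^ t / conj_z h ^ t)) / of_nat q"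
      unfolding a_def sum_divide_distrib sum_distrib_right by (intro sum.cong refl) simp
    also have "(\<Sum>t<q. \<Sum>h<q. y h * (conj_z i ^ t / conj_z h ^ t))
        = (\<Sum>h<q. y h * (\<Sum>t<q. conj_z i ^ t / conj_z h ^ t))"
      unfolding sum_distrib_left by (rule sum.swap)
    also have "\<dots> = (\<Sum>h<q. if h = i then of_nat q * y h else 0)"
      using i by (intro sum.cong) (auto simp: row_orthogonality)
    also have "\<dots> = of_nat q * y i" using i by simp
    finally show ?thesis using q_nonzero by simp
  qed
  moreover have "a t \<in> L" for t
    unfolding a_def divide_inverse using conj_z_mem B_subset_L
    by (intro L.mult_mem L.sum_mem L_inverse L.power_mem L.of_nat_mem y) auto
  ultimately show ?thesis by (intro exI[of _ a]) simp
qed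

lemma expansion_unique:
  assumes "\<And>i. i < q \<Longrightarrow> (\<Sum>t<q. a t * conj_z i ^ t) = (\<Sum>t<q. a' t * conj_z i ^ t)" "t < q"
  shows "a t = a' t"
proof -
  have "of_nat q * a t = of_nat q * a' t"
    using expansion_coeff[of _ a t, OF refl assms(2)]
      expansion_coeff[of "\<lambda>i. \<Sum>t<q. a t * conj_z i ^ t" a' t] assms by simp
  then show ?thesis using q_nonzero by simp
qed

text \<open>The basis elements \<open>z\<^sup>t u\<^sup>j\<close> are indexed by \<open>t q + j\<close>.\<close>

definition basis :: "nat \<Rightarrow> nat \<Rightarrow> 'b" where
  "basis l = (\<lambda>j. if j = l mod q then z ^ (l div q) else 0)"

lemma basis_closed: "basis l \<in> carrier D"
  using q_pos mod_less_divisor[OF q_pos, of l]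
  by (auto simp: basis_def carrier_D L.zero_mem L.power_mem z_mem_L simp del: mod_less_divisor)

lemma combination_D:
  assumes c: "\<And>l. l < q * q \<Longrightarrow> c' l \<in> L"
  shows "(\<Oplus>\<^bsub>D\<^esub>l\<in>{..<q * q}. cyclic_embed (c' l) \<otimes>\<^bsub>D\<^esub> basis l)
       = (\<lambda>j. if j < q then \<Sum>t<q. c' (t * q + j) * z ^ t else 0)"
proof
  fix j
  have "(\<Oplus>\<^bsub>D\<^esub>l\<in>{..<q * q}. cyclic_embed (c' l) \<otimes>\<^bsub>D\<^esub> basis l) j = (\<Sum>l<q * q. c' l * basis l j)"
  proof -
    have "cyclic_embed (c' l) \<otimes>\<^bsub>D\<^esub> basis l \<in> carrier D" if "l \<in> {..<q * q}" for l
      using c that by (intro mult_D_closed cyclic_embed_closed basis_closed) auto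
    then show ?thesis by (subst finsum_D) (auto simp: embed_mult_D basis_closed)
  qed
  also have "\<dots> = (\<Sum>l<q * q. c' (l div q * q + l mod q) * (if j = l mod q then z ^ (l div q) else 0))"
    by (simp only: basis_def div_mult_mod_eq)
  also have "\<dots> = (\<Sum>t<q. \<Sum>h<q. c' (t * q + h) * (if j = h then z ^ t else 0))"
    by (rule sum_div_mod[of "\<lambda>t h. c' (t * q + h) * (if j = h then z ^ t else 0)"])
  also have "\<dots> = (\<Sum>t<q. \<Sum>h<q. if h = j then c' (t * q + h) * z ^ t else 0)"
    by (intro sum.cong refl) auto
  also have "\<dots> = (if j < q then \<Sum>t<q. c' (t * q + j) * z ^ t else 0)" by simp
  finally show "(\<Oplus>\<^bsub>D\<^esub>l\<in>{..<q * q}. cyclic_embed (c' l) \<otimes>\<^bsub>D\<^esub> basis l) j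
      = (if j < q then \<Sum>t<q. c' (t * q + j) * z ^ t else 0)" .
qed

text \<open>Coefficients with the same j = k - i modulo q meet on one cyclic diagonal only, and
  there they act as a polynomial evaluated at the conjugates of z, up to a factor \<open>c\<close>
  at the wrap-around.\<close>

lemma combination_rep:
  assumes i: "i < q" and k: "k < q"
  shows "(\<Sum>l<q * q. c' l * rep (basis l) $$ (i, k))
    = (\<Sum>t<q. c' (t * q + (k + q - i) mod q) * conj_z i ^ t) * (if k < i then c else 1)"
proof -
  let ?j = "(k + q - i) mod q"
  have "(\<Sum>l<q * q. c' l * rep (basis l) $$ (i, k))
      = (\<Sum>l<q * q. c' (l div q * q + l mod q) *
          ((g ^^ i) (if ?j = l mod q then z ^ (l div q) else 0) * (if k < i then c else 1)))"
    using i k by (simp only: basis_def rep_index div_mult_mod_eq)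
  also have "\<dots> = (\<Sum>t<q. \<Sum>h<q. c' (t * q + h) *
          ((g ^^ i) (if ?j = h then z ^ t else 0) * (if k < i then c else 1)))"
    by (rule sum_div_mod[of "\<lambda>t h. c' (t * q + h) * ((g ^^ i) (if ?j = h then z ^ t else 0) * (if k < i then c else 1))"])
  also have "\<dots> = (\<Sum>t<q. \<Sum>h<q. if h = ?j then c' (t * q + h) * conj_z i ^ t * (if k < i then c else 1) else 0)"
    by (intro sum.cong refl) (auto simp: funpow_zero funpow_power_hom z_mem_L conj_z_def)
  also have "\<dots> = (\<Sum>t<q. c' (t * q + ?j) * conj_z i ^ t * (if k < i then c else 1))"
    using q_pos by simp
  finally show ?thesis by (simp add: sum_distrib_right)
qed

lemma index_less: "t < q \<Longrightarrow> j < q \<Longrightarrow> t * q + j < q * q"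
  using mult_le_mono1[of "Suc t" q q] by simp

text \<open>The matrix space decomposes into q cyclic diagonals. On each of them coordinates
  correspond to entries by the Fourier transform, which is bijective over \<open>L\<close>; over
  \<open>K\<close> the same uniqueness applies to the coordinates of the components of d in powers
  of z.\<close>

lemma splitting_rep: "splitting K cyclic_embed D L q rep"
  unfolding splitting_def
proof (intro conjI exI[of _ "q * q"] exI[of _ basis] ballI allI impI)
  show "subfield L ring_of_type_algebra"
    by (rule subfield_of_unital_subring[OF L.unital_subring_axioms L_inverse])
  show "rep ` carrier D \<subseteq> matrices_over L q"
    using rep_mem by (auto simp: matrices_over_def rep_carrier elements_mat_def rep_def)
next
  fix d assume d: "d \<in> carrier D"
  then have dL: "d j \<in> L" if "j < q" for j using that by (simp add: carrier_D)
  have "\<forall>j\<in>{..<q}. \<exists>a. (\<forall>t. a t \<in> K) \<and> d j = (\<Sum>t<q. a t * z ^ t)"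
    using L_expansion dL by blast
  then obtain a where a: "\<And>j t. j < q \<Longrightarrow> a j t \<in> K" "\<And>j. j < q \<Longrightarrow> d j = (\<Sum>t<q. a j t * z ^ t)"
    by (metis lessThan_iff)
  define c0 where "c0 = restrict (\<lambda>l. a (l mod q) (l div q)) {..<q * q}"
  have c0: "c0 \<in> {..<q * q} \<rightarrow>\<^sub>E K" using a q_pos by (auto simp: c0_def)
  have c0': "c0 (t * q + j) = a j t" if "t < q" "j < q" for t j
    using index_less[OF that] that by (simp add: c0_def)
  have expand: "d = (\<Oplus>\<^bsub>D\<^esub>l\<in>{..<q * q}. cyclic_embed (c1 l) \<otimes>\<^bsub>D\<^esub> basis l) \<longleftrightarrow>
      (\<forall>j<q. d j = (\<Sum>t<q. c1 (t * q + j) * z ^ t))" if "c1 \<in> {..<q * q} \<rightarrow>\<^sub>E K" for c1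
    using that d K_subset_L by (subst combination_D) (auto simp: carrier_D fun_eq_iff PiE_iff)
  show "\<exists>!c. c \<in> {..<q * q} \<rightarrow>\<^sub>E K \<and> d = (\<Oplus>\<^bsub>D\<^esub>l\<in>{..<q * q}. cyclic_embed (c l) \<otimes>\<^bsub>D\<^esub> basis l)"
  proof (rule ex1I)
    show "c0 \<in> {..<q * q} \<rightarrow>\<^sub>E K \<and> d = (\<Oplus>\<^bsub>D\<^esub>l\<in>{..<q * q}. cyclic_embed (c0 l) \<otimes>\<^bsub>D\<^esub> basis l)"
      using c0 a(2) c0' by (simp add: expand)
  next
    fix c1 assume *: "c1 \<in> {..<q * q} \<rightarrow>\<^sub>E K \<and>
      d = (\<Oplus>\<^bsub>D\<^esub>l\<in>{..<q * q}. cyclic_embed (c1 l) \<otimes>\<^bsub>D\<^esub> basis l)"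
    then have c1: "c1 \<in> {..<q * q} \<rightarrow>\<^sub>E K" by blast
    have "c1 (t * q + j) = c0 (t * q + j)" if t: "t < q" and j: "j < q" for t j
    proof (rule expansion_unique[OF _ t])
      fix i
      have "(\<Sum>t<q. c1 (t * q + j) * z ^ t) = (\<Sum>t<q. c0 (t * q + j) * z ^ t)"
        using * expand[OF c1] a(2)[OF j] c0' j by simp
      then have "(g ^^ i) (\<Sum>t<q. c1 (t * q + j) * z ^ t) = (g ^^ i) (\<Sum>t<q. c0 (t * q + j) * z ^ t)"
        by simp
      then show "(\<Sum>t<q. c1 (t * q + j) * conj_z i ^ t) = (\<Sum>t<q. c0 (t * q + j) * conj_z i ^ t)"
        using c1 c0 index_less[OF _ j] by (subst (asm) (1 2) conj_expansion) (auto simp: PiE_iff)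
    qed
    then have "c1 l = c0 l" if "l < q * q" for l
      using that q_pos less_mult_imp_div_less[OF that] mod_less_divisor[OF q_pos, of l]
      by (metis div_mult_mod_eq)
    then show "c1 = c0" using c1 c0 by (intro PiE_ext[of _ "{..<q * q}"]) auto
  qed
next
  fix M assume "M \<in> matrices_over L q"
  then have M: "M \<in> carrier_mat q q" and M_mem: "\<And>i k. i < q \<Longrightarrow> k < q \<Longrightarrow> M $$ (i, k) \<in> L"
    by (fastforce simp: matrices_over_def elements_mat_def)+
  let ?e = "\<lambda>i j. (i + j) mod q" and ?c = "\<lambda>P. if P then c else 1"
  \<comment> \<open>The entries of the j-th diagonal with the factor \<open>c\<close> of the
    wrap-around divided out; here \<open>c\<close> must be nonzero.\<close>
  define y where "y j i = M $$ (i, ?e i j) * inverse (?c (?e i j < i))" for j i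
  have "\<exists>a. (\<forall>t. a t \<in> L) \<and> (\<forall>i<q. y j i = (\<Sum>t<q. a t * conj_z i ^ t))" for j
  proof -
    have "y j i \<in> L" if "i < q" for i
      unfolding y_def using that q_pos c_mem_L
      by (intro L.mult_mem L_inverse M_mem) (auto simp: L.one_mem)
    then show ?thesis by (rule interpolation)
  qed
  then have "\<exists>a. \<forall>j. (\<forall>t. a j t \<in> L) \<and> (\<forall>i<q. y j i = (\<Sum>t<q. a j t * conj_z i ^ t))"
    by (intro choice allI)
  then obtain a where a: "\<And>j t. a j t \<in> L" "\<And>j i. i < q \<Longrightarrow> y j i = (\<Sum>t<q. a j t * conj_z i ^ t)"
    by blast
  define c0 where "c0 = restrict (\<lambda>l. a (l mod q) (l div q)) {..<q * q}"
  have c0: "c0 \<in> {..<q * q} \<rightarrow>\<^sub>E L" using a q_pos by (auto simp: c0_def)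
  have c0': "c0 (t * q + j) = a j t" if "t < q" "j < q" for t j
    using index_less[OF that] that by (simp add: c0_def)
  have expand: "M = mat q q (\<lambda>(i, k). \<Sum>l<q * q. c1 l * rep (basis l) $$ (i, k)) \<longleftrightarrow>
      (\<forall>j<q. \<forall>i<q. y j i = (\<Sum>t<q. c1 (t * q + j) * conj_z i ^ t))" for c1
  proof -
    have "M = mat q q (\<lambda>(i, k). \<Sum>l<q * q. c1 l * rep (basis l) $$ (i, k)) \<longleftrightarrow>
      (\<forall>i<q. \<forall>k<q. M $$ (i, k) = (\<Sum>t<q. c1 (t * q + (k + q - i) mod q) * conj_z i ^ t) * ?c (k < i))"
      using M by (auto simp: mat_eq_iff combination_rep)
    also have "\<dots> \<longleftrightarrow> (\<forall>i<q. \<forall>j<q. M $$ (i, ?e i j) = (\<Sum>t<q. c1 (t * q + j) * conj_z i ^ t) * ?c (?e i j < i))"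
    proof (rule all_cong)
      fix i assume i: "i < q"
      let ?P = "\<lambda>k j. M $$ (i, k) = (\<Sum>t<q. c1 (t * q + j) * conj_z i ^ t) * ?c (k < i)"
      have "?P (?e i j) j" if "\<forall>k<q. ?P k ((k + q - i) mod q)" "j < q" for j
        using that(1)[rule_format, of "?e i j"] cyclic_add_diff(1)[OF i that(2)] q_pos by simp
      moreover have "?P k ((k + q - i) mod q)" if "\<forall>j<q. ?P (?e i j) j" "k < q" for k
        using that(1)[rule_format, of "(k + q - i) mod q"] cyclic_add_diff(2)[OF i that(2)] q_pos by simp
      ultimately show "(\<forall>k<q. ?P k ((k + q - i) mod q)) \<longleftrightarrow> (\<forall>j<q. ?P (?e i j) j)" by blast
    qed
    also have "\<dots> \<longleftrightarrow> (\<forall>j<q. \<forall>i<q. y j i = (\<Sum>t<q. c1 (t * q + j) * conj_z i ^ t))"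
    proof -
      have "y j i = S \<longleftrightarrow> M $$ (i, ?e i j) = S * ?c (?e i j < i)" for i j S
        unfolding y_def using c_nonzero by (cases "?e i j < i") (auto simp: field_simps)
      then show ?thesis by blast
    qed
    finally show ?thesis .
  qed
  show "\<exists>!c. c \<in> {..<q * q} \<rightarrow>\<^sub>E L \<and>
     M = mat q q (\<lambda>(i, k). \<Sum>l<q * q. c l * rep (basis l) $$ (i, k))"
  proof (rule ex1I)
    show "c0 \<in> {..<q * q} \<rightarrow>\<^sub>E L \<and> M = mat q q (\<lambda>(i, k). \<Sum>l<q * q. c0 l * rep (basis l) $$ (i, k))"
      using c0 a(2) c0' by (simp add: expand)
  next
    fix c1 assume *: "c1 \<in> {..<q * q} \<rightarrow>\<^sub>E L \<and>
      M = mat q q (\<lambda>(i, k). \<Sum>l<q * q. c1 l * rep (basis l) $$ (i, k))"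
    have "c1 (t * q + j) = c0 (t * q + j)" if t: "t < q" and j: "j < q" for t j
    proof (rule expansion_unique[OF _ t])
      fix i assume "i < q"
      then show "(\<Sum>t<q. c1 (t * q + j) * conj_z i ^ t) = (\<Sum>t<q. c0 (t * q + j) * conj_z i ^ t)"
        using * a(2) c0' j expand[of c1] by auto
    qed
    then have "c1 l = c0 l" if "l < q * q" for l
      using that q_pos less_mult_imp_div_less[OF that] mod_less_divisor[OF q_pos, of l]
      by (metis div_mult_mod_eq)
    then show "c1 = c0" using * c0 by (intro PiE_ext[of _ "{..<q * q}"]) auto
  qed
qed (use K_subset_L rep_ring_hom rep_scalar basis_closed in auto)

lemma reduced_norm_D: "d \<in> carrier D \<Longrightarrow> reduced_norm K cyclic_embed D d = det (rep d)"
  by (rule D.reduced_norm_eq_det[OF splitting_rep])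

end

section \<open>Sums over orbits\<close>

lemma funpow_fix_mult: "(f ^^ a) x = x \<Longrightarrow> (f ^^ (a * k)) x = x"
  by (induction k) (auto simp: funpow_add)

lemma funpow_fix_gcd:
  assumes a: "(f ^^ a) x = x" and b: "(f ^^ b) x = x" and "a \<noteq> 0"
  shows "(f ^^ gcd a b) x = x"
proof -
  obtain u v where "a * u = b * v + gcd a b" using bezout_nat[OF \<open>a \<noteq> 0\<close>] by blast
  then have "(f ^^ (gcd a b + b * v)) x = x" using funpow_fix_mult[OF a, of u] by (simp add: add.commute)
  then show ?thesis using funpow_fix_mult[OF b, of v] by (simp add: funpow_add)
qed

text \<open>Periods are closed under gcd, so a smaller period i would yield the period gcd(i, p^k),
  a smaller power of p. It therefore suffices to test exponents that are powers of p, as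
  \<open>level\<close> does below.\<close>

lemma prime_power_least_period:
  assumes p: "prime p" and per: "(f ^^ (p ^ k)) x = x" and least: "\<And>j. j < k \<Longrightarrow> (f ^^ (p ^ j)) x \<noteq> x"
    and i: "0 < i" "i < p ^ k"
  shows "(f ^^ i) x \<noteq> x"
proof
  assume "(f ^^ i) x = x"
  then have g: "(f ^^ gcd i (p ^ k)) x = x" using funpow_fix_gcd[OF _ per, of i] i by blast
  have "gcd i (p ^ k) dvd p ^ k" by simp
  then obtain j where j: "j \<le> k" "gcd i (p ^ k) = p ^ j" using divides_primepow_nat[OF p] by blast
  have "gcd i (p ^ k) \<le> i" using i by (simp add: dvd_imp_le)
  then have "j \<noteq> k" using j i by auto
  then show False using g j least[of j] by simp
qed

text \<open>Orbits are removed one at a time by induction on the set, so no system of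
  representatives is needed.\<close>

lemma sum_over_orbits:
  assumes "finite Q" and Q: "\<And>x. x \<in> Q \<Longrightarrow> R x \<in> Q"
    and per: "\<And>x. x \<in> Q \<Longrightarrow> (R ^^ N) x = x"
    and free: "\<And>x i. x \<in> Q \<Longrightarrow> 0 < i \<Longrightarrow> i < N \<Longrightarrow> (R ^^ i) x \<noteq> x" and N: "N > 0"
    and zero: "(0 :: 'b::comm_monoid_add) \<in> I" and add: "\<And>a b. a \<in> I \<Longrightarrow> b \<in> I \<Longrightarrow> a + b \<in> I"
    and T: "\<And>x. x \<in> Q \<Longrightarrow> (\<Sum>i<N. T ((R ^^ i) x)) \<in> I"
  shows "sum T Q \<in> I"
  using \<open>finite Q\<close> Q per free T
proof (induction Q rule: finite_psubset_induct)
  case (psubset Q)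
  show ?case
  proof (cases "Q = {}")
    case False
    then obtain x where x: "x \<in> Q" by blast
    define Orb where "Orb = (\<lambda>i. (R ^^ i) x) ` {..<N}"
    have pow: "(R ^^ i) y \<in> Q" if "y \<in> Q" for y i
      by (induction i) (use that psubset.prems(1) in auto)
    have Orb: "Orb \<subseteq> Q" using pow[OF x] by (auto simp: Orb_def)
    have xOrb: "x \<in> Orb" using N by (auto simp: Orb_def intro!: image_eqI[of _ _ 0])
    have *: "i = j" if ij: "i \<le> j" "j < N" "(R ^^ i) x = (R ^^ j) x" for i j
    proof (rule ccontr)
      assume "i \<noteq> j"
      have "(R ^^ (j - i)) ((R ^^ i) x) = (R ^^ (j - i + i)) x" by (simp only: funpow_add o_apply)
      then have "(R ^^ (j - i)) ((R ^^ i) x) = (R ^^ i) x" using ij by simp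
      then show False using psubset.prems(3)[OF pow[OF x, of i], of "j - i"] ij \<open>i \<noteq> j\<close>
        by (simp add: less_imp_diff_less)
    qed
    have inj: "inj_on (\<lambda>i. (R ^^ i) x) {..<N}"
    proof (rule inj_onI)
      fix i j assume "i \<in> {..<N}" "j \<in> {..<N}" "(R ^^ i) x = (R ^^ j) x"
      then show "i = j" using *[of i j] *[of j i] by (cases "i \<le> j") auto
    qed
    have "sum T (Q - Orb) \<in> I"
    proof (rule psubset.IH)
      show "Q - Orb \<subset> Q" using x xOrb by blast
    next
      fix y assume y: "y \<in> Q - Orb"
      \<comment> \<open>R is invertible on Q through its (N-1)-st power, so a point that R maps into
        the orbit already lies in it.\<close>
      have "R y \<notin> Orb"
      proof
        assume "R y \<in> Orb"
        then obtain i where i: "R y = (R ^^ i) x" "i < N" by (auto simp: Orb_def)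
        have "y = (R ^^ (N - 1 + 1)) y" using psubset.prems(2) y N by simp
        also have "\<dots> = (R ^^ (N - 1)) (R y)" by (simp only: funpow_add o_apply) simp
        also have "\<dots> = (R ^^ (N - 1 + i)) x" by (simp only: i(1) funpow_add o_apply)
        also have "\<dots> \<in> Orb"
        proof (cases "i = 0")
          case True
          then show ?thesis using N by (auto simp: Orb_def)
        next
          case False
          then have "N - 1 + i = (i - 1) + N" using N by simp
          then have "(R ^^ (N - 1 + i)) x = (R ^^ (i - 1)) x"
            using psubset.prems(2)[OF x] by (simp only: funpow_add o_apply)
          then show ?thesis using i by (auto simp: Orb_def)
        qed
        finally show False using y by blast
      qed
      then show "R y \<in> Q - Orb" using y psubset.prems(1) by blast
    qed (use psubset.prems in auto)
    moreover have "sum T Orb = (\<Sum>i<N. T ((R ^^ i) x))"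
      unfolding Orb_def using inj by (subst sum.reindex) auto
    moreover have "sum T Q = sum T (Q - Orb) + sum T Orb"
      using Orb psubset.hyps by (intro sum.subset_diff) auto
    ultimately show ?thesis using psubset.prems(4)[OF x] add by simp
  qed (simp add: zero)
qed

section \<open>Expansion of a determinant\<close>

text \<open>A pair \<open>(S, \<sigma>)\<close> selects the principal minor with index set \<open>S\<close> and one of its terms.\<close>

definition partial_perms :: "nat \<Rightarrow> (nat set \<times> (nat \<Rightarrow> nat)) set" where
  "partial_perms N = (SIGMA S:Pow {..<N}. {\<sigma>. \<sigma> permutes S})"

lemma finite_partial_perms: "finite (partial_perms N)"
  unfolding partial_perms_def
  by (intro finite_SigmaI) (auto intro: finite_permutations finite_subset)

lemma partial_permsD:
  assumes "(S, \<sigma>) \<in> partial_perms N"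
  shows "S \<subseteq> {..<N}" "\<sigma> permutes S" "finite S"
  using assms finite_subset by (auto simp: partial_perms_def)

text \<open>Each factor of a Leibniz term is an entry of M plus a Kronecker delta. If S collects the
  indices where M was chosen, all others must be fixed points, so the permutation is one of S, with
  the same sign.\<close>

lemma det_one_plus:
  fixes M :: "'b::comm_ring_1 mat"
  assumes "M \<in> carrier_mat N N"
  shows "det (1\<^sub>m N + M) = (\<Sum>(S, \<sigma>)\<in>partial_perms N. signof \<sigma> * (\<Prod>i\<in>S. M $$ (i, \<sigma> i)))"
proof -
  let ?U = "{..<N}"
  have "det (1\<^sub>m N + M) = (\<Sum>\<sigma> | \<sigma> permutes ?U. signof \<sigma> * (\<Prod>i\<in>?U. (1\<^sub>m N + M) $$ (i, \<sigma> i)))"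
    using assms by (subst det_def'[of _ N]) (auto simp: atLeast0LessThan)
  also have "\<dots> = (\<Sum>\<sigma> | \<sigma> permutes ?U. \<Sum>S\<in>Pow ?U. if \<forall>i\<in>?U - S. \<sigma> i = i
      then signof \<sigma> * (\<Prod>i\<in>S. M $$ (i, \<sigma> i)) else 0)"
  proof (intro sum.cong refl)
    fix \<sigma> assume "\<sigma> \<in> {\<sigma>. \<sigma> permutes ?U}"
    then have \<sigma>: "\<sigma> i < N" if "i < N" for i using permutes_in_image[of \<sigma> ?U] that by auto
    have "(\<Prod>i\<in>?U. (1\<^sub>m N + M) $$ (i, \<sigma> i))
        = (\<Prod>i\<in>?U. M $$ (i, \<sigma> i) + (if \<sigma> i = i then 1 else 0))"
      using assms \<sigma> by (intro prod.cong) auto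
    also have "\<dots> = (\<Sum>S\<in>Pow ?U. (\<Prod>i\<in>S. M $$ (i, \<sigma> i)) * (\<Prod>i\<in>?U - S. if \<sigma> i = i then 1 else 0))"
      by (rule prod_add) simp
    also have "\<dots> = (\<Sum>S\<in>Pow ?U. if \<forall>i\<in>?U - S. \<sigma> i = i then \<Prod>i\<in>S. M $$ (i, \<sigma> i) else 0)"
    proof (intro sum.cong refl)
      fix S
      have "(\<Prod>i\<in>?U - S. if \<sigma> i = i then 1 else 0) = (if \<forall>i\<in>?U - S. \<sigma> i = i then 1 else (0::'b))"
        by (auto intro!: prod_zero prod.neutral)
      then show "(\<Prod>i\<in>S. M $$ (i, \<sigma> i)) * (\<Prod>i\<in>?U - S. if \<sigma> i = i then 1 else 0)
          = (if \<forall>i\<in>?U - S. \<sigma> i = i then \<Prod>i\<in>S. M $$ (i, \<sigma> i) else 0)" by simp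
    qed
    finally show "signof \<sigma> * (\<Prod>i\<in>?U. (1\<^sub>m N + M) $$ (i, \<sigma> i)) = (\<Sum>S\<in>Pow ?U.
        if \<forall>i\<in>?U - S. \<sigma> i = i then signof \<sigma> * (\<Prod>i\<in>S. M $$ (i, \<sigma> i)) else 0)"
      by (simp add: sum_distrib_left if_distrib cong: if_cong)
  qed
  also have "\<dots> = (\<Sum>S\<in>Pow ?U. \<Sum>\<sigma> | \<sigma> permutes ?U. if \<forall>i\<in>?U - S. \<sigma> i = i
      then signof \<sigma> * (\<Prod>i\<in>S. M $$ (i, \<sigma> i)) else 0)"
    by (rule sum.swap)
  also have "\<dots> = (\<Sum>S\<in>Pow ?U. \<Sum>\<sigma> | \<sigma> permutes S. signof \<sigma> * (\<Prod>i\<in>S. M $$ (i, \<sigma> i)))"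
  proof (rule sum.cong[OF refl])
    fix S assume S: "S \<in> Pow ?U"
    have "{\<sigma>. \<sigma> permutes S} = {\<sigma> \<in> {\<sigma>. \<sigma> permutes ?U}. \<forall>i\<in>?U - S. \<sigma> i = i}"
      using S permutes_subset permutes_superset[of _ ?U S] by (fastforce simp: permutes_not_in)
    then show "(\<Sum>\<sigma> | \<sigma> permutes ?U. if \<forall>i\<in>?U - S. \<sigma> i = i
      then signof \<sigma> * (\<Prod>i\<in>S. M $$ (i, \<sigma> i)) else 0)
        = (\<Sum>\<sigma> | \<sigma> permutes S. signof \<sigma> * (\<Prod>i\<in>S. M $$ (i, \<sigma> i)))"
      by (simp add: sum.inter_filter[symmetric] finite_permutations)
  qed
  also have "\<dots> = (\<Sum>(S, \<sigma>)\<in>partial_perms N. signof \<sigma> * (\<Prod>i\<in>S. M $$ (i, \<sigma> i)))"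
    unfolding partial_perms_def
    by (intro sum.Sigma) (auto intro: finite_permutations finite_subset)
  finally show ?thesis .
qed

section \<open>Rotation of partial permutations\<close>

text \<open>The shift by one modulo N. It is the identity beyond N, so that it is a permutation of
  all naturals and can conjugate permutations that are functions on the whole type.\<close>

definition rot :: "nat \<Rightarrow> nat \<Rightarrow> nat" where
  "rot N i = (if i < N then (if Suc i = N then 0 else Suc i) else i)"

lemma rot_permutes: "rot N permutes {..<N}"
proof (rule bij_imp_permutes)
  show "bij_betw (rot N) {..<N} {..<N}"
    by (rule bij_betw_byWitness[of _ "\<lambda>i. if i = 0 then N - 1 else i - 1"]) (auto simp: rot_def)
qed (simp add: rot_def)

lemma bij_rot: "bij (rot N)" using rot_permutes by (rule permutes_bij)

lemma rot_pow: "i < N \<Longrightarrow> (rot N ^^ k) i = (i + k) mod N"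
  by (induction k) (auto simp: rot_def mod_Suc)

lemma rot_pow_ge: "\<not> i < N \<Longrightarrow> (rot N ^^ k) i = i"
  by (induction k) (auto simp: rot_def)

lemma rot_pow_N: "rot N ^^ N = id"
proof
  fix i show "(rot N ^^ N) i = id i"
    using rot_pow[of i N N] rot_pow_ge[of i N N] by (cases "i < N") auto
qed

definition rotate_perm :: "nat \<Rightarrow> nat set \<times> (nat \<Rightarrow> nat) \<Rightarrow> nat set \<times> (nat \<Rightarrow> nat)" where
  "rotate_perm N = (\<lambda>(S, \<sigma>). (rot N ` S, rot N \<circ> \<sigma> \<circ> inv_into UNIV (rot N)))"

lemma rotate_perm_pow:
  "(rotate_perm N ^^ k) (S, \<sigma>) = ((rot N ^^ k) ` S, (rot N ^^ k) \<circ> \<sigma> \<circ> inv_into UNIV (rot N ^^ k))"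
proof (induction k)
  case (Suc k)
  have "inv_into UNIV (rot N ^^ Suc k) = inv_into UNIV (rot N ^^ k) \<circ> inv_into UNIV (rot N)"
    unfolding funpow.simps by (intro o_inv_distrib bij_rot bij_fn)
  moreover have "(rotate_perm N ^^ Suc k) (S, \<sigma>)
      = rotate_perm N ((rot N ^^ k) ` S, (rot N ^^ k) \<circ> \<sigma> \<circ> inv_into UNIV (rot N ^^ k))"
    by (subst funpow.simps, subst o_apply, subst Suc.IH) (rule refl)
  ultimately show ?case
    by (simp only: rotate_perm_def prod.case image_comp o_assoc funpow.simps)
qed simp

lemma rotate_perm_pow_N: "(rotate_perm N ^^ N) x = x"
  by (cases x) (simp add: rotate_perm_pow rot_pow_N)

lemma rotate_perm_fixD:
  assumes "(rotate_perm N ^^ k) (S, \<sigma>) = (S, \<sigma>)"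
  shows "(rot N ^^ k) ` S = S" "\<sigma> ((rot N ^^ k) i) = (rot N ^^ k) (\<sigma> i)"
proof -
  have eq: "(rot N ^^ k) ` S = S" "(rot N ^^ k) \<circ> \<sigma> \<circ> inv_into UNIV (rot N ^^ k) = \<sigma>"
    using assms by (simp_all add: rotate_perm_pow)
  show "(rot N ^^ k) ` S = S" by fact
  have "inv_into UNIV (rot N ^^ k) ((rot N ^^ k) i) = i"
    using bij_fn[OF bij_rot] by (simp add: bij_is_inj)
  then show "\<sigma> ((rot N ^^ k) i) = (rot N ^^ k) (\<sigma> i)"
    using fun_cong[OF eq(2), of "(rot N ^^ k) i"] by simp
qed

lemma rotate_perm_closed:
  assumes "x \<in> partial_perms N"
  shows "rotate_perm N x \<in> partial_perms N"
proof -
  obtain S \<sigma> where x: "x = (S, \<sigma>)" by (cases x)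
  note S = partial_permsD[OF assms[unfolded x]]
  let ?\<tau> = "rot N \<circ> \<sigma> \<circ> inv_into UNIV (rot N)"
  have inv: "inv_into UNIV (rot N) (rot N i) = i" for i using bij_rot by (simp add: bij_is_inj)
  have inj: "inj (rot N)" using bij_rot by (rule bij_is_inj)
  have "bij ?\<tau>" (is ?bij) by (intro bij_comp bij_imp_bij_inv bij_rot permutes_bij[OF S(2)])
  have img: "?\<tau> ` (rot N ` S) = rot N ` S"
  proof -
    have "?\<tau> ` (rot N ` S) = rot N ` (\<sigma> ` S)" by (simp add: image_image inv)
    then show ?thesis by (simp only: permutes_image[OF S(2)])
  qed
  have "bij_betw ?\<tau> (rot N ` S) (rot N ` S)"
    by (rule bij_betw_imageI[OF inj_on_subset[OF bij_is_inj[OF \<open>?bij\<close>] subset_UNIV] img])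
  moreover have "?\<tau> i = i" if "i \<notin> rot N ` S" for i
  proof -
    have "rot N (inv_into UNIV (rot N) i) = i" using bij_rot by (simp add: bij_is_surj surj_f_inv_f)
    moreover from this have "inv_into UNIV (rot N) i \<notin> S" using that by (metis imageI)
    ultimately show ?thesis by (simp add: permutes_not_in[OF S(2)])
  qed
  ultimately have "?\<tau> permutes rot N ` S" by (rule bij_imp_permutes)
  moreover have "rot N ` S \<subseteq> {..<N}"
    using S(1) permutes_in_image[OF rot_permutes] by auto
  ultimately show ?thesis by (simp add: x rotate_perm_def partial_perms_def)
qed

lemma rotate_perm_pow_closed: "x \<in> partial_perms N \<Longrightarrow> (rotate_perm N ^^ k) x \<in> partial_perms N"
  by (induction k) (auto intro: rotate_perm_closed)

lemma card_rotate_perm: "card (fst (rotate_perm N x)) = card (fst x)"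
proof (cases x)
  case (Pair S \<sigma>)
  have "inj_on (rot N) S" using bij_rot by (meson bij_is_inj inj_on_subset subset_UNIV)
  then show ?thesis by (simp add: Pair rotate_perm_def card_image)
qed

lemma sign_rotate_perm:
  assumes "x \<in> partial_perms N"
  shows "sign (snd (rotate_perm N x)) = sign (snd x)"
proof -
  obtain S \<sigma> where x: "x = (S, \<sigma>)" by (cases x)
  have "permutation \<sigma>"
    using partial_permsD[OF assms[unfolded x]] by (auto intro: permutes_imp_permutation)
  moreover have "permutation (rot N)" by (rule permutes_imp_permutation[OF _ rot_permutes]) simp
  ultimately show ?thesis
    by (simp add: x rotate_perm_def sign_compose sign_inverse permutation_compose permutation_inverse)
qed

text \<open>A subset of the integers modulo h e stable under translation by e is the full preimage
  of its set of residues modulo e, and each residue class has h members.\<close>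

lemma card_translation_stable:
  assumes S: "S \<subseteq> {..<h * e}" and shift: "\<And>i. i \<in> S \<Longrightarrow> (i + e) mod (h * e) \<in> S" and e: "e > 0"
  shows "card S = h * card ((\<lambda>i. i mod e) ` S)"
    and "S = (\<lambda>(k, w). k * e + w) ` ({..<h} \<times> (\<lambda>i. i mod e) ` S)"
proof -
  let ?W = "(\<lambda>i. i mod e) ` S"
  have shift': "(i + e * k) mod (h * e) \<in> S" if i: "i \<in> S" for i k
  proof (induction k)
    case 0
    then show ?case using i S by auto
  next
    case (Suc k)
    then have "((i + e * k) mod (h * e) + e) mod (h * e) \<in> S" by (rule shift)
    moreover have "((i + e * k) mod (h * e) + e) mod (h * e) = (i + e * Suc k) mod (h * e)"
      by (subst mod_add_left_eq) (simp add: add_ac)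
    ultimately show ?case by simp
  qed
  show eq: "S = (\<lambda>(k, w). k * e + w) ` ({..<h} \<times> ?W)"
  proof (rule subset_antisym; rule subsetI)
    fix i assume i: "i \<in> S"
    then have "i div e < h" using S less_mult_imp_div_less by auto
    then show "i \<in> (\<lambda>(k, w). k * e + w) ` ({..<h} \<times> ?W)"
      using i by (intro image_eqI[of _ _ "(i div e, i mod e)"]) auto
  next
    fix x assume "x \<in> (\<lambda>(k, w). k * e + w) ` ({..<h} \<times> ?W)"
    then obtain k i where ki: "k < h" "i \<in> S" "x = k * e + i mod e" by auto
    have "i div e < h" using ki S less_mult_imp_div_less by auto
    \<comment> \<open>Number of translations by e that carry block i div e to block k. The extra h
      steps are one full turn and replace a possibly negative difference.\<close>
    then have d: "i div e + (k + h - i div e) = k + h" by simp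
    have "i + e * (k + h - i div e) = i mod e + e * (i div e + (k + h - i div e))"
      by (simp add: add_mult_distrib2)
    also have "\<dots> = i mod e + e * (k + h)" unfolding d ..
    also have "\<dots> = x + h * e" by (simp add: ki algebra_simps)
    finally have "(i + e * (k + h - i div e)) mod (h * e) = x mod (h * e)" by simp
    moreover have "x < h * e"
    proof -
      have "x < Suc k * e" using ki e by simp
      also have "\<dots> \<le> h * e" using ki by (intro mult_le_mono1) simp
      finally show ?thesis .
    qed
    ultimately show "x \<in> S" using shift'[OF ki(2), of "k + h - i div e"] by simp
  qed
  have "inj_on (\<lambda>(k, w). k * e + w) ({..<h} \<times> ?W)"
  proof (rule inj_onI, clarify)
    fix k k' i i' assume "k * e + i mod e = k' * e + i' mod e"
    then have "(k * e + i mod e) div e = (k' * e + i' mod e) div e"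
      "(k * e + i mod e) mod e = (k' * e + i' mod e) mod e" by simp_all
    then show "k = k' \<and> i mod e = i' mod e" using e by simp
  qed
  then have "card ((\<lambda>(k, w). k * e + w) ` ({..<h} \<times> ?W)) = h * card ?W"
    by (simp add: card_image card_cartesian_product)
  then show "card S = h * card ?W" using eq by simp
qed

lemma rotate_perm_fixI:
  assumes "(rot N ^^ k) ` S = S" "\<And>i. \<sigma> ((rot N ^^ k) i) = (rot N ^^ k) (\<sigma> i)"
  shows "(rotate_perm N ^^ k) (S, \<sigma>) = (S, \<sigma>)"
proof -
  have "(rot N ^^ k) \<circ> \<sigma> \<circ> inv_into UNIV (rot N ^^ k) = \<sigma>"
  proof
    fix i
    have "(rot N ^^ k) (inv_into UNIV (rot N ^^ k) i) = i"
      using bij_fn[OF bij_rot] by (simp add: bij_is_surj surj_f_inv_f)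
    then show "((rot N ^^ k) \<circ> \<sigma> \<circ> inv_into UNIV (rot N ^^ k)) i = \<sigma> i"
      using assms(2)[of "inv_into UNIV (rot N ^^ k) i"] by simp
  qed
  then show ?thesis by (simp only: rotate_perm_pow assms(1))
qed

lemma rotate_perm_inj: "rotate_perm N x = rotate_perm N y \<Longrightarrow> x = y"
proof (cases N)
  case 0
  have "rot 0 = id" by (simp add: rot_def fun_eq_iff)
  then have "rotate_perm 0 z = z" for z by (cases z) (simp add: rotate_perm_def)
  then show "rotate_perm N x = rotate_perm N y \<Longrightarrow> x = y" using 0 by simp
next
  case (Suc n)
  have "(rotate_perm N ^^ n) (rotate_perm N z) = z" for z
    using rotate_perm_pow_N[of N z] by (simp add: Suc funpow_swap1)
  then show "rotate_perm N x = rotate_perm N y \<Longrightarrow> x = y" by metis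
qed

lemma rotate_perm_pow_inj: "(rotate_perm N ^^ k) x = (rotate_perm N ^^ k) y \<Longrightarrow> x = y"
  by (induction k) (auto dest: rotate_perm_inj)

lemma rotate_perm_fix_iff:
  "(rotate_perm N ^^ j) ((rotate_perm N ^^ i) x) = (rotate_perm N ^^ i) x \<longleftrightarrow> (rotate_perm N ^^ j) x = x"
proof -
  have "(rotate_perm N ^^ j) ((rotate_perm N ^^ i) x) = (rotate_perm N ^^ i) ((rotate_perm N ^^ j) x)"
    by (metis add.commute comp_apply funpow_add)
  then show ?thesis using rotate_perm_pow_inj[of i N] by metis
qed

lemma card_rotate_perm_pow: "card (fst ((rotate_perm N ^^ k) x)) = card (fst x)"
  by (induction k) (auto simp: card_rotate_perm)

text \<open>The differences \<sigma> i - i cancel over S, so only the wrap-arounds contribute, each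
  by N. Hence the number of descents, which is the exponent of \<open>c\<close> in a minor, is
  determined by the residues of \<sigma> i - i alone.\<close>

lemma sum_cyclic_diff:
  assumes "(S, \<sigma>) \<in> partial_perms N"
  shows "(\<Sum>i\<in>S. (\<sigma> i + N - i) mod N) = N * card {i \<in> S. \<sigma> i < i}"
proof -
  note S = partial_permsD[OF assms]
  have "(\<Sum>i\<in>S. (\<sigma> i + N - i) mod N) + (\<Sum>i\<in>S. i) = (\<Sum>i\<in>S. \<sigma> i + (if \<sigma> i < i then N else 0))"
    unfolding sum.distrib[symmetric]
  proof (intro sum.cong refl)
    fix i assume i: "i \<in> S"
    then have "i < N" "\<sigma> i < N" using S permutes_in_image[OF S(2), of i] by auto
    then show "(\<sigma> i + N - i) mod N + i = \<sigma> i + (if \<sigma> i < i then N else 0)"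
      by (simp add: cyclic_diff_eq)
  qed
  also have "\<dots> = (\<Sum>i\<in>S. i) + (\<Sum>i\<in>S. if \<sigma> i < i then N else 0)"
    using sum.permute[OF S(2), of "\<lambda>i. i"] by (simp add: sum.distrib)
  also have "(\<Sum>i\<in>S. if \<sigma> i < i then N else 0) = N * card {i \<in> S. \<sigma> i < i}"
    using S(3) by (simp add: sum.inter_filter[symmetric])
  finally show ?thesis by simp
qed

section \<open>Translations of a subgroup\<close>

text \<open>The pairs with m = 1, normalised to contain 0: the subgroup generated by e inside the
  integers modulo h e, with its translation by e v. Outside it is the identity, as
  \<open>permutes\<close> requires.\<close>

definition coset_perm :: "nat \<Rightarrow> nat \<Rightarrow> nat \<Rightarrow> nat set \<times> (nat \<Rightarrow> nat)" where
  "coset_perm h e v = ({i. i < h * e \<and> e dvd i},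
     \<lambda>i. if i < h * e \<and> e dvd i then (i + e * v) mod (h * e) else i)"

context
  fixes h e :: nat
  assumes h: "h > 0" and e: "e > 0"
begin

lemma subgroup_eq_image: "{i. i < h * e \<and> e dvd i} = (\<lambda>k. k * e) ` {..<h}"
  using e by (auto simp: mult.commute elim!: dvdE)

lemma card_subgroup: "card {i. i < h * e \<and> e dvd i} = h"
  unfolding subgroup_eq_image using e by (subst card_image) (auto simp: inj_on_def)

lemma coset_perm_mem: "coset_perm h e v \<in> partial_perms (h * e)"
proof -
  let ?S = "{i. i < h * e \<and> e dvd i}" and ?\<sigma> = "snd (coset_perm h e v)"
  have \<sigma>: "?\<sigma> i = (i + e * v) mod (h * e)" if "i \<in> ?S" for i using that by (simp add: coset_perm_def)
  have "?\<sigma> ` ?S \<subseteq> ?S" using h e by (auto simp: \<sigma> intro!: dvd_mod)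
  moreover have "inj_on ?\<sigma> ?S"
  proof (rule inj_onI)
    fix i j assume ij: "i \<in> ?S" "j \<in> ?S" "?\<sigma> i = ?\<sigma> j"
    then have "[i + e * v = j + e * v] (mod (h * e))" by (simp add: \<sigma> cong_def)
    then have "[i = j] (mod (h * e))" by (simp add: cong_add_rcancel_nat)
    then show "i = j" using ij by (simp add: cong_def)
  qed
  ultimately have "bij_betw ?\<sigma> ?S ?S" by (simp add: bij_betw_def endo_inj_surj)
  then have "?\<sigma> permutes ?S" by (rule bij_imp_permutes) (auto simp: coset_perm_def)
  then show ?thesis by (auto simp: partial_perms_def coset_perm_def)
qed

lemma coset_perm_fix: "(rotate_perm (h * e) ^^ e) (coset_perm h e v) = coset_perm h e v"
  unfolding coset_perm_def
proof (rule rotate_perm_fixI)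
  let ?S = "{i. i < h * e \<and> e dvd i}" and ?r = "rot (h * e) ^^ e"
  have r: "?r i = (i + e) mod (h * e)" if "i < h * e" for i using that by (rule rot_pow)
  have mem: "?r i \<in> ?S \<longleftrightarrow> i \<in> ?S" for i
    using h e rot_pow_ge[of i "h * e" e] by (cases "i < h * e") (auto simp: r dvd_mod_iff)
  show "?r ` ?S = ?S"
    using mem by (intro endo_inj_surj) (auto intro: inj_on_subset[OF bij_is_inj[OF bij_fn[OF bij_rot]]])
  fix i
  show "(if ?r i < h * e \<and> e dvd ?r i then (?r i + e * v) mod (h * e) else ?r i)
      = ?r (if i < h * e \<and> e dvd i then (i + e * v) mod (h * e) else i)"
  proof (cases "i \<in> ?S")
    case True
    then have "(?r i + e * v) mod (h * e) = ?r ((i + e * v) mod (h * e))"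
      using h e by (simp add: r mod_simps add_ac)
    then show ?thesis using True mem[of i] by simp
  next
    case False
    then show ?thesis using mem[of i] by auto
  qed
qed

text \<open>With h elements S is a single coset, and 0 in S makes it the subgroup. Since \<sigma>
  commutes with translation by e, it is determined by \<sigma> 0 = e v.\<close>

lemma coset_perm_unique:
  assumes "(S, \<sigma>) \<in> partial_perms (h * e)" and per: "(rotate_perm (h * e) ^^ e) (S, \<sigma>) = (S, \<sigma>)"
    and S0: "0 \<in> S" and card: "card S = h"
  shows "\<exists>v<h. (S, \<sigma>) = coset_perm h e v"
proof -
  note S = partial_permsD[OF assms(1)]
  have shift: "(i + e) mod (h * e) \<in> S" if "i \<in> S" for i
    using rotate_perm_fixD(1)[OF per] rot_pow[of i "h * e" e] that S(1) by (metis imageI lessThan_iff subsetD)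
  have "card S = h * card ((\<lambda>i. i mod e) ` S)"
    by (rule card_translation_stable(1)[OF S(1) shift e])
  then have "card ((\<lambda>i. i mod e) ` S) = 1" using card h by auto
  moreover have "0 \<in> (\<lambda>i. i mod e) ` S" using S0 by (intro image_eqI[of _ _ 0]) auto
  ultimately have "(\<lambda>i. i mod e) ` S = {0}" by (metis card_1_singletonE singletonD)
  then have "S = (\<lambda>(k, w). k * e + w) ` ({..<h} \<times> {0})"
    using card_translation_stable(2)[OF S(1) shift e] by simp
  also have "\<dots> = (\<lambda>k. k * e) ` {..<h}" by force
  finally have S_eq: "S = (\<lambda>k. k * e) ` {..<h}" .
  have "\<sigma> 0 \<in> S" using S0 permutes_in_image[OF S(2)] by simp
  then obtain v where v: "v < h" "\<sigma> 0 = e * v" unfolding S_eq by auto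
  have "\<sigma> i = (i + e * v) mod (h * e)" if i: "i \<in> S" for i
  proof -
    obtain k where k: "i = k * e" "k < h" using i unfolding S_eq by blast
    have lt: "e * k < h * e" "e * v < h * e" using k v e by simp_all
    have "(rotate_perm (h * e) ^^ (e * k)) (S, \<sigma>) = (S, \<sigma>)" by (rule funpow_fix_mult[OF per])
    from rotate_perm_fixD(2)[OF this, of 0] show ?thesis
      using h e lt by (simp add: rot_pow v k add.commute mult.commute[of k])
  qed
  moreover have "\<sigma> i = i" if "i \<notin> S" for i using that by (rule permutes_not_in[OF S(2)])
  ultimately have "(S, \<sigma>) = coset_perm h e v"
    unfolding coset_perm_def subgroup_eq_image[symmetric] S_eq[folded subgroup_eq_image, symmetric]
    using S_eq[folded subgroup_eq_image] by (auto simp: fun_eq_iff)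
  then show ?thesis using v by blast
qed

text \<open>The index set of a rotated pair is a coset and reveals i modulo e; after undoing the
  rotation, the image of 0 reveals v.\<close>

lemma coset_perm_rotate_inj:
  assumes "(rotate_perm (h * e) ^^ i) (coset_perm h e v) = (rotate_perm (h * e) ^^ j) (coset_perm h e w)"
    and "i < e" "j < e" "v < h" "w < h"
  shows "i = j \<and> v = w"
proof -
  let ?R = "rotate_perm (h * e)"
  have *: "i = j" if "i \<le> j" "j < e" "(?R ^^ i) (coset_perm h e v) = (?R ^^ j) (coset_perm h e w)"
    for i j v w
  proof -
    have "(?R ^^ j) (coset_perm h e w) = (?R ^^ (i + (j - i))) (coset_perm h e w)" using that by simp
    also have "\<dots> = (?R ^^ i) ((?R ^^ (j - i)) (coset_perm h e w))" by (simp only: funpow_add o_apply)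
    finally have "coset_perm h e v = (?R ^^ (j - i)) (coset_perm h e w)"
      using that(3) rotate_perm_pow_inj by metis
    then have "{i. i < h * e \<and> e dvd i} = (rot (h * e) ^^ (j - i)) ` {i. i < h * e \<and> e dvd i}"
      by (simp add: coset_perm_def rotate_perm_pow)
    moreover have "0 \<in> {i. i < h * e \<and> e dvd i}" using h e by simp
    ultimately have "0 \<in> (rot (h * e) ^^ (j - i)) ` {i. i < h * e \<and> e dvd i}" by blast
    then obtain a where "a < h * e" "e dvd a" "0 = (rot (h * e) ^^ (j - i)) a" by blast
    then have a: "a < h * e" "e dvd a" "(a + (j - i)) mod (h * e) = 0" by (simp_all add: rot_pow)
    then have "e dvd a + (j - i)" by (metis dvd_trans dvd_triv_right mod_0_imp_dvd)
    then have "e dvd j - i" using a(2) by (simp add: dvd_add_right_iff)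
    then show "i = j" using that by (auto dest!: dvd_imp_le)
  qed
  have ij: "i = j" using *[of i j v w] *[of j i w v] assms by (cases "i \<le> j") auto
  then have "coset_perm h e v = coset_perm h e w" using assms(1) rotate_perm_pow_inj by metis
  then have "snd (coset_perm h e v) 0 = snd (coset_perm h e w) 0" by simp
  moreover have "e * v < h * e" "e * w < h * e" using assms e by simp_all
  ultimately have "e * v = e * w" using h e by (simp add: coset_perm_def)
  then show ?thesis using e ij by simp
qed

lemma coset_perm_period:
  assumes "0 < j" "j < e"
  shows "(rotate_perm (h * e) ^^ j) (coset_perm h e v) \<noteq> coset_perm h e v"
proof
  assume "(rotate_perm (h * e) ^^ j) (coset_perm h e v) = coset_perm h e v"
  then have "(rot (h * e) ^^ j) ` {i. i < h * e \<and> e dvd i} = {i. i < h * e \<and> e dvd i}"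
    unfolding coset_perm_def by (rule rotate_perm_fixD)
  moreover have "0 \<in> {i. i < h * e \<and> e dvd i}" using h e by simp
  ultimately have "(rot (h * e) ^^ j) 0 \<in> {i. i < h * e \<and> e dvd i}" by blast
  moreover have "j < h * e" using assms h by (metis less_le_trans mult_le_mono1 nat_mult_1 Suc_leI One_nat_def)
  ultimately have "e dvd j" using h e by (simp add: rot_pow)
  then show False using assms by (simp add: nat_dvd_not_less)
qed

text \<open>The h-th power of the translation is the identity, and a sign whose odd power is 1
  equals 1.\<close>

lemma sign_coset_perm:
  assumes "odd h"
  shows "sign (snd (coset_perm h e v)) = 1"
proof -
  let ?\<sigma> = "snd (coset_perm h e v)"
  obtain S where S: "(S, ?\<sigma>) \<in> partial_perms (h * e)" using coset_perm_mem[of v] by (metis prod.collapse)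
  have perm: "permutation ?\<sigma>"
    by (rule permutes_imp_permutation[OF partial_permsD(3)[OF S] partial_permsD(2)[OF S]])
  have pow: "sign (?\<sigma> ^^ k) = sign ?\<sigma> ^ k \<and> permutation (?\<sigma> ^^ k)" for k
  proof (induction k)
    case (Suc k)
    then show ?case
      unfolding funpow.simps by (simp only: sign_compose perm permutation_compose power_Suc simp_thms)
  qed simp
  have "(?\<sigma> ^^ k) i = (if i < h * e \<and> e dvd i then (i + e * v * k) mod (h * e) else i)" for k i
    using h e by (induction k) (auto simp: coset_perm_def mod_simps algebra_simps intro!: dvd_mod)
  moreover have "(i + e * v * h) mod (h * e) = i mod (h * e)" for i
    using mod_mult_self1[of i v "h * e"] by (simp only: mult_ac)
  ultimately have "(?\<sigma> ^^ h) i = id i" for i by simp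
  then have "?\<sigma> ^^ h = id" by auto
  then have "sign ?\<sigma> ^ h = 1" using pow[of h] by simp
  then show ?thesis using assms by (cases ?\<sigma> rule: sign_cases) auto
qed

lemma coset_perm_diff:
  assumes "v < h" "i \<in> fst (coset_perm h e v)"
  shows "(snd (coset_perm h e v) i + h * e - i) mod (h * e) = e * v"
  using assms e cyclic_add_diff(1)[of i "h * e" "e * v"] by (simp add: coset_perm_def)

text \<open>All h differences equal e v, while each wrap-around accounts for h e of their sum. This
  is the origin of the factor (1 + T)^v.\<close>

lemma coset_perm_carries:
  assumes "v < h"
  shows "card {i \<in> fst (coset_perm h e v). snd (coset_perm h e v) i < i} = v"
proof -
  have "h * e * card {i \<in> fst (coset_perm h e v). snd (coset_perm h e v) i < i}
      = (\<Sum>i\<in>fst (coset_perm h e v). (snd (coset_perm h e v) i + h * e - i) mod (h * e))"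
    using coset_perm_mem[of v] by (subst sum_cyclic_diff[symmetric]) simp_all
  also have "\<dots> = card (fst (coset_perm h e v)) * (e * v)" using assms by (simp add: coset_perm_diff)
  also have "\<dots> = h * e * v" by (simp add: coset_perm_def card_subgroup)
  finally show ?thesis using h e by simp
qed

end

section \<open>The congruence for the reduced norm\<close>

context cyclic_extension
begin

text \<open>In the theorem 1 - z^q is \<pi>, because z^q is \<open>\<zeta> r\<close>; so this is the
  ideal of \<open>A\<close> generated by \<pi>^e.\<close>

definition ideal :: "nat \<Rightarrow> 'b set" where
  "ideal e = (\<lambda>a. (1 - z ^ q) ^ e * a) ` A"

lemma ideal_zero: "0 \<in> ideal e"
  unfolding ideal_def by (rule image_eqI[OF _ A.zero_mem]) simp

lemma ideal_add: "x \<in> ideal e \<Longrightarrow> y \<in> ideal e \<Longrightarrow> x + y \<in> ideal e"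
  unfolding ideal_def by (auto intro: A.add_mem simp flip: distrib_left)

lemma ideal_sum: "(\<And>i. i \<in> I \<Longrightarrow> f i \<in> ideal e) \<Longrightarrow> sum f I \<in> ideal e"
  by (induction I rule: infinite_finite_induct) (auto intro: ideal_zero ideal_add)

lemma one_minus_z_power_mem: "1 - z ^ q \<in> A"
  by (intro A.diff_mem A.one_mem z_power_q_mem)

lemma ideal_mono:
  assumes "x \<in> ideal e'" "e \<le> e'" shows "x \<in> ideal e"
proof -
  obtain a where a: "x = (1 - z ^ q) ^ e' * a" "a \<in> A" using assms by (auto simp: ideal_def)
  then have "x = (1 - z ^ q) ^ e * ((1 - z ^ q) ^ (e' - e) * a)"
    using assms(2) by (simp flip: power_add mult.assoc)
  then show ?thesis
    unfolding ideal_def using a by (blast intro: A.mult_mem A.power_mem one_minus_z_power_mem)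
qed

lemma z_q_root: "primitive_root_of_unity (p ^ r) (z ^ q)"
  unfolding q_def
  using z_root prime_gt_0_nat[OF p(1)] by (intro primitive_root_power) (auto simp: power_add mult.commute)

lemma one_minus_z_q_nonzero: "1 - z ^ q \<noteq> 0"
proof -
  have "\<not> p ^ r dvd 1" using r prime_gt_1_nat[OF p(1)] by simp
  then have "(z ^ q) ^ 1 \<noteq> 1"
    using primitive_root_power_eq_1_iff[OF z_q_root] prime_gt_0_nat[OF p(1)] by (metis zero_less_power)
  then show ?thesis by simp
qed

lemma prime_eq: obtains a where "a \<in> A" "of_nat p = (1 - z ^ q) ^ totient (p ^ r) * a"
  using prime_mem_power_ideal[OF subring_A z_power_q_mem p(1) z_q_root r p_nonzero] by blast

text \<open>By the Frobenius congruence (1 - z)^q differs from 1 - z^q by a multiple of p, and 1 -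
  z^q divides p. It converts powers of \<Pi> into powers of \<pi>.\<close>

lemma one_minus_z_power_q: obtains w where "w \<in> B" "(1 - z) ^ q = (1 - z ^ q) * w"
proof -
  obtain a where a: "a \<in> A" "of_nat p = (1 - z ^ q) ^ totient (p ^ r) * a" by (rule prime_eq)
  have "totient (p ^ r) > 0" using prime_gt_0_nat[OF p(1)] by simp
  then have pX: "of_nat p = (1 - z ^ q) * ((1 - z ^ q) ^ (totient (p ^ r) - 1) * a)"
    unfolding a(2) by (cases "totient (p ^ r)") (auto simp: mult.assoc)
  obtain y where y: "y \<in> B" "(1 - z) ^ q = 1 - z ^ q + of_nat p * y"
    using B.frobenius_one_minus[OF p z_mem, of s] by (auto simp: q_def)
  have "(1 - z) ^ q = (1 - z ^ q) * (1 + (1 - z ^ q) ^ (totient (p ^ r) - 1) * a * y)"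
    unfolding y(2) pX by (simp only: distrib_left mult_1_right mult.assoc)
  moreover have "1 + (1 - z ^ q) ^ (totient (p ^ r) - 1) * a * y \<in> B"
    using a(1) y(1) A_subset_B one_minus_z_power_mem
    by (intro B.add_mem B.mult_mem B.one_mem B.power_mem) auto
  ultimately show ?thesis
    by (intro that[of "1 + (1 - z ^ q) ^ (totient (p ^ r) - 1) * a * y"])
qed

lemma q_split: "k \<le> s \<Longrightarrow> p ^ (s - k) * p ^ k = q"
  by (simp add: q_def flip: power_add)

text \<open>
  The full trace of \<open>y\<close> is \<open>p\<^sup>s a\<close> with \<open>a \<in> A\<close>. If \<open>y\<close> is fixed by \<open>g\<close> to the power \<open>p\<^sup>k\<close>, the full
  trace is also \<open>p\<^bsup>s-k\<^esup>\<close> times the partial one, which therefore is \<open>p\<^sup>k a\<close>.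
\<close>

lemma partial_trace_mem:
  assumes k: "k \<le> s" and y: "y \<in> B" and x: "x = (1 - z) ^ (q * e) * y" and per: "(g ^^ (p ^ k)) x = x"
  shows "(\<Sum>i<p ^ k. (g ^^ i) x) \<in> ideal (k * totient (p ^ r) + e)"
proof -
  obtain w where w: "w \<in> B" "(1 - z) ^ q = (1 - z ^ q) * w" by (rule one_minus_z_power_q)
  define v where "v = w ^ e * y"
  have v: "v \<in> B" unfolding v_def by (intro B.mult_mem B.power_mem w y)
  let ?u = "(1 - z ^ q) ^ e"
  have xv: "x = ?u * v" unfolding x v_def power_mult w(2) by (simp add: power_mult_distrib mult.assoc)
  have u: "?u \<in> K" using A_subset_K one_minus_z_power_mem by (intro K.power_mem) auto
  have u0: "?u \<noteq> 0" using one_minus_z_q_nonzero by simp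
  have vL: "v \<in> L" using v B_subset_L by blast
  have gx: "(g ^^ i) x = ?u * (g ^^ i) v" for i
    unfolding xv using u vL K_subset_L by (subst funpow_mult_hom) (auto simp: funpow_fixes)
  \<comment> \<open>\<open>?u\<close> is a nonzero element of \<open>K\<close>, so \<open>v\<close>
    inherits the period of \<open>x\<close>, and the power of \<pi> can be taken out of the
    trace.\<close>
  have vper: "(g ^^ (p ^ k)) v = v" using per gx[of "p ^ k"] u0 xv by (metis mult_left_cancel)
  have "(g ^^ l) v = (g ^^ (l mod p ^ k)) v" for l
  proof -
    have "(g ^^ (l mod p ^ k + p ^ k * (l div p ^ k))) v = (g ^^ (l mod p ^ k)) v"
      using funpow_fix_mult[OF vper] by (simp only: funpow_add o_apply)
    then show ?thesis by simp
  qed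
  then have "(\<Sum>l<p ^ (s - k) * p ^ k. (g ^^ l) v)
      = (\<Sum>l<p ^ (s - k) * p ^ k. (\<lambda>t j. (g ^^ j) v) (l div p ^ k) (l mod p ^ k))"
    by (intro sum.cong) auto
  also have "\<dots> = of_nat (p ^ (s - k)) * (\<Sum>j<p ^ k. (g ^^ j) v)"
    by (subst sum_div_mod) simp
  finally have "of_nat (p ^ (s - k)) * (\<Sum>j<p ^ k. (g ^^ j) v) = (\<Sum>l<q. (g ^^ l) v)"
    by (simp only: q_split[OF k])
  moreover obtain a where a: "a \<in> A" "(\<Sum>l<q. (g ^^ l) v) = of_nat q * a" by (rule trace_B[OF v])
  moreover have "(of_nat q :: 'b) = of_nat (p ^ (s - k)) * of_nat (p ^ k)"
    unfolding q_split[OF k, symmetric] by (rule of_nat_mult)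
  ultimately have "of_nat (p ^ (s - k)) * (\<Sum>j<p ^ k. (g ^^ j) v)
      = of_nat (p ^ (s - k)) * (of_nat (p ^ k) * a)" by (simp only: mult.assoc)
  moreover have "of_nat (p ^ (s - k)) \<noteq> (0 :: 'b)" using p_nonzero by simp
  ultimately have tr: "(\<Sum>j<p ^ k. (g ^^ j) v) = of_nat (p ^ k) * a" by (metis mult_left_cancel)
  obtain a' where a': "a' \<in> A" "of_nat p = (1 - z ^ q) ^ totient (p ^ r) * a'" by (rule prime_eq)
  have "(\<Sum>i<p ^ k. (g ^^ i) x) = ?u * (of_nat p ^ k * a)"
    by (simp add: gx tr flip: sum_distrib_left)
  also have "\<dots> = (1 - z ^ q) ^ (k * totient (p ^ r) + e) * (a' ^ k * a)"
    unfolding a'(2) by (simp add: power_mult_distrib power_add mult_ac flip: power_mult)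
  finally show ?thesis
    unfolding ideal_def by (rule image_eqI) (intro A.mult_mem A.power_mem a a')
qed

end

locale norm_expansion = cyclic_extension p r s A B K L z c g
  for p r s :: nat and A B K L :: "'b::field set" and z c :: 'b and g :: "'b \<Rightarrow> 'b" +
  fixes n :: nat and b :: "nat \<Rightarrow> 'b"
  assumes b_mem_B: "j < p ^ s \<Longrightarrow> b j \<in> B"
begin

lemmas b_mem = b_mem_B[folded q_def]

text \<open>The coordinates of d - 1; the value 0 from q onwards places the function in
  \<open>carrier D\<close>.\<close>

definition coef :: "nat \<Rightarrow> 'b" where
  "coef j = (if j < q then (1 - z) ^ n * b j else 0)"

lemma coef_B: "coef j \<in> B"
  unfolding coef_def using b_mem
  by (auto intro!: B.mult_mem B.power_mem B.diff_mem B.one_mem z_mem B.zero_mem)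

lemma coef_L: "coef j \<in> L" using coef_B B_subset_L by blast

lemma coef_carrier: "coef \<in> carrier D"
proof -
  have "coef j = 0" if "j \<ge> q" for j using that by (simp add: coef_def)
  then show ?thesis using coef_L by (simp add: carrier_D)
qed

text \<open>Conjugates of z are powers of z, and 1 - z divides 1 - z^e for every e; so conjugation
  does not lose the factor \<Pi>^n.\<close>

lemma funpow_coef:
  assumes "j < q"
  obtains y where "y \<in> B" "(g ^^ i) (coef j) = (1 - z) ^ n * y"
proof -
  have zL: "1 - z \<in> L" using z_mem_L by (intro L.diff_mem L.one_mem)
  have "(g ^^ i) (1 - z) = 1 - conj_z i"
    using funpow_add_hom[OF L.one_mem L.uminus_mem[OF z_mem_L], of i]
    by (simp add: funpow_one funpow_uminus_hom z_mem_L conj_z_def)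
  also have "\<dots> = (1 - z) * (\<Sum>j<(1 + p ^ r) ^ i. z ^ j)"
    unfolding conj_z_eq by (rule one_diff_power_eq)
  finally have "(g ^^ i) (coef j)
      = (1 - z) ^ n * ((\<Sum>j<(1 + p ^ r) ^ i. z ^ j) ^ n * (g ^^ i) (b j))"
    using assms b_mem[OF assms] B_subset_L zL
    by (auto simp: coef_def funpow_mult_hom L.power_mem funpow_power_hom power_mult_distrib)
  moreover have "(\<Sum>j<(1 + p ^ r) ^ i. z ^ j) ^ n * (g ^^ i) (b j) \<in> B"
    by (intro B.mult_mem B.power_mem B.sum_mem z_mem funpow_closed_B b_mem assms)
  ultimately show ?thesis by (rule that[rotated])
qed

section \<open>Minors of the regular representation and the action of g\<close>

definition minor :: "nat set \<times> (nat \<Rightarrow> nat) \<Rightarrow> 'b" where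
  "minor = (\<lambda>(S, \<sigma>). signof \<sigma> * (\<Prod>i\<in>S. rep coef $$ (i, \<sigma> i)))"

lemma minor_eq:
  assumes "(S, \<sigma>) \<in> partial_perms q"
  shows "minor (S, \<sigma>) = signof \<sigma> * (\<Prod>i\<in>S. (g ^^ i) (coef ((\<sigma> i + q - i) mod q)))
           * c ^ card {i \<in> S. \<sigma> i < i}"
proof -
  note S = partial_permsD[OF assms]
  have lt: "i < q \<and> \<sigma> i < q" if "i \<in> S" for i
    using that S permutes_in_image[OF S(2), of i] by auto
  have "(\<Prod>i\<in>S. rep coef $$ (i, \<sigma> i)) = (\<Prod>i\<in>S. (g ^^ i) (coef ((\<sigma> i + q - i) mod q))) *
      (\<Prod>i\<in>S. if \<sigma> i < i then c else 1)"
    using lt by (simp add: rep_index flip: prod.distrib)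
  also have "(\<Prod>i\<in>S. if \<sigma> i < i then c else 1) = c ^ card {i \<in> S. \<sigma> i < i}"
    using S(3) by (simp add: prod.inter_filter[symmetric])
  finally show ?thesis by (simp add: minor_def mult.assoc)
qed

lemma minor_mem:
  assumes "(S, \<sigma>) \<in> partial_perms q"
  obtains y where "y \<in> B" "minor (S, \<sigma>) = (1 - z) ^ (n * card S) * y"
proof -
  have "\<exists>y. y \<in> B \<and> (g ^^ i) (coef ((\<sigma> i + q - i) mod q)) = (1 - z) ^ n * y" for i
    using funpow_coef[OF mod_less_divisor[OF q_pos]] by metis
  then obtain y where y: "\<And>i. y i \<in> B"
    "\<And>i. (g ^^ i) (coef ((\<sigma> i + q - i) mod q)) = (1 - z) ^ n * y i" by metis
  have "minor (S, \<sigma>) = (1 - z) ^ (n * card S) * (signof \<sigma> * prod y S * c ^ card {i \<in> S. \<sigma> i < i})"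
    unfolding minor_eq[OF assms] y(2) by (simp add: prod.distrib power_mult mult_ac)
  moreover have "signof \<sigma> * prod y S * c ^ card {i \<in> S. \<sigma> i < i} \<in> B"
    using c_mem A_subset_B by (intro B.mult_mem B.of_int_mem B.prod_mem B.power_mem y) auto
  ultimately show ?thesis by (rule that[rotated])
qed

text \<open>Raising both indices by one applies \<open>g\<close> to an entry of
  \<open>rep coef\<close>, apart from factors \<open>c\<close> at the wrap-around. These balance
  over a whole permutation because rotation preserves the residues of \<sigma> i - i, which
  determine their number.\<close>

lemma minor_rotate:
  assumes "x \<in> partial_perms q"
  shows "minor (rotate_perm q x) = g (minor x)"
proof -
  obtain S \<sigma> where x: "x = (S, \<sigma>)" by (cases x)
  note x_mem = assms[unfolded x]
  note S = partial_permsD[OF x_mem]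
  define S' \<sigma>' where "S' = rot q ` S" and "\<sigma>' = rot q \<circ> \<sigma> \<circ> inv_into UNIV (rot q)"
  have Rx: "rotate_perm q x = (S', \<sigma>')" by (simp add: x rotate_perm_def S'_def \<sigma>'_def)
  have S'_mem: "(S', \<sigma>') \<in> partial_perms q" using rotate_perm_closed[OF assms] by (simp add: Rx)
  have sign: "sign \<sigma>' = sign \<sigma>" using sign_rotate_perm[OF assms] unfolding Rx by (simp add: x)
  have inj: "inj (rot q)" using bij_rot by (rule bij_is_inj)
  have \<sigma>': "\<sigma>' (rot q i) = rot q (\<sigma> i)" for i by (simp add: \<sigma>'_def inj)
  have lt: "i < q" "\<sigma> i < q" if "i \<in> S" for i
    using that S permutes_in_image[OF S(2), of i] by auto
  have diff: "(rot q (\<sigma> i) + q - rot q i) mod q = (\<sigma> i + q - i) mod q" if "i \<in> S" for i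
    using lt[OF that] by (auto simp: rot_def cyclic_diff_eq)
  have "q * card {i \<in> S'. \<sigma>' i < i} = (\<Sum>i\<in>S'. (\<sigma>' i + q - i) mod q)"
    by (rule sum_cyclic_diff[OF S'_mem, symmetric])
  also have "\<dots> = (\<Sum>i\<in>S. (\<sigma> i + q - i) mod q)"
    unfolding S'_def using inj_on_subset[OF inj subset_UNIV] by (subst sum.reindex) (auto simp: \<sigma>' diff)
  also have "\<dots> = q * card {i \<in> S. \<sigma> i < i}" by (rule sum_cyclic_diff[OF x_mem])
  finally have card: "card {i \<in> S'. \<sigma>' i < i} = card {i \<in> S. \<sigma> i < i}" using q_pos by simp
  have "(\<Prod>i\<in>S'. (g ^^ i) (coef ((\<sigma>' i + q - i) mod q)))
      = (\<Prod>i\<in>S. (g ^^ rot q i) (coef ((\<sigma> i + q - i) mod q)))"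
    unfolding S'_def using inj_on_subset[OF inj subset_UNIV] by (subst prod.reindex) (auto simp: \<sigma>' diff)
  also have "\<dots> = (\<Prod>i\<in>S. (g ^^ 1) ((g ^^ i) (coef ((\<sigma> i + q - i) mod q))))"
  proof (rule prod.cong[OF refl])
    fix i assume "i \<in> S"
    \<comment> \<open>The only critical index is q - 1, which rotates to 0; there \<open>g\<close>
      to the power q is the identity on \<open>L\<close>.\<close>
    then have "(g ^^ rot q i) y = (g ^^ Suc i) y" if "y \<in> L" for y
    proof (cases "Suc i = q")
      case True
      have "(g ^^ Suc i) y = y" unfolding True by (rule funpow_q[OF that])
      then show ?thesis using True \<open>i \<in> S\<close> lt[of i] by (simp add: rot_def)
    qed (use \<open>i \<in> S\<close> lt[of i] in \<open>simp add: rot_def\<close>)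
    then show "(g ^^ rot q i) (coef ((\<sigma> i + q - i) mod q))
        = (g ^^ 1) ((g ^^ i) (coef ((\<sigma> i + q - i) mod q)))" using coef_L by simp
  qed
  also have "\<dots> = (g ^^ 1) (\<Prod>i\<in>S. (g ^^ i) (coef ((\<sigma> i + q - i) mod q)))"
    by (intro funpow_prod_hom[symmetric] funpow_closed coef_L)
  finally have prod: "(\<Prod>i\<in>S'. (g ^^ i) (coef ((\<sigma>' i + q - i) mod q)))
      = g (\<Prod>i\<in>S. (g ^^ i) (coef ((\<sigma> i + q - i) mod q)))" by simp
  let ?P = "\<Prod>i\<in>S. (g ^^ i) (coef ((\<sigma> i + q - i) mod q))"
  have PL: "?P \<in> L" by (intro L.prod_mem funpow_closed coef_L)
  have sK: "signof \<sigma> \<in> K" by (rule K.of_int_mem)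
  have cK: "c ^ card {i \<in> S. \<sigma> i < i} \<in> K" by (intro K.power_mem c_mem_K)
  have "minor (rotate_perm q x) = signof \<sigma> * g ?P * c ^ card {i \<in> S. \<sigma> i < i}"
    unfolding Rx minor_eq[OF S'_mem] prod card sign ..
  also have "\<dots> = g (signof \<sigma> * ?P * c ^ card {i \<in> S. \<sigma> i < i})"
    using PL sK cK K_subset_L by (auto simp: g_mult g_fixes L.mult_mem subset_iff)
  finally show ?thesis unfolding x minor_eq[OF x_mem] .
qed

lemma minor_rotate_pow:
  "x \<in> partial_perms q \<Longrightarrow> minor ((rotate_perm q ^^ i) x) = (g ^^ i) (minor x)"
  by (induction i) (auto simp: minor_rotate rotate_perm_pow_closed)

text \<open>\<open>N\<close> is a lower bound for the number of cosets forming S. Then n card S is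
  at least q times the floor of n N / p^k, and the excess of the exponent over this multiple of q is
  absorbed by the cofactor.\<close>

lemma orbit_sum_mem:
  assumes x: "x \<in> partial_perms q" and k: "k \<le> s" and per: "(rotate_perm q ^^ (p ^ k)) x = x"
    and N: "N * p ^ (s - k) \<le> card (fst x)"
  shows "(\<Sum>i<p ^ k. minor ((rotate_perm q ^^ i) x)) \<in> ideal (k * totient (p ^ r) + n * N div p ^ k)"
proof -
  obtain S \<sigma> where S: "x = (S, \<sigma>)" by (cases x)
  obtain y where y: "y \<in> B" "minor x = (1 - z) ^ (n * card S) * y"
    using minor_mem x unfolding S by blast
  let ?e = "n * N div p ^ k"
  have "q * ?e = p ^ (s - k) * (p ^ k * ?e)" unfolding q_split[OF k, symmetric] by (rule mult.assoc)
  also have "\<dots> \<le> p ^ (s - k) * (n * N)" by (intro mult_le_mono2) simp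
  also have "\<dots> \<le> n * card S" using N mult_le_mono2[of _ _ n] by (simp add: S mult_ac)
  finally have "(1 - z) ^ (n * card S) * y = (1 - z) ^ (q * ?e) * ((1 - z) ^ (n * card S - q * ?e) * y)"
    by (simp flip: power_add mult.assoc)
  then have "minor x = (1 - z) ^ (q * ?e) * ((1 - z) ^ (n * card S - q * ?e) * y)"
    using y(2) by simp
  moreover have "(1 - z) ^ (n * card S - q * ?e) * y \<in> B"
    by (intro B.mult_mem B.power_mem B.diff_mem B.one_mem z_mem y)
  moreover have "(g ^^ (p ^ k)) (minor x) = minor x"
    using minor_rotate_pow[OF x, of "p ^ k"] per by simp
  ultimately have "(\<Sum>i<p ^ k. (g ^^ i) (minor x)) \<in> ideal (k * totient (p ^ r) + ?e)"
    using partial_trace_mem[OF k] by blast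
  then show ?thesis using minor_rotate_pow[OF x] by simp
qed

text \<open>The orbit of x under rotation has length p to the power \<open>level x\<close>.\<close>

definition level :: "nat set \<times> (nat \<Rightarrow> nat) \<Rightarrow> nat" where
  "level x = (LEAST k. (rotate_perm q ^^ (p ^ k)) x = x)"

lemma level: "(rotate_perm q ^^ (p ^ level x)) x = x" "level x \<le> s"
  "j < level x \<Longrightarrow> (rotate_perm q ^^ (p ^ j)) x \<noteq> x"
proof -
  have q: "(rotate_perm q ^^ (p ^ s)) x = x" using rotate_perm_pow_N[of q x] by (simp add: q_def)
  show "(rotate_perm q ^^ (p ^ level x)) x = x" unfolding level_def by (rule LeastI[of _ s]) (rule q)
  show "level x \<le> s" unfolding level_def by (rule Least_le) (rule q)
  show "(rotate_perm q ^^ (p ^ j)) x \<noteq> x" if "j < level x"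
    using not_less_Least[OF that[unfolded level_def]] .
qed

lemma level_eqI:
  assumes "(rotate_perm q ^^ (p ^ k)) x = x" "\<And>j. j < k \<Longrightarrow> (rotate_perm q ^^ (p ^ j)) x \<noteq> x"
  shows "level x = k"
  using level(1)[of x] level(3)[of k x] assms by (metis nat_neq_iff)

lemma level_rotate: "level ((rotate_perm q ^^ i) x) = level x"
  unfolding level_def rotate_perm_fix_iff ..

text \<open>Pairs whose orbit has length p^k. The empty index set is excluded because it contributes
  the 1 in nr(d) - 1.\<close>

definition orbits :: "nat \<Rightarrow> (nat set \<times> (nat \<Rightarrow> nat)) set" where
  "orbits k = {x \<in> partial_perms q. fst x \<noteq> {} \<and> level x = k}"

lemma finite_orbits: "finite (orbits k)"
  unfolding orbits_def using finite_partial_perms by simp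

lemma rotate_orbits: "x \<in> orbits k \<Longrightarrow> rotate_perm q x \<in> orbits k"
  using level_rotate[of 1 x] rotate_perm_closed[of x q] card_rotate_perm[of q x]
  by (auto simp: orbits_def) (auto simp: rotate_perm_def split_def)

lemma rotate_pow_orbits: "x \<in> orbits k \<Longrightarrow> (rotate_perm q ^^ i) x \<in> orbits k"
  by (induction i) (auto intro: rotate_orbits)

text \<open>The cardinality is a nonzero multiple of p^(s-k), so when it is not p^(s-k) itself it is
  at least twice as large.\<close>

lemma orbits_card:
  assumes "x \<in> orbits k" "card (fst x) \<noteq> p ^ (s - k)"
  shows "2 * p ^ (s - k) \<le> card (fst x)"
proof -
  obtain S \<sigma> where x: "x = (S, \<sigma>)" by (cases x)
  have k: "k \<le> s" using assms level(2)[of x] by (simp add: orbits_def)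
  have mem: "(S, \<sigma>) \<in> partial_perms q" and ne: "S \<noteq> {}" using assms by (auto simp: orbits_def x)
  note S = partial_permsD[OF mem]
  have "(rotate_perm q ^^ (p ^ k)) (S, \<sigma>) = (S, \<sigma>)" using assms level(1)[of x] by (simp add: orbits_def x)
  from rotate_perm_fixD(1)[OF this] have "(i + p ^ k) mod q \<in> S" if i: "i \<in> S" for i
    using i S(1) rot_pow[of i q "p ^ k"] by (metis imageI lessThan_iff subsetD)
  then have "card S = p ^ (s - k) * card ((\<lambda>i. i mod p ^ k) ` S)"
    using S(1) prime_gt_0_nat[OF p(1)] by (intro card_translation_stable(1)) (simp_all add: q_split[OF k])
  moreover have "card ((\<lambda>i. i mod p ^ k) ` S) \<noteq> 0" using ne S(3) by simp
  moreover have "card ((\<lambda>i. i mod p ^ k) ` S) \<noteq> 1" using calculation(1) assms(2) by (auto simp: x)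
  ultimately show ?thesis by (simp add: x)
qed

text \<open>Every orbit here has length exactly p^k, so the orbit sums can be estimated one by one.
  The bound is that of m = 2, since larger m only increase the exponent.\<close>

lemma large_orbits_sum:
  assumes k: "k \<le> s"
  shows "(\<Sum>x | x \<in> orbits k \<and> card (fst x) \<noteq> p ^ (s - k). minor x)
           \<in> ideal (k * totient (p ^ r) + n * 2 div p ^ k)"
proof (rule sum_over_orbits[where R = "rotate_perm q" and N = "p ^ k"])
  show "finite {x. x \<in> orbits k \<and> card (fst x) \<noteq> p ^ (s - k)}" using finite_orbits by simp
next
  fix x assume x: "x \<in> {x. x \<in> orbits k \<and> card (fst x) \<noteq> p ^ (s - k)}"
  then have lev: "level x = k" by (simp add: orbits_def)
  show "rotate_perm q x \<in> {x. x \<in> orbits k \<and> card (fst x) \<noteq> p ^ (s - k)}"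
    using x by (simp add: rotate_orbits card_rotate_perm)
  show per: "(rotate_perm q ^^ (p ^ k)) x = x" using level(1)[of x] lev by simp
  show "(rotate_perm q ^^ i) x \<noteq> x" if "0 < i" "i < p ^ k" for i
  proof (rule prime_power_least_period[OF p(1) per _ that])
    show "(rotate_perm q ^^ (p ^ j)) x \<noteq> x" if "j < k" for j
      using level(3)[of j x] lev that by simp
  qed
  show "(\<Sum>i<p ^ k. minor ((rotate_perm q ^^ i) x)) \<in> ideal (k * totient (p ^ r) + n * 2 div p ^ k)"
    using x orbits_card[of x k] by (intro orbit_sum_mem k per) (auto simp: orbits_def)
qed (use prime_gt_0_nat[OF p(1)] in \<open>auto intro: ideal_zero ideal_add\<close>)

abbreviation coset :: "nat \<Rightarrow> nat \<Rightarrow> nat set \<times> (nat \<Rightarrow> nat)" where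
  "coset k v \<equiv> coset_perm (p ^ (s - k)) (p ^ k) v"

lemma pp_pos: "p ^ k > 0" using prime_gt_0_nat[OF p(1)] by simp

section \<open>Orbits of single cosets and the norm terms\<close>

lemma coset_orbits:
  assumes k: "k \<le> s" shows "coset k v \<in> orbits k"
proof -
  note q = q_split[OF k]
  have "level (coset k v) = k"
  proof (rule level_eqI)
    show "(rotate_perm q ^^ (p ^ k)) (coset k v) = coset k v"
      using coset_perm_fix[OF pp_pos[of "s - k"] pp_pos[of k], of v] by (simp only: q)
    show "(rotate_perm q ^^ (p ^ j)) (coset k v) \<noteq> coset k v" if "j < k" for j
    proof -
      have "p ^ j < p ^ k" using that prime_gt_1_nat[OF p(1)] by (intro power_strict_increasing)
      then show ?thesis
        using coset_perm_period[OF pp_pos[of "s - k"] pp_pos[of k], of "p ^ j" v] pp_pos[of j]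
        unfolding q by blast
    qed
  qed
  moreover have "0 \<in> fst (coset k v)" using prime_gt_0_nat[OF p(1)] by (simp add: coset_perm_def)
  ultimately show ?thesis
    using coset_perm_mem[OF pp_pos[of "s - k"] pp_pos[of k], of v] by (auto simp: orbits_def q)
qed

lemma coset_card: "card (fst (coset k v)) = p ^ (s - k)"
  using card_subgroup[OF pp_pos[of "s - k"] pp_pos[of k]] by (simp add: coset_perm_def)

text \<open>Each orbit with m = 1 contains exactly one pair whose index set contains 0, that is, one
  \<open>coset k v\<close>; the pairs (v, i) enumerate all members without repetition.\<close>

lemma small_orbits_sum:
  assumes k: "k \<le> s"
  shows "(\<Sum>x | x \<in> orbits k \<and> card (fst x) = p ^ (s - k). minor x)
      = (\<Sum>v<p ^ (s - k). \<Sum>i<p ^ k. (g ^^ i) (minor (coset k v)))"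
proof -
  note q = q_split[OF k]
  let ?R = "\<lambda>(v, i). (rotate_perm q ^^ i) (coset k v)"
  let ?I = "{..<p ^ (s - k)} \<times> {..<p ^ k}"
  let ?Q = "{x. x \<in> orbits k \<and> card (fst x) = p ^ (s - k)}"
  have inj: "inj_on ?R ?I"
  proof (rule inj_onI)
    fix x y assume xy: "x \<in> ?I" "y \<in> ?I" "?R x = ?R y"
    obtain v i w j where vi: "x = (v, i)" "y = (w, j)" by (cases x, cases y)
    show "x = y"
      using coset_perm_rotate_inj[OF pp_pos[of "s - k"] pp_pos[of k], of i v j w] xy
      by (simp add: q vi)
  qed
  have "?R ` ?I = ?Q"
  proof (intro subset_antisym subsetI)
    fix x assume "x \<in> ?R ` ?I"
    then show "x \<in> ?Q"
      using rotate_pow_orbits[OF coset_orbits[OF k]] by (auto simp: card_rotate_perm_pow coset_card)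
  next
    fix x assume x: "x \<in> ?Q"
    obtain S \<sigma> where S: "x = (S, \<sigma>)" by (cases x)
    have mem: "(S, \<sigma>) \<in> partial_perms q" "S \<noteq> {}" using x by (auto simp: S orbits_def)
    then obtain i where i: "i \<in> S" "i < q" using partial_permsD(1)[OF mem(1)] by blast
    \<comment> \<open>Rotating by q - i moves the chosen element i of S to 0, which normalises the
      pair.\<close>
    obtain S' \<sigma>' where y: "(rotate_perm q ^^ (q - i)) x = (S', \<sigma>')" by fastforce
    have y_orb: "(S', \<sigma>') \<in> orbits k" using rotate_pow_orbits[of x k "q - i"] x y by simp
    have "(rot q ^^ (q - i)) i = 0" using i by (simp add: rot_pow)
    then have "0 \<in> S'" using y i by (auto simp: S rotate_perm_pow intro: image_eqI[of _ _ i])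
    moreover have "card S' = p ^ (s - k)"
      using card_rotate_perm_pow[of "q - i" q x] x y by simp
    moreover have "(rotate_perm q ^^ (p ^ k)) (S', \<sigma>') = (S', \<sigma>')"
      using y_orb level(1)[of "(S', \<sigma>')"] by (simp add: orbits_def)
    ultimately obtain v where v: "v < p ^ (s - k)" "(S', \<sigma>') = coset k v"
      using coset_perm_unique[OF pp_pos[of "s - k"] pp_pos[of k], of S' \<sigma>'] y_orb by (auto simp: q orbits_def)
    have "x = (rotate_perm q ^^ (i + (q - i))) x" using i rotate_perm_pow_N[of q x] by simp
    also have "\<dots> = (rotate_perm q ^^ i) (coset k v)" by (simp only: funpow_add o_apply y v(2))
    \<comment> \<open>The normalised pair has period p^k, so only the residue of i matters.\<close>
    also have "\<dots> = (rotate_perm q ^^ (i mod p ^ k + p ^ k * (i div p ^ k))) (coset k v)" by simp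
    also have "\<dots> = (rotate_perm q ^^ (i mod p ^ k)) (coset k v)"
      using coset_perm_fix[OF pp_pos[of "s - k"] pp_pos[of k], of v] unfolding q
      by (simp only: funpow_add o_apply funpow_fix_mult)
    finally show "x \<in> ?R ` ?I" using v(1) pp_pos by (intro image_eqI[of _ _ "(v, i mod p ^ k)"]) auto
  qed
  then have "sum minor ?Q = sum minor (?R ` ?I)" by (rule arg_cong[of _ _ "sum minor", OF sym])
  also have "\<dots> = (\<Sum>y\<in>?I. minor (?R y))" unfolding sum.reindex[OF inj] by (simp only: o_def)
  also have "\<dots> = (\<Sum>v<p ^ (s - k). \<Sum>i<p ^ k. minor ((rotate_perm q ^^ i) (coset k v)))"
    by (simp add: sum.cartesian_product split_def)
  also have "\<dots> = (\<Sum>v<p ^ (s - k). \<Sum>i<p ^ k. (g ^^ i) (minor (coset k v)))"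
    using coset_orbits[OF k] by (simp add: minor_rotate_pow orbits_def)
  finally show ?thesis .
qed

text \<open>The term (1 + T)^v Tr(N(\<Pi>^n b)) of the theorem, with norm and trace spelled out as
  products and sums over powers of \<open>g\<close> instead of subgroups and cosets.\<close>

definition norm_term :: "nat \<Rightarrow> nat \<Rightarrow> 'b" where
  "norm_term k v = c ^ v * (\<Sum>i<p ^ k. (g ^^ i) (\<Prod>j<p ^ (s - k). (g ^^ (j * p ^ k)) (coef (p ^ k * v))))"

lemma minor_coset:
  assumes k: "k \<le> s" and v: "v < p ^ (s - k)"
  shows "minor (coset k v) = c ^ v * (\<Prod>j<p ^ (s - k). (g ^^ (j * p ^ k)) (coef (p ^ k * v)))"
proof -
  note q = q_split[OF k]
  let ?S = "fst (coset k v)" and ?\<sigma> = "snd (coset k v)"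
  have mem: "(?S, ?\<sigma>) \<in> partial_perms q"
    using coset_perm_mem[OF pp_pos[of "s - k"] pp_pos[of k], of v] by (simp add: q)
  have sign: "sign ?\<sigma> = 1" using p(2) by (intro sign_coset_perm pp_pos) simp
  have carries: "card {i \<in> ?S. ?\<sigma> i < i} = v" by (rule coset_perm_carries[OF pp_pos pp_pos v])
  have diff: "(?\<sigma> i + q - i) mod q = p ^ k * v" if "i \<in> ?S" for i
    using coset_perm_diff[OF pp_pos pp_pos v that] by (simp only: q)
  have S: "?S = (\<lambda>j. j * p ^ k) ` {..<p ^ (s - k)}"
    using subgroup_eq_image[OF pp_pos[of "s - k"] pp_pos[of k]] by (simp add: coset_perm_def)
  have "minor (coset k v) = (\<Prod>i\<in>?S. (g ^^ i) (coef (p ^ k * v))) * c ^ v"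
    using minor_eq[OF mem] diff by (simp add: sign carries)
  also have "(\<Prod>i\<in>?S. (g ^^ i) (coef (p ^ k * v)))
      = (\<Prod>j<p ^ (s - k). (g ^^ (j * p ^ k)) (coef (p ^ k * v)))"
    unfolding S using pp_pos[of k] by (subst prod.reindex) (auto simp: inj_on_def)
  finally show ?thesis by (simp only: mult.commute)
qed

lemma norm_term_eq:
  assumes k: "k \<le> s" and v: "v < p ^ (s - k)"
  shows "norm_term k v = (\<Sum>i<p ^ k. (g ^^ i) (minor (coset k v)))"
proof -
  let ?N = "\<Prod>j<p ^ (s - k). (g ^^ (j * p ^ k)) (coef (p ^ k * v))"
  have "?N \<in> L" by (intro L.prod_mem funpow_closed coef_L)
  moreover have "c ^ v \<in> K" by (intro K.power_mem c_mem_K)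
  ultimately have "(g ^^ i) (c ^ v * ?N) = c ^ v * (g ^^ i) ?N" for i
    using K_subset_L by (subst funpow_mult_hom) (auto simp: funpow_fixes)
  then show ?thesis unfolding norm_term_def minor_coset[OF k v] by (simp add: sum_distrib_left)
qed

lemma norm_term_mem:
  assumes k: "k \<le> s" and v: "v < p ^ (s - k)"
  shows "norm_term k v \<in> ideal (k * totient (p ^ r) + n div p ^ k)"
proof -
  have orb: "coset k v \<in> orbits k" by (rule coset_orbits[OF k])
  then have "coset k v \<in> partial_perms q" "level (coset k v) = k" by (auto simp: orbits_def)
  then show ?thesis
    using orbit_sum_mem[of "coset k v" k 1] level(1)[of "coset k v"] k
    by (simp add: coset_card norm_term_eq[OF k v] minor_rotate_pow)
qed

text \<open>An exact identity, prior to any comparison of exponents: the empty index set gives 1,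
  single cosets give the norm terms, and all remaining pairs of level k form
  \<open>E k\<close>.\<close>

theorem det_congruence:
  obtains E where "\<And>k. k \<le> s \<Longrightarrow> E k \<in> ideal (k * totient (p ^ r) + n * 2 div p ^ k)"
    "det (rep (\<lambda>j. (if j = 0 then 1 else 0) + coef j)) - 1
       = (\<Sum>k\<le>s. (\<Sum>v<p ^ (s - k). norm_term k v) + E k)"
proof -
  let ?one = "\<lambda>j::nat. if j = 0 then 1 else (0::'b)"
  let ?E = "\<lambda>k. \<Sum>x | x \<in> orbits k \<and> card (fst x) \<noteq> p ^ (s - k). minor x"
  have one: "cyclic_embed 1 = ?one" by (auto simp: cyclic_embed_def)
  have one_mem: "?one \<in> carrier D" unfolding one[symmetric] by (rule cyclic_embed_closed[OF L.one_mem])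
  have "rep (\<lambda>j. ?one j + coef j) = rep ?one + rep coef"
    using rep_add[OF one_mem coef_carrier] by (simp add: D_ops(3))
  also have "rep ?one = 1\<^sub>m q" using rep_scalar[OF K.one_mem] by (auto simp: one intro!: eq_matI)
  finally have "det (rep (\<lambda>j. ?one j + coef j)) = (\<Sum>x\<in>partial_perms q. minor x)"
    by (simp add: det_one_plus[OF rep_carrier] minor_def)
  also have "\<dots> = (\<Sum>x | x \<in> partial_perms q \<and> fst x = {}. minor x)
      + (\<Sum>x | x \<in> partial_perms q \<and> fst x \<noteq> {}. minor x)"
    using finite_partial_perms by (subst sum.union_disjoint[symmetric]) (auto intro!: sum.cong)
  also have "{x. x \<in> partial_perms q \<and> fst x = {}} = {({}, id)}"
    by (auto simp: partial_perms_def)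
  also have "(\<Sum>x\<in>{({}, id)}. minor x) = 1" by (simp add: minor_def)
  also have "(\<Sum>x | x \<in> partial_perms q \<and> fst x \<noteq> {}. minor x)
      = (\<Sum>k\<le>s. \<Sum>x | x \<in> {x. x \<in> partial_perms q \<and> fst x \<noteq> {}} \<and> level x = k. minor x)"
    using finite_partial_perms level(2) by (intro sum.group[symmetric]) auto
  also have "\<dots> = (\<Sum>k\<le>s. sum minor (orbits k))"
    by (intro sum.cong refl) (auto simp: orbits_def intro!: sum.cong)
  also have "\<dots> = (\<Sum>k\<le>s. (\<Sum>v<p ^ (s - k). norm_term k v) + ?E k)"
  proof (rule sum.cong[OF refl])
    fix k assume "k \<in> {..s}"
    then have k: "k \<le> s" by simp
    have "sum minor (orbits k) = (\<Sum>x | x \<in> orbits k \<and> card (fst x) = p ^ (s - k). minor x) + ?E k"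
      using finite_orbits by (subst sum.union_disjoint[symmetric]) (auto intro!: sum.cong)
    then show "sum minor (orbits k) = (\<Sum>v<p ^ (s - k). norm_term k v) + ?E k"
      using norm_term_eq[OF k] by (simp add: small_orbits_sum[OF k])
  qed
  finally show ?thesis using large_orbits_sum by (intro that[of ?E]) simp_all
qed

end

section \<open>The Galois group\<close>

locale cyclic_galois = cyclic_extension p r s A B K L z c g
  for p r s :: nat and A B K L :: "'b::field set" and z c :: 'b and g :: "'b \<Rightarrow> 'b" +
  assumes g_Bij: "g \<in> Bij L"
begin

abbreviation G :: "('b \<Rightarrow> 'b) monoid" where "G \<equiv> galois_group L K"

text \<open>Members of \<open>BijGroup\<close> are extensional, so iterates of \<open>g\<close> have
  to be restricted to \<open>L\<close> before they can be group elements.\<close>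

definition \<gamma> :: "nat \<Rightarrow> 'b \<Rightarrow> 'b" where "\<gamma> i = restrict (g ^^ i) L"

lemma \<gamma>_apply: "x \<in> L \<Longrightarrow> \<gamma> i x = (g ^^ i) x" by (simp add: \<gamma>_def)

lemma compose_\<gamma>: "compose L (\<gamma> i) (\<gamma> j) = \<gamma> (i + j)"
  by (rule ext) (simp add: compose_def \<gamma>_def funpow_closed funpow_add)

lemma \<gamma>_1: "\<gamma> (Suc 0) = g"
  using Bij_imp_extensional[OF g_Bij] by (simp add: \<gamma>_def extensional_restrict)

lemma \<gamma>_Bij: "\<gamma> i \<in> Bij L"
proof (induction i)
  case 0
  have id: "\<gamma> 0 = (\<lambda>x\<in>L. x)" by (auto simp: \<gamma>_def restrict_def)
  show ?case unfolding id by (rule id_Bij)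
next
  case (Suc i)
  then show ?case using compose_Bij[OF g_Bij Suc] compose_\<gamma>[of "Suc 0" i] by (simp add: \<gamma>_1)
qed

lemma \<gamma>_cong: "[i = j] (mod q) \<Longrightarrow> \<gamma> i = \<gamma> j"
  using funpow_mod_q[of _ i] funpow_mod_q[of _ j] by (auto simp: \<gamma>_def cong_def)

lemma \<gamma>_inj: "\<gamma> i = \<gamma> j \<Longrightarrow> [i = j] (mod q)"
  using \<gamma>_apply[OF z_mem_L] conj_z_eq_iff by (metis conj_z_def)

lemma carrier_G_iff: "h \<in> carrier G \<longleftrightarrow> h \<in> Bij L \<and>
    (\<forall>x\<in>L. \<forall>y\<in>L. h (x + y) = h x + h y \<and> h (x * y) = h x * h y) \<and> (\<forall>x\<in>K. h x = x)"
  by (simp add: galois_group_def)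

lemma \<gamma>_mem: "\<gamma> i \<in> carrier G"
  unfolding carrier_G_iff using \<gamma>_Bij K_subset_L
  by (auto simp: \<gamma>_apply L.add_mem L.mult_mem funpow_add_hom funpow_mult_hom funpow_fixes)

text \<open>The q conjugates are distinct solutions, and a polynomial of degree at most q leaves no
  room for others in the ambient field.\<close>

lemma roots_eq: "{x. x ^ q = z ^ q} = conj_z ` {..<q}"
proof (rule sym, rule card_seteq)
  let ?P = "monom 1 q - [:z ^ q:]"
  have roots: "{x. x ^ q = z ^ q} = {x. poly ?P x = 0}" by (auto simp: poly_monom)
  have "coeff ?P q = 1" using q_pos by (cases q) (auto simp: coeff_pCons)
  then have ne: "?P \<noteq> 0" by (metis coeff_0 zero_neq_one)
  show "finite {x. x ^ q = z ^ q}" unfolding roots by (rule poly_roots_finite[OF ne])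
  show "conj_z ` {..<q} \<subseteq> {x. x ^ q = z ^ q}" by (auto simp: conj_z_power_q)
  have "card {x. x ^ q = z ^ q} \<le> degree ?P" unfolding roots by (rule card_poly_roots_bound[OF ne])
  also have "\<dots> \<le> q" by (intro degree_diff_le degree_monom_le) simp
  also have "q = card (conj_z ` {..<q})" using conj_z_inj by (subst card_image) (auto simp: inj_on_def)
  finally show "card {x. x ^ q = z ^ q} \<le> card (conj_z ` {..<q})" .
qed

text \<open>An automorphism over \<open>K\<close> sends z to a solution of x^q = z^q, hence to a
  conjugate, and its value at z determines it because every element of \<open>L\<close> has
  coordinates in \<open>K\<close> with respect to powers of z.\<close>

lemma carrier_G: "carrier G = \<gamma> ` {..<q}"
proof (intro subset_antisym subsetI)
  fix h assume "h \<in> carrier G"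
  then have h: "h \<in> Bij L" and add: "\<And>x y. x \<in> L \<Longrightarrow> y \<in> L \<Longrightarrow> h (x + y) = h x + h y"
    and mult: "\<And>x y. x \<in> L \<Longrightarrow> y \<in> L \<Longrightarrow> h (x * y) = h x * h y" and fixes_K: "\<And>x. x \<in> K \<Longrightarrow> h x = x"
    by (auto simp: carrier_G_iff)
  have pow: "h (z ^ k) = h z ^ k" for k
    by (induction k) (auto simp: fixes_K K.one_mem mult z_mem_L L.power_mem)
  have "h z ^ q = z ^ q"
    using pow[of q] fixes_K[of "z ^ q"] z_power_q_mem A_subset_K by auto
  then have "h z \<in> conj_z ` {..<q}" using roots_eq by blast
  then obtain i where i: "i < q" "h z = conj_z i" by auto
  have sum: "h (sum f I) = (\<Sum>x\<in>I. h (f x))" if "finite I" "\<And>x. x \<in> I \<Longrightarrow> f x \<in> L" for f and I :: "nat set"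
    using that by (induction I) (auto simp: fixes_K K.zero_mem add L.sum_mem)
  have "h x = \<gamma> i x" for x
  proof (cases "x \<in> L")
    case True
    obtain a where a: "\<forall>t. a t \<in> K" "x = (\<Sum>t<q. a t * z ^ t)" using L_expansion[OF True] by blast
    have aL: "a t \<in> L" for t using a(1) K_subset_L by blast
    have "h x = (\<Sum>t<q. h (a t * z ^ t))"
      unfolding a(2) by (intro sum) (auto intro: L.mult_mem L.power_mem z_mem_L aL)
    also have "\<dots> = (\<Sum>t<q. a t * conj_z i ^ t)"
      using a(1) by (intro sum.cong refl) (simp add: mult aL L.power_mem z_mem_L pow i fixes_K)
    also have "\<dots> = (g ^^ i) x" unfolding a(2) using a(1) by (intro conj_expansion[symmetric]) simp
    finally show ?thesis using True by (simp add: \<gamma>_apply)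
  next
    case False
    then show ?thesis using Bij_imp_extensional[OF h] by (simp add: \<gamma>_def extensional_def)
  qed
  then show "h \<in> \<gamma> ` {..<q}" using i by auto
qed (use \<gamma>_mem in auto)

lemma mult_G: "\<gamma> i \<otimes>\<^bsub>G\<^esub> \<gamma> j = \<gamma> (i + j)"
  using \<gamma>_Bij by (simp add: galois_group_def BijGroup_def compose_\<gamma>)

lemma one_G: "\<one>\<^bsub>G\<^esub> = \<gamma> 0"
  by (simp add: galois_group_def BijGroup_def \<gamma>_def id_def)

lemma group_G: "group G"
proof (rule groupI)
  fix x assume "x \<in> carrier G"
  then obtain i where i: "i < q" "x = \<gamma> i" unfolding carrier_G by auto
  show "\<one>\<^bsub>G\<^esub> \<otimes>\<^bsub>G\<^esub> x = x" unfolding i one_G mult_G by simp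
  have "\<gamma> (q - i) \<otimes>\<^bsub>G\<^esub> x = \<gamma> 0" unfolding i mult_G using i by (intro \<gamma>_cong) (simp add: cong_def)
  then show "\<exists>y\<in>carrier G. y \<otimes>\<^bsub>G\<^esub> x = \<one>\<^bsub>G\<^esub>" unfolding one_G by (intro bexI[of _ "\<gamma> (q - i)"] \<gamma>_mem)
next
  fix x y assume "x \<in> carrier G" "y \<in> carrier G"
  then obtain i j where ij: "x = \<gamma> i" "y = \<gamma> j" unfolding carrier_G by auto
  show "x \<otimes>\<^bsub>G\<^esub> y \<in> carrier G" unfolding ij mult_G by (rule \<gamma>_mem)
  fix w assume "w \<in> carrier G"
  then obtain l where l: "w = \<gamma> l" unfolding carrier_G by auto
  show "x \<otimes>\<^bsub>G\<^esub> y \<otimes>\<^bsub>G\<^esub> w = x \<otimes>\<^bsub>G\<^esub> (y \<otimes>\<^bsub>G\<^esub> w)" unfolding ij l mult_G by (simp add: add.assoc)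
qed (simp add: one_G \<gamma>_mem)

sublocale G: group G by (rule group_G)

lemma pow_G: "\<gamma> i [^]\<^bsub>G\<^esub> (k::nat) = \<gamma> (i * k)"
  by (induction k) (simp_all add: one_G mult_G add.commute)

definition H :: "nat \<Rightarrow> ('b \<Rightarrow> 'b) set" where
  "H k = generate G {g [^]\<^bsub>G\<^esub> (p ^ k)}"

text \<open>In a finite group the powers with natural exponents already form a subgroup.\<close>

lemma H_eq: "H k = range (\<lambda>j. \<gamma> (j * p ^ k))"
proof -
  have g_pow: "g [^]\<^bsub>G\<^esub> (p ^ k) = \<gamma> (p ^ k)" using pow_G[of "Suc 0" "p ^ k"] by (simp add: \<gamma>_1)
  have "finite (carrier G)" unfolding carrier_G by simp
  then have "H k = {\<gamma> (p ^ k) [^]\<^bsub>G\<^esub> j |j. j \<in> (UNIV :: nat set)}"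
    unfolding H_def g_pow by (rule G.generate_pow_on_finite_carrier[OF _ \<gamma>_mem])
  then show ?thesis by (auto simp: pow_G mult.commute)
qed

lemma H_finite:
  assumes "k \<le> s"
  shows "H k = (\<lambda>j. \<gamma> (j * p ^ k)) ` {..<p ^ (s - k)}"
proof -
  have "\<gamma> (j * p ^ k) = \<gamma> ((j mod p ^ (s - k)) * p ^ k)" for j
  proof (rule \<gamma>_cong)
    have "j * p ^ k = (j mod p ^ (s - k) + (j div p ^ (s - k)) * p ^ (s - k)) * p ^ k"
      by (simp only: mod_div_mult_eq)
    also have "\<dots> = (j mod p ^ (s - k)) * p ^ k + (j div p ^ (s - k)) * (p ^ (s - k) * p ^ k)"
      by (simp only: distrib_right mult.assoc)
    finally show "[j * p ^ k = (j mod p ^ (s - k)) * p ^ k] (mod q)"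
      unfolding q_split[OF assms] by (simp add: cong_def)
  qed
  moreover have "j mod p ^ (s - k) < p ^ (s - k)" for j using prime_gt_0_nat[OF p(1)] by simp
  ultimately show ?thesis unfolding H_eq by blast
qed

lemma norm_H:
  assumes k: "k \<le> s" and x: "x \<in> L"
  shows "norm_over (H k) x = (\<Prod>j<p ^ (s - k). (g ^^ (j * p ^ k)) x)"
proof -
  have "inj_on (\<lambda>j. \<gamma> (j * p ^ k)) {..<p ^ (s - k)}"
  proof (rule inj_onI)
    fix i j assume ij: "i \<in> {..<p ^ (s - k)}" "j \<in> {..<p ^ (s - k)}" "\<gamma> (i * p ^ k) = \<gamma> (j * p ^ k)"
    have "l * p ^ k < q" if "l < p ^ (s - k)" for l
      unfolding q_split[OF k, symmetric] using that prime_gt_0_nat[OF p(1)] by simp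
    then have "i * p ^ k = j * p ^ k" using \<gamma>_inj[OF ij(3)] ij by (simp add: cong_def)
    then show "i = j" using prime_gt_0_nat[OF p(1)] by simp
  qed
  then show ?thesis unfolding norm_over_def H_finite[OF k] by (simp add: prod.reindex \<gamma>_apply x)
qed

text \<open>The left cosets of the subgroup correspond to exponents modulo p^k, and x, being fixed
  by the subgroup, takes one value on each coset.\<close>

lemma trace_H:
  assumes k: "k \<le> s" and x: "x \<in> L" "(g ^^ (p ^ k)) x = x"
  shows "trace_mod G (H k) x = (\<Sum>i<p ^ k. (g ^^ i) x)"
proof -
  define C where "C i = range (\<lambda>j. \<gamma> (i + j * p ^ k))" for i
  have coset: "\<gamma> i <#\<^bsub>G\<^esub> H k = C i" for i
    by (auto simp: l_coset_def H_eq C_def mult_G)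
  have C_mod: "C i = C (i mod p ^ k)" for i
  proof -
    have "\<gamma> (i + j * p ^ k) = \<gamma> (i mod p ^ k + (j + i div p ^ k) * p ^ k)" for j
    proof -
      have "i mod p ^ k + (j + i div p ^ k) * p ^ k = i mod p ^ k + i div p ^ k * p ^ k + j * p ^ k"
        by (simp only: distrib_right add_ac)
      then show ?thesis by (simp only: mod_div_mult_eq)
    qed
    \<comment> \<open>Modulo p^(s-k) the factor p^(s-k) - 1 acts as -1, so it subtracts i div p^k
      without leaving the naturals.\<close>
    moreover have "\<gamma> (i mod p ^ k + j * p ^ k) = \<gamma> (i + (j + (p ^ (s - k) - 1) * (i div p ^ k)) * p ^ k)" for j
    proof (rule \<gamma>_cong)
      let ?d = "i div p ^ k"
      have "i + (j + (p ^ (s - k) - 1) * ?d) * p ^ k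
          = (i mod p ^ k + ?d * p ^ k) + (j + (p ^ (s - k) - 1) * ?d) * p ^ k"
        by (simp only: mod_div_mult_eq)
      also have "\<dots> = i mod p ^ k + j * p ^ k + (1 + (p ^ (s - k) - 1)) * ?d * p ^ k"
        by (simp only: distrib_right mult_1 add_ac)
      also have "1 + (p ^ (s - k) - 1) = p ^ (s - k)" using prime_gt_0_nat[OF p(1)] by simp
      also have "p ^ (s - k) * ?d * p ^ k = ?d * q" unfolding q_split[OF k, symmetric] by (simp add: mult_ac)
      finally show "[i mod p ^ k + j * p ^ k = i + (j + (p ^ (s - k) - 1) * ?d) * p ^ k] (mod q)"
        by (simp add: cong_def)
    qed
    ultimately show ?thesis unfolding C_def by blast
  qed
  have "lcosets\<^bsub>G\<^esub> (H k) = C ` {..<p ^ k}"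
  proof -
    have "lcosets\<^bsub>G\<^esub> (H k) = C ` {..<q}" by (auto simp: LCOSETS_def carrier_G coset)
    also have "\<dots> = C ` {..<p ^ k}"
    proof (intro subset_antisym subsetI)
      fix Y assume "Y \<in> C ` {..<q}"
      then obtain i where "Y = C (i mod p ^ k)" using C_mod by blast
      then show "Y \<in> C ` {..<p ^ k}" using prime_gt_0_nat[OF p(1)] by auto
    next
      have "p ^ k \<le> q" unfolding q_def using k prime_gt_0_nat[OF p(1)] by (simp add: power_increasing)
      then show "Y \<in> C ` {..<q}" if "Y \<in> C ` {..<p ^ k}" for Y using that by auto
    qed
    finally show ?thesis .
  qed
  moreover have "inj_on C {..<p ^ k}"
  proof (rule inj_onI)
    fix i l assume i: "i \<in> {..<p ^ k}" "l \<in> {..<p ^ k}" "C i = C l"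
    have "\<gamma> (i + 0 * p ^ k) \<in> C i" unfolding C_def by blast
    then obtain j where "\<gamma> i = \<gamma> (l + j * p ^ k)" unfolding i(3) by (auto simp: C_def)
    then have "[i = l + j * p ^ k] (mod q)" by (rule \<gamma>_inj)
    moreover have "p ^ k dvd q" unfolding q_split[OF k, symmetric] by simp
    ultimately have "[i = l + j * p ^ k] (mod p ^ k)" by (rule cong_dvd_modulus_nat)
    then show "i = l" using i by (simp add: cong_def)
  qed
  moreover have "the_elem ((\<lambda>h. h x) ` C i) = (g ^^ i) x" for i
  proof -
    have "(g ^^ (i + j * p ^ k)) x = (g ^^ i) x" for j
      using funpow_fix_mult[OF x(2), of j] by (simp add: funpow_add mult.commute)
    then have "(\<lambda>h. h x) ` C i = {(g ^^ i) x}"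
      using x(1) by (simp add: C_def image_image \<gamma>_apply)
    then show ?thesis by simp
  qed
  ultimately show ?thesis by (simp add: trace_mod_def sum.reindex)
qed

end

section \<open>The numerical functions\<close>

context
  fixes p r n :: nat
  assumes p: "prime p" "odd p" and r: "r \<ge> 1"
begin

lemma p_ge_3: "p \<ge> 3"
proof -
  have "p \<noteq> 2" using p(2) by auto
  then show ?thesis using prime_ge_2_nat[OF p(1)] by linarith
qed

lemma totient_eq: "totient (p ^ r) = p ^ r - p ^ (r - 1)"
  using r p(1) by (subst totient_prime_power) (auto simp: diff_mult_distrib2 simp flip: power_Suc2)

lemma power_r: "p ^ r = p * p ^ (r - 1)"
  using r by (simp flip: power_Suc)

text \<open>With m the floor of n / p^k, passing from k to k + 1 changes \<open>Phi_k\<close> by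
  \<phi>(p^r) minus (m - m div p). Its sign is therefore decided by a monotone function of
  m.\<close>

lemma diff_div_mono: "(m::nat) \<le> m' \<Longrightarrow> m - m div p \<le> m' - m' div p"
proof (induction m' rule: dec_induct)
  case (step m')
  have "Suc m' - Suc m' div p \<ge> m' - m' div p"
    using div_le_dividend[of m' p] by (simp add: div_Suc Suc_diff_le)
  with step show ?case by linarith
qed simp

lemma diff_div_gt: "p ^ r + 1 \<le> m \<Longrightarrow> totient (p ^ r) < m - m div p"
proof -
  assume "p ^ r + 1 \<le> m"
  then have "p ^ r + 1 - (p ^ r + 1) div p \<le> m - m div p" by (rule diff_div_mono)
  moreover have "(p ^ r + 1) div p = p ^ (r - 1)"
  proof -
    have "p ^ r + 1 = 1 + p ^ (r - 1) * p" unfolding power_r by simp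
    then show ?thesis using p_ge_3 by (simp only: div_mult_self1) simp
  qed
  moreover have "p ^ (r - 1) \<le> p ^ r" using p_ge_3 unfolding power_r by simp
  ultimately show ?thesis unfolding totient_eq by linarith
qed

text \<open>The two values of m at which consecutive \<open>Phi_k\<close> agree. The floor of n /
  p^k takes one of them exactly when n is at least p^(r+k) - p^k and below p^(r+k) + p^k: the
  transitional window has this origin.\<close>

lemma diff_div_eq:
  assumes "m = p ^ r - 1 \<or> m = p ^ r" shows "m - m div p = totient (p ^ r)"
proof -
  have pos: "p ^ (r - 1) \<ge> 1" using p_ge_3 by simp
  have "(p ^ r - 1) div p = p ^ (r - 1) - 1"
  proof -
    obtain y where y: "p ^ (r - 1) = Suc y" using pos by (metis Suc_le_D One_nat_def)
    have "p ^ r - 1 = (p - 1) + y * p" using p_ge_3 unfolding power_r y by (simp add: mult.commute)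
    then have "(p ^ r - 1) div p = y + (p - 1) div p" using p_ge_3 by (simp only: div_mult_self1)
    then show ?thesis using p_ge_3 unfolding y by simp
  qed
  moreover have "p ^ r div p = p ^ (r - 1)" using p_ge_3 unfolding power_r by simp
  ultimately show ?thesis using assms pos unfolding totient_eq by auto
qed

lemma diff_div_lt: "m + 1 < p ^ r \<Longrightarrow> m - m div p < totient (p ^ r)"
proof -
  assume "m + 1 < p ^ r"
  then have "m - m div p \<le> (p ^ r - 2) - (p ^ r - 2) div p" by (intro diff_div_mono) simp
  moreover have pos: "p ^ (r - 1) \<ge> 1" using p_ge_3 by simp
  moreover have "(p ^ r - 2) div p = p ^ (r - 1) - 1"
  proof -
    obtain y where y: "p ^ (r - 1) = Suc y" using pos by (metis Suc_le_D One_nat_def)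
    have "p ^ r - 2 = (p - 2) + y * p" using p_ge_3 unfolding power_r y by (simp add: mult.commute)
    then have "(p ^ r - 2) div p = y + (p - 2) div p" using p_ge_3 by (simp only: div_mult_self1)
    then show ?thesis using p_ge_3 unfolding y by simp
  qed
  moreover have "p ^ (r - 1) * 3 \<le> p ^ r"
    unfolding power_r using p_ge_3 by (subst mult.commute) (rule mult_le_mono1)
  ultimately show ?thesis unfolding totient_eq by linarith
qed

section \<open>Variation of the exponents with k and the position of the minimum\<close>

lemma Phi_k_Suc:
  "Phi_k p r (Suc k) n + (n div p ^ k - n div p ^ k div p) = Phi_k p r k n + totient (p ^ r)"
proof -
  have "n div p ^ Suc k = n div p ^ k div p" by (simp only: power_Suc2 div_mult2_eq)
  then show ?thesis using div_le_dividend[of "n div p ^ k" p] by (simp add: Phi_k_def)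
qed

lemma Phi_k_decreases: "p ^ (r + k) + p ^ k \<le> n \<Longrightarrow> Phi_k p r (Suc k) n < Phi_k p r k n"
proof -
  assume "p ^ (r + k) + p ^ k \<le> n"
  then have "(p ^ r + 1) * p ^ k \<le> n" by (simp add: power_add)
  then have "p ^ r + 1 \<le> n div p ^ k" using p_ge_3 by (simp add: less_eq_div_iff_mult_less_eq)
  from diff_div_gt[OF this] show ?thesis using Phi_k_Suc[of k] by linarith
qed

lemma Phi_k_increases: "n < p ^ (r + k) - p ^ k \<Longrightarrow> Phi_k p r k n < Phi_k p r (Suc k) n"
proof -
  assume "n < p ^ (r + k) - p ^ k"
  then have "n < (p ^ r - 1) * p ^ k" by (simp add: power_add diff_mult_distrib)
  then have "n div p ^ k < p ^ r - 1" using p_ge_3 by (simp add: div_less_iff_less_mult)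
  then have "n div p ^ k + 1 < p ^ r" by linarith
  from diff_div_lt[OF this] show ?thesis using Phi_k_Suc[of k] by linarith
qed

lemma Phi_k_constant:
  "p ^ (r + k) - p ^ k \<le> n \<Longrightarrow> n < p ^ (r + k) + p ^ k \<Longrightarrow> Phi_k p r (Suc k) n = Phi_k p r k n"
proof -
  assume "p ^ (r + k) - p ^ k \<le> n" "n < p ^ (r + k) + p ^ k"
  then have "(p ^ r - 1) * p ^ k \<le> n" "n < (p ^ r + 1) * p ^ k"
    by (simp_all add: power_add diff_mult_distrib)
  then have "p ^ r - 1 \<le> n div p ^ k" "n div p ^ k < p ^ r + 1"
    using p_ge_3 by (simp_all add: less_eq_div_iff_mult_less_eq div_less_iff_less_mult)
  then have "n div p ^ k = p ^ r - 1 \<or> n div p ^ k = p ^ r" by linarith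
  from diff_div_eq[OF this] show ?thesis using Phi_k_Suc[of k] by linarith
qed

lemma weight_bound: "n < p ^ (r + weight p r n) + p ^ weight p r n"
  unfolding weight_def
proof (rule LeastI)
  have "n < p ^ n" using p_ge_3 by (intro power_gt_expt) simp
  then show "n < p ^ (r + n) + p ^ n" by simp
qed

lemma weight_least: "k < weight p r n \<Longrightarrow> p ^ (r + k) + p ^ k \<le> n"
  unfolding weight_def by (drule not_less_Least) simp

text \<open>The transitional windows of consecutive k are disjoint: p^r + 1 <= p (p^r - 1) because p
  >= 3. So n lies below every window after the one of its weight.\<close>

lemma Phi_k_strict_after_weight:
  assumes "weight p r n < k" shows "Phi_k p r k n < Phi_k p r (Suc k) n"
proof (rule Phi_k_increases)
  let ?w = "weight p r n"
  have "p ^ (r + ?w) + p ^ ?w = (p ^ r + 1) * p ^ ?w" by (simp add: power_add)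
  also have "p ^ r + 1 \<le> p * (p ^ r - 1)"
  proof -
    have "p ^ 1 \<le> p ^ r" using r p_ge_3 by (intro power_increasing) auto
    then have "p ^ r + 1 \<le> 3 * (p ^ r - 1)" using p_ge_3 by simp
    also have "\<dots> \<le> p * (p ^ r - 1)" using p_ge_3 by (rule mult_le_mono1)
    finally show ?thesis .
  qed
  then have "(p ^ r + 1) * p ^ ?w \<le> p * (p ^ r - 1) * p ^ ?w" by (rule mult_le_mono1)
  also have "\<dots> = (p ^ r - 1) * p ^ Suc ?w" by simp
  also have "\<dots> \<le> (p ^ r - 1) * p ^ k"
    using assms p_ge_3 by (intro mult_le_mono2 power_increasing) auto
  also have "\<dots> = p ^ (r + k) - p ^ k" by (simp add: power_add diff_mult_distrib)
  finally show "n < p ^ (r + k) - p ^ k" using weight_bound by linarith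
qed

lemma Phi_k_before_weight: "k < weight p r n \<Longrightarrow> Phi_k p r (weight p r n) n < Phi_k p r k n"
proof (induction k rule: strict_inc_induct)
  case (base i)
  then show ?case using Phi_k_decreases[OF weight_least, of i] by simp
next
  case (step i)
  then have "i < weight p r n" by simp
  then show ?case using Phi_k_decreases[OF weight_least, of i] step by linarith
qed

lemma Phi_k_after_weight:
  "weight p r n + 1 < k \<Longrightarrow> Phi_k p r (weight p r n + 1) n < Phi_k p r k n"
proof (induction k)
  case (Suc k)
  then show ?case
    using Phi_k_strict_after_weight[of k] by (cases "k = weight p r n + 1") auto
qed simp

lemma Phi_k_weight_Suc:
  "Phi_k p r (weight p r n) n \<le> Phi_k p r (weight p r n + 1) n"
  "Phi_k p r (weight p r n + 1) n = Phi_k p r (weight p r n) n \<longleftrightarrow> transitional p r n"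
  "ordinary p r n \<longleftrightarrow> \<not> transitional p r n"
proof -
  let ?w = "weight p r n"
  consider "n < p ^ (r + ?w) - p ^ ?w" | "p ^ (r + ?w) - p ^ ?w \<le> n" by linarith
  then have "Phi_k p r ?w n \<le> Phi_k p r (?w + 1) n \<and>
    (Phi_k p r (?w + 1) n = Phi_k p r ?w n \<longleftrightarrow> transitional p r n) \<and>
    (ordinary p r n \<longleftrightarrow> \<not> transitional p r n)"
  proof cases
    case 1
    then show ?thesis using Phi_k_increases[OF 1] by (simp add: transitional_def ordinary_def)
  next
    case 2
    then show ?thesis
      using Phi_k_constant[OF 2 weight_bound] weight_bound by (simp add: transitional_def ordinary_def)
  qed
  then show "Phi_k p r ?w n \<le> Phi_k p r (?w + 1) n"
    "Phi_k p r (?w + 1) n = Phi_k p r ?w n \<longleftrightarrow> transitional p r n"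
    "ordinary p r n \<longleftrightarrow> \<not> transitional p r n" by blast+
qed

lemma Phi_eq: "Phi p r n = Phi_k p r (weight p r n) n"
  unfolding Phi_def
proof (rule antisym)
  show "(INF k. Phi_k p r k n) \<le> Phi_k p r (weight p r n) n" by (intro cINF_lower) auto
  show "Phi_k p r (weight p r n) n \<le> (INF k. Phi_k p r k n)"
  proof (rule cINF_greatest)
    fix k
    consider "k < weight p r n" | "k = weight p r n" | "k = weight p r n + 1" | "weight p r n + 1 < k"
      by linarith
    then show "Phi_k p r (weight p r n) n \<le> Phi_k p r k n"
      using Phi_k_before_weight[of k] Phi_k_after_weight[of k] Phi_k_weight_Suc(1)
      by cases (auto intro: less_imp_le order.trans)
  qed simp
qed

lemma Phi_le: "Phi p r n \<le> Phi_k p r k n"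
  unfolding Phi_def by (intro cINF_lower) auto

text \<open>\<open>Phi_k\<close> decreases strictly up to the weight w, is constant or increases on
  the next step, and increases strictly from w + 1 on; only w and w + 1 can attain the
  minimum.\<close>

lemma Phi_minimizers:
  "{k. Phi_k p r k n = Phi p r n} =
     (if transitional p r n then {weight p r n, weight p r n + 1} else {weight p r n})"
proof -
  have "Phi_k p r k n = Phi p r n \<longleftrightarrow> k = weight p r n \<or> k = weight p r n + 1 \<and> transitional p r n" for k
  proof -
    consider "k < weight p r n" | "k = weight p r n" | "k = weight p r n + 1" | "weight p r n + 1 < k"
      by linarith
    then show ?thesis
      unfolding Phi_eq
      using Phi_k_before_weight[of k] Phi_k_after_weight[of k] Phi_k_weight_Suc by cases auto
  qed
  then show ?thesis by auto
qed

text \<open>The upper bound on n enters here: w < s keeps w + 1 <= s, so in the transitional case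
  both minimising k still belong to subgroups of the Galois group of index p^k.\<close>

lemma weight_less:
  assumes "s \<ge> 1" "n < p ^ (r + s - 1)"
  shows "weight p r n < s"
proof -
  have "n < p ^ (r + (s - 1)) + p ^ (s - 1)" using assms by simp
  then have "weight p r n \<le> s - 1" unfolding weight_def by (rule Least_le)
  then show ?thesis using assms by simp
qed

text \<open>If 2 n >= p^k, doubling n increases the floor of n / p^k. Otherwise k > 0, and for l = k
  - 1 the floor m of n / p^l satisfies 2 m < p, so m + 1 <= p - 1 <= \<phi>(p^r): the step from l to
  k costs more than the lost floor.\<close>

lemma Phi_less_double:
  assumes "n \<ge> 1" shows "Phi p r n + 1 \<le> k * totient (p ^ r) + n * 2 div p ^ k"
proof (cases "n * 2 < p ^ k")
  case True
  then obtain l where k: "k = Suc l" using assms by (cases k) auto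
  define m where "m = n div p ^ l"
  have "m * p ^ l \<le> n" unfolding m_def by simp
  then have "m * p ^ l * 2 \<le> n * 2" by (rule mult_le_mono1)
  also have "\<dots> < p * p ^ l" using True unfolding k by simp
  finally have "m * 2 * p ^ l < p * p ^ l" by (simp only: mult_ac)
  then have "m * 2 < p" by (simp only: mult_less_cancel2)
  moreover have "p - 1 \<le> totient (p ^ r)"
  proof -
    have "(p - 1) * 1 \<le> (p - 1) * p ^ (r - 1)" using p_ge_3 by (intro mult_le_mono2) simp
    then show ?thesis unfolding totient_eq unfolding power_r by (simp add: diff_mult_distrib)
  qed
  moreover have "Phi p r n \<le> l * totient (p ^ r) + m" using Phi_le[of l] by (simp add: Phi_k_def m_def)
  ultimately show ?thesis using p_ge_3 by (simp add: k)
next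
  case False
  have "n div p ^ k + 1 \<le> n * 2 div p ^ k"
  proof (cases "n div p ^ k = 0")
    case True
    have "1 \<le> n * 2 div p ^ k" using False p_ge_3 by (subst less_eq_div_iff_mult_less_eq) auto
    then show ?thesis using True by simp
  next
    case False
    have "(n div p ^ k * 2) * p ^ k \<le> n * 2" by simp
    then have "n div p ^ k * 2 \<le> n * 2 div p ^ k" using p_ge_3 by (simp add: less_eq_div_iff_mult_less_eq)
    then show ?thesis using False by linarith
  qed
  then show ?thesis using Phi_le[of k] by (simp add: Phi_k_def)
qed

end

section \<open>The main theorem\<close>

text \<open>Below exponent q the powers of u do not wrap around, so no factor \<open>c\<close>
  arises.\<close>

lemma (in cyclic_extension) cyclic_gen_power:
  "j < q \<Longrightarrow> cyclic_gen [^]\<^bsub>D\<^esub> j = (\<lambda>i. if i = j then 1 else 0)"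
proof (induction j)
  case 0
  then show ?case by (auto simp: D_ops cyclic_embed_def)
next
  case (Suc j)
  then have IH: "cyclic_gen [^]\<^bsub>D\<^esub> j = (\<lambda>i. if i = j then 1 else (0::'b))" by simp
  show ?case
  proof
    fix k
    show "(cyclic_gen [^]\<^bsub>D\<^esub> Suc j) k = (if k = Suc j then 1 else 0)"
    proof (cases "k < q")
      case True
      have "(cyclic_gen [^]\<^bsub>D\<^esub> Suc j) k = (\<Sum>i<q. (if i = j then 1 else 0) * rep cyclic_gen $$ (i, k))"
        by (simp add: IH mult_D[OF True])
      also have "\<dots> = (\<Sum>i<q. if i = j then rep cyclic_gen $$ (i, k) else 0)"
        by (intro sum.cong refl) simp
      also have "\<dots> = rep cyclic_gen $$ (j, k)" using Suc.prems by simp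
      also have "\<dots> = (if k = Suc j then 1 else 0)"
        using Suc.prems True
        by (auto simp: rep_index cyclic_gen_def cyclic_diff_eq funpow_zero funpow_one)
      finally show ?thesis .
    next
      case False
      then show ?thesis using Suc.prems by (simp add: IH mult_D_ge)
    qed
  qed
qed

lemma (in norm_expansion) element_eq:
  "\<one>\<^bsub>D\<^esub> \<oplus>\<^bsub>D\<^esub> cyclic_embed ((1 - z) ^ n) \<otimes>\<^bsub>D\<^esub>
      (\<Oplus>\<^bsub>D\<^esub>j\<in>{..<q}. cyclic_embed (b j) \<otimes>\<^bsub>D\<^esub> cyclic_gen [^]\<^bsub>D\<^esub> j)
    = (\<lambda>j. (if j = 0 then 1 else 0) + coef j)"
proof -
  have u: "(\<lambda>i. if i = j then 1 else 0) \<in> carrier D" if "j < q" for j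
    using that by (auto simp: carrier_D L.zero_mem L.one_mem)
  have bL: "b j \<in> L" if "j < q" for j using b_mem[OF that] B_subset_L by blast
  have prod: "cyclic_embed (b j) \<otimes>\<^bsub>D\<^esub> cyclic_gen [^]\<^bsub>D\<^esub> j = (\<lambda>i. b j * (if i = j then 1 else 0))"
    if "j < q" for j
    unfolding cyclic_gen_power[OF that] by (rule embed_mult_D[OF u[OF that]])
  have mem: "cyclic_embed (b j) \<otimes>\<^bsub>D\<^esub> cyclic_gen [^]\<^bsub>D\<^esub> j \<in> carrier D" if "j < q" for j
    unfolding cyclic_gen_power[OF that]
    by (intro mult_D_closed cyclic_embed_closed bL u that)
  have "(\<Oplus>\<^bsub>D\<^esub>j\<in>{..<q}. cyclic_embed (b j) \<otimes>\<^bsub>D\<^esub> cyclic_gen [^]\<^bsub>D\<^esub> j)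
      = (\<lambda>i. \<Sum>j<q. b j * (if i = j then 1 else 0))"
    using mem by (subst finsum_D) (auto simp: prod)
  also have "\<dots> = (\<lambda>i. if i < q then b i else 0)"
    by (rule ext) (simp add: if_distrib cong: if_cong)
  finally have sum: "(\<Oplus>\<^bsub>D\<^esub>j\<in>{..<q}. cyclic_embed (b j) \<otimes>\<^bsub>D\<^esub> cyclic_gen [^]\<^bsub>D\<^esub> j)
      = (\<lambda>i. if i < q then b i else 0)" .
  have "(\<lambda>i. if i < q then b i else 0) \<in> carrier D" using bL by (simp add: carrier_D)
  then show ?thesis
    unfolding sum by (subst embed_mult_D) (auto simp: D_ops cyclic_embed_def coef_def fun_eq_iff)
qed

locale norm_galois = norm_expansion p r s A B K L z c g n b + cyclic_galois p r s A B K L z c g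
  for p r s :: nat and A B K L :: "'b::field set" and z c :: 'b and g :: "'b \<Rightarrow> 'b"
    and n :: nat and b :: "nat \<Rightarrow> 'b"
begin

text \<open>The norm is a product over one full cycle of \<open>g\<close> to the power p^k, hence
  fixed by it, and this is what the coset description of the trace requires.\<close>

lemma trace_norm_eq:
  assumes k: "k \<le> s" and v: "v < p ^ (s - k)"
  shows "c ^ v * trace_mod G (H k) (norm_over (H k) ((1 - z) ^ n * b (p ^ k * v))) = norm_term k v"
proof -
  have "p ^ k * v < p ^ k * p ^ (s - k)" using v prime_gt_0_nat[OF p(1)] by simp
  also have "p ^ k * p ^ (s - k) = q" using q_split[OF k] by (simp only: mult.commute)
  finally have coef: "(1 - z) ^ n * b (p ^ k * v) = coef (p ^ k * v)" by (simp only: coef_def if_True)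
  define x where "x = coef (p ^ k * v)"
  have x: "x \<in> L" unfolding x_def by (rule coef_L)
  define N where "N = (\<Prod>j<p ^ (s - k). (g ^^ (j * p ^ k)) x)"
  have N: "N \<in> L" unfolding N_def by (intro L.prod_mem funpow_closed x)
  have "(g ^^ (p ^ k)) N = (\<Prod>j<p ^ (s - k). (g ^^ (Suc j * p ^ k)) x)"
    unfolding N_def using x by (subst funpow_prod_hom) (auto simp: funpow_closed funpow_add)
  also have "\<dots> = N"
    unfolding N_def
    by (rule prod_shift_invariant[of "\<lambda>j. (g ^^ (j * p ^ k)) x"]) (simp add: q_split[OF k] funpow_q x)
  finally have "(g ^^ (p ^ k)) N = N" .
  then have "trace_mod G (H k) N = (\<Sum>i<p ^ k. (g ^^ i) N)" by (rule trace_H[OF k N])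
  moreover have "norm_over (H k) x = N" unfolding N_def by (rule norm_H[OF k x])
  ultimately show ?thesis unfolding coef norm_term_def by (simp add: N_def x_def)
qed

text \<open>For k outside \<open>M\<close> the exponent \<Phi>_k(n) exceeds the minimum by at least
  one, so these norm terms vanish modulo the ideal, together with all \<open>E k\<close>.\<close>

lemma reduced_norm_congruence:
  assumes n: "1 \<le> n" "n < p ^ (r + s - 1)"
  defines "M \<equiv> {k. Phi_k p r k n = Phi p r n}"
  shows "(reduced_norm K cyclic_embed D (\<lambda>j. (if j = 0 then 1 else 0) + coef j) - 1)
      - (\<Sum>k\<in>M. \<Sum>v<p ^ (s - k). norm_term k v) \<in> ideal (Phi p r n + 1)"
    and "\<And>k. k \<in> M \<Longrightarrow> k \<le> s"
proof -
  let ?f = "\<lambda>k. \<Sum>v<p ^ (s - k). norm_term k v"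
  have "weight p r n < s" by (rule weight_less[OF p r s n(2)])
  then show M: "k \<le> s" if "k \<in> M" for k
    using that unfolding M_def Phi_minimizers[OF p r] by (auto split: if_splits)
  obtain E where E: "\<And>k. k \<le> s \<Longrightarrow> E k \<in> ideal (k * totient (p ^ r) + n * 2 div p ^ k)"
    "det (rep (\<lambda>j. (if j = 0 then 1 else 0) + coef j)) - 1 = (\<Sum>k\<le>s. ?f k + E k)"
    using det_congruence by blast
  have "cyclic_embed 1 \<in> carrier D" by (rule cyclic_embed_closed[OF L.one_mem])
  from D.add.m_closed[OF this coef_carrier]
  have "(\<lambda>j. (if j = 0 then 1 else 0) + coef j) \<in> carrier D"
    by (simp add: D_ops(3) cyclic_embed_def)
  then have "reduced_norm K cyclic_embed D (\<lambda>j. (if j = 0 then 1 else 0) + coef j) - 1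
      = (\<Sum>k\<le>s. ?f k) + (\<Sum>k\<le>s. E k)"
    using E(2) by (simp add: reduced_norm_D sum.distrib)
  also have "(\<Sum>k\<le>s. ?f k) = (\<Sum>k\<in>{..s} - M. ?f k) + (\<Sum>k\<in>M. ?f k)"
    using M by (intro sum.subset_diff) auto
  finally have "(reduced_norm K cyclic_embed D (\<lambda>j. (if j = 0 then 1 else 0) + coef j) - 1)
      - (\<Sum>k\<in>M. ?f k) = (\<Sum>k\<in>{..s} - M. ?f k) + (\<Sum>k\<le>s. E k)" by simp
  moreover have "(\<Sum>k\<le>s. E k) \<in> ideal (Phi p r n + 1)"
    using Phi_less_double[OF p r n(1)] E(1) by (intro ideal_sum) (auto intro: ideal_mono)
  moreover have "(\<Sum>k\<in>{..s} - M. ?f k) \<in> ideal (Phi p r n + 1)"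
  proof (intro ideal_sum)
    fix k v assume k: "k \<in> {..s} - M" and v: "v \<in> {..<p ^ (s - k)}"
    have "Phi p r n + 1 \<le> Phi_k p r k n"
      using Phi_le[OF p r, of n k] k by (auto simp: M_def)
    then show "norm_term k v \<in> ideal (Phi p r n + 1)"
      using norm_term_mem[of k v] k v by (auto simp: Phi_k_def intro: ideal_mono)
  qed
  ultimately show "(reduced_norm K cyclic_embed D (\<lambda>j. (if j = 0 then 1 else 0) + coef j) - 1)
      - (\<Sum>k\<in>M. ?f k) \<in> ideal (Phi p r n + 1)" by (simp add: ideal_add)
qed

end

lemma primitive_root_of_unity_fls_const:
  "primitive_root_of_unity N (fls_const x) \<longleftrightarrow> primitive_root_of_unity N x"
  by (simp add: primitive_root_of_unity_def flip: fls_const_power)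

theorem mainTheorem3:
  fixes p r s n :: nat
    and Qp F \<O> :: "'a::field_char_0 set" and av :: "'a \<Rightarrow> real" and \<zeta> :: "nat \<Rightarrow> 'a"
    and A B qA qB :: "'a fls set" and \<pi> :: "nat \<Rightarrow> 'a fls"
    and G :: "('a fls \<Rightarrow> 'a fls) monoid" and g :: "'a fls \<Rightarrow> 'a fls"
    and Gp :: "nat \<Rightarrow> ('a fls \<Rightarrow> 'a fls) set"
    and D :: "(nat \<Rightarrow> 'a fls) ring" and b :: "nat \<Rightarrow> 'a fls" and d :: "nat \<Rightarrow> 'a fls"
    and t :: "nat \<Rightarrow> nat \<Rightarrow> 'a fls"
  assumes p: "prime p" "odd p" and r: "r \<ge> 1" and s: "s \<ge> 1"
    and Qp: "padic_field p Qp av"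
    and F: "finite_unramified_extension p Qp av F"
    and O: "\<O> = ring_of_integers Qp av F"
    and zeta: "\<zeta> 0 = 1" "\<And>m. \<zeta> (Suc m) ^ p = \<zeta> m" "\<And>m. primitive_root_of_unity (p ^ m) (\<zeta> m)"
    and pi: "\<And>m. \<pi> m = fls_const (1 - \<zeta> m)"
    and A: "A = power_series_ring (adjoin \<O> (\<zeta> r))"
    and B: "B = power_series_ring (adjoin \<O> (\<zeta> (r + s)))"
    and qA: "qA = fraction_field A" and qB: "qB = fraction_field B"
    and G: "G = galois_group qB qA"
    and g: "g \<in> carrier G" "g (fls_const (\<zeta> (r + s))) = fls_const (\<zeta> (r + s)) ^ (1 + p ^ r)"
    and Gp: "\<And>k. Gp k = generate G {g [^]\<^bsub>G\<^esub> (p ^ k)}"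
    and D: "D = cyclic_algebra qB g (p ^ s) (1 + fls_X)"
    and n: "1 \<le> n" "n < p ^ (r + s - 1)"
    and b: "\<And>j. j < p ^ s \<Longrightarrow> b j \<in> B"
    and d: "d = \<one>\<^bsub>D\<^esub> \<oplus>\<^bsub>D\<^esub> cyclic_embed (\<pi> (r + s) ^ n) \<otimes>\<^bsub>D\<^esub>
              (\<Oplus>\<^bsub>D\<^esub>j\<in>{..<p ^ s}. cyclic_embed (b j) \<otimes>\<^bsub>D\<^esub> cyclic_gen [^]\<^bsub>D\<^esub> j)"
    and t: "\<And>k v. t k v = (1 + fls_X) ^ v *
              trace_mod G (Gp k) (norm_over (Gp k) (\<pi> (r + s) ^ n * b (p ^ k * v)))"
  shows "(reduced_norm qA cyclic_embed D d - 1)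
           - (\<Sum>k | Phi_k p r k n = Phi p r n. \<Sum>v<p ^ (s - k). t k v)
           \<in> (\<lambda>a. \<pi> r ^ (Phi p r n + 1) * a) ` A
         \<and> (\<forall>k v. Phi_k p r k n = Phi p r n \<and> v < p ^ (s - k) \<longrightarrow>
              t k v \<in> (\<lambda>a. \<pi> r ^ Phi p r n * a) ` A)
         \<and> (ordinary p r n \<longrightarrow> {k. Phi_k p r k n = Phi p r n} = {weight p r n})
         \<and> (transitional p r n \<longrightarrow>
              {k. Phi_k p r k n = Phi p r n} = {weight p r n, weight p r n + 1})"
proof -
  define z where "z = fls_const (\<zeta> (r + s))"
  have p0: "p > 0" using prime_gt_0_nat[OF p(1)] .
  have zeta_pow: "\<zeta> (m + k) ^ (p ^ k) = \<zeta> m" for m k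
    by (induction k) (simp_all add: power_mult zeta(2))
  have zeta_q: "\<zeta> (r + s) ^ (p ^ s) = \<zeta> r" by (rule zeta_pow)
  have ring_O: "unital_subring \<O>"
    unfolding O ring_of_integers_def using F
    by (intro unital_subring_integral_closure unital_subring_padic_integers[OF Qp p(1)]
          unital_subring_subfield) (simp add: finite_unramified_extension_def)
  note ring_Or = unital_subring_adjoin[OF ring_O, of "\<zeta> r"]
  note ring_Ors = unital_subring_adjoin[OF ring_O, of "\<zeta> (r + s)"]
  have sub: "adjoin \<O> (\<zeta> r) \<subseteq> adjoin \<O> (\<zeta> (r + s))"
    unfolding zeta_q[symmetric]
    by (intro adjoin_subset ring_Ors unital_subring.power_mem[OF ring_Ors] adjoin_gen_mem[OF ring_O])
       (auto intro: adjoin_base_mem[OF ring_O])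
  have g_G: "g \<in> Bij qB" "\<And>x y. x \<in> qB \<Longrightarrow> y \<in> qB \<Longrightarrow> g (x + y) = g x + g y \<and> g (x * y) = g x * g y"
    "\<And>x. x \<in> qA \<Longrightarrow> g x = x"
    using g(1) by (auto simp: G galois_group_def)
  \<comment> \<open>Since the p^s-th power of \<open>\<zeta> (r + s)\<close> is
    \<open>\<zeta> r\<close>, exponents reduce modulo p^s over the smaller ring, coefficient by
    coefficient of the series.\<close>
  have B_exp: "\<exists>a. (\<forall>t. a t \<in> A) \<and> x = (\<Sum>t<p ^ s. a t * z ^ t)" if xB: "x \<in> B" for x
  proof -
    have "\<exists>a. (\<forall>t. a t \<in> adjoin \<O> (\<zeta> r)) \<and> y = (\<Sum>t<p ^ s. a t * \<zeta> (r + s) ^ t)"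
      if y: "y \<in> adjoin \<O> (\<zeta> (r + s))" for y
    proof -
      obtain a where "\<And>t. a t \<in> adjoin \<O> (\<zeta> (r + s) ^ (p ^ s))"
        "y = (\<Sum>t<p ^ s. a t * \<zeta> (r + s) ^ t)"
        by (rule adjoin_expansion[OF ring_O y, of "p ^ s"]) (use p0 in auto)
      then show ?thesis unfolding zeta_q by blast
    qed
    then obtain a where "\<And>t. a t \<in> power_series_ring (adjoin \<O> (\<zeta> r))"
      "x = (\<Sum>t<p ^ s. a t * fls_const (\<zeta> (r + s)) ^ t)"
      using power_series_ring_expansion[OF xB[unfolded B]] by blast
    then show ?thesis unfolding A z_def by blast
  qed
  interpret A: unital_subring A unfolding A by (rule unital_subring_power_series_ring[OF ring_Or])
  interpret B: unital_subring B unfolding B by (rule unital_subring_power_series_ring[OF ring_Ors])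
  interpret norm_galois p r s A B qA qB z "1 + fls_X" g n b
  proof
    show "primitive_root_of_unity (p ^ (r + s)) z"
      unfolding z_def primitive_root_of_unity_fls_const by (rule zeta(3))
    show "z \<in> B" unfolding z_def B
      by (intro fls_const_mem_power_series_ring ring_Ors adjoin_gen_mem[OF ring_O])
    show "z ^ (p ^ s) \<in> A" unfolding z_def A fls_const_power[symmetric] zeta_q
      by (intro fls_const_mem_power_series_ring ring_Or adjoin_gen_mem[OF ring_O])
    show "g z = z ^ (1 + p ^ r)" unfolding z_def by (rule g(2))
    show "1 + fls_X \<in> A"
      using fls_X_mem_power_series_ring[OF ring_Or] by (intro A.add_mem A.one_mem) (simp add: A)
    show "1 + fls_X \<noteq> (0 :: 'a fls)"
    proof
      assume "1 + fls_X = (0 :: 'a fls)"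
      then have "fls_nth (1 + fls_X :: 'a fls) 0 = 0" by simp
      then show False by simp
    qed
    show "A \<subseteq> B" unfolding A B by (rule power_series_ring_mono[OF sub])
  qed (use p r s p0 qA qB g_G B_exp b Bij_imp_funcset[of g qB] in auto)
  have zs: "z ^ q = fls_const (\<zeta> r)" unfolding z_def q_def fls_const_power[symmetric] zeta_q ..
  have pi_z: "\<pi> (r + s) = 1 - z" "\<pi> r = 1 - z ^ q"
    unfolding pi zs by (simp_all add: z_def fls_minus_const[symmetric])
  have ideal_eq: "(\<lambda>a. \<pi> r ^ e * a) ` A = ideal e" for e by (simp add: ideal_def pi_z)
  have G_eq: "G = galois_group qB qA" by (rule G)
  have Gp_eq: "Gp k = H k" for k unfolding Gp H_def G_eq ..
  have D_eq: "D = cyclic_algebra qB g q (1 + fls_X)" unfolding D q_def ..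
  let ?M = "{k. Phi_k p r k n = Phi p r n}"
  note core = reduced_norm_congruence[OF n]
  have t_eq: "t k v = norm_term k v" if "k \<in> ?M" "v < p ^ (s - k)" for k v
    unfolding t Gp_eq G_eq pi_z by (rule trace_norm_eq[OF core(2)[OF that(1)] that(2)])
  have d_eq: "d = (\<lambda>j. (if j = 0 then 1 else 0) + coef j)"
    unfolding d D_eq pi_z q_def[symmetric] by (rule element_eq)
  have "(reduced_norm qA cyclic_embed D d - 1) - (\<Sum>k\<in>?M. \<Sum>v<p ^ (s - k). t k v)
      \<in> ideal (Phi p r n + 1)"
    using core(1) t_eq by (simp add: d_eq D_eq)
  moreover have "t k v \<in> ideal (Phi p r n)" if "k \<in> ?M" "v < p ^ (s - k)" for k v
    using norm_term_mem[OF core(2)[OF that(1)] that(2)] that by (simp add: t_eq Phi_k_def)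
  moreover have "ordinary p r n \<longrightarrow> ?M = {weight p r n}"
    "transitional p r n \<longrightarrow> ?M = {weight p r n, weight p r n + 1}"
    unfolding Phi_minimizers[OF p r] Phi_k_weight_Suc(3)[OF p r] by auto
  ultimately show ?thesis unfolding ideal_eq by simp
qed

end
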